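(* Let $M$ be a smooth Riemannian manifold. (a) For any $2\le p<\infty$ there is a constant $C=C(p)>0$ such that for any $\varepsilon>0$ and any $u\in C^\infty_{\mathrm{c}}(M)$ one has $$\|\mathrm{grad}(u)\|_p\le\frac{C}{\varepsilon}\|u\|_p+C\varepsilon\|\mathrm{Hess}(u)\|_p.$$ (b) Assume that either $M$ is geodesically complete or that $M$ is a relatively compact open subset of an arbitrary smooth Riemannian manifold. Then for any $1<p\le2$ there is a constant $C=C(p)>0$ such that for any $\varepsilon>0$ and any $u\in C^\infty_{\mathrm{c}}(M)$ one has $$\|\mathrm{grad}(u)\|_p\le\frac{C}{\varepsilon}\|u\|_p+C\varepsilon\|\Delta u\|_p.$$
   Context: Manifolds are smooth and without boundary. $C=C(p)$ means that the constant depends only on $p$, and on nothing else. $C^\infty_{\mathrm{c}}(M)$ is the space of smooth compactly supported functions on $M$. $\|\cdot\|_p$ are $\mathsf{L}^p$-norms with respect to the Riemannian volume measure, of functions or of pointwise norms of tensors (induced by the metric). $\mathrm{grad}(u)$ is the Riemannian gradient, $\mathrm{Hess}(u)=\nabla\mathrm{d}u$ with $\nabla$ the Levi-Civita connection, and $\Delta u=-\mathrm{tr}(\mathrm{Hess}(u))$.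
   Formalization: In (a) the constant C depends on p and on the dimension of M (uniform over all M of that dimension), since a constant depending only on p fails: take u=x_1 on the unit spheres S^n with ε=n^{-1/4} and let n grow. *)

theory Defs
  imports "HOL-Probability.Probability" "Jordan_Normal_Form.Gauss_Jordan_Elimination"
    "Jordan_Normal_Form.Determinant"
begin

text \<open>
  Constants that are uniform in the dimension require the dimension to be a natural number rather
  than a type. The model space of dimension \<open>n\<close> is therefore \<^term>\<open>powertop_real {..<n}\<close>, i.e. the
  extensional functions \<open>{..<n} \<rightarrow> real\<close>; it carries the Lebesgue measure
  \<^term>\<open>Pi\<^sub>M {..<n} (\<lambda>_. lborel)\<close>.
\<close>

abbreviation Rn :: "nat \<Rightarrow> (nat \<Rightarrow> real) topology"
  where "Rn n \<equiv> powertop_real {..<n}"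

subsection \<open>Smooth functions on open subsets of the model space\<close>

definition partial :: "nat \<Rightarrow> ((nat \<Rightarrow> real) \<Rightarrow> real) \<Rightarrow> (nat \<Rightarrow> real) \<Rightarrow> real"
  where "partial i f y = deriv (\<lambda>t. f (y(i := t))) (y i)"

text \<open>\<open>f\<close> is of class \<open>C\<^sup>k\<close> on the open set \<open>V\<close>; values of \<open>f\<close> outside \<open>V\<close> are irrelevant.\<close>

primrec Ck_on :: "nat \<Rightarrow> nat \<Rightarrow> (nat \<Rightarrow> real) set \<Rightarrow> ((nat \<Rightarrow> real) \<Rightarrow> real) \<Rightarrow> bool"
  where
    "Ck_on n 0 V f \<longleftrightarrow> continuous_map (subtopology (Rn n) V) euclideanreal f"
  | "Ck_on n (Suc k) V f \<longleftrightarrow>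
       continuous_map (subtopology (Rn n) V) euclideanreal f \<and>
       (\<forall>i<n. (\<forall>y\<in>V. (\<lambda>t. f (y(i := t))) differentiable (at (y i))) \<and>
              Ck_on n k V (partial i f))"

definition smooth_on :: "nat \<Rightarrow> (nat \<Rightarrow> real) set \<Rightarrow> ((nat \<Rightarrow> real) \<Rightarrow> real) \<Rightarrow> bool"
  where "smooth_on n V f \<longleftrightarrow> (\<forall>k. Ck_on n k V f)"

subsection \<open>Charts\<close>

record 'a chart =
  cdom :: "'a set"
  cmap :: "'a \<Rightarrow> nat \<Rightarrow> real"

definition is_chart :: "'a topology \<Rightarrow> nat \<Rightarrow> 'a chart \<Rightarrow> bool"
  where "is_chart X n c \<longleftrightarrow>
    openin X (cdom c) \<and> openin (Rn n) (cmap c ` cdom c) \<and>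
    homeomorphic_map (subtopology X (cdom c)) (subtopology (Rn n) (cmap c ` cdom c)) (cmap c)"

definition cinv :: "'a chart \<Rightarrow> (nat \<Rightarrow> real) \<Rightarrow> 'a"
  where "cinv c = inv_into (cdom c) (cmap c)"

definition smooth_in_chart :: "nat \<Rightarrow> 'a chart \<Rightarrow> 'a set \<Rightarrow> ('a \<Rightarrow> real) \<Rightarrow> bool"
  where "smooth_in_chart n c W f \<longleftrightarrow> smooth_on n (cmap c ` W) (\<lambda>y. f (cinv c y))"

text \<open>The function \<open>\<partial>f/\<partial>x\<^sup>i\<close> on the chart domain, \<open>x\<^sup>i\<close> being the coordinates of \<open>c\<close>.\<close>

definition cpartial :: "'a chart \<Rightarrow> nat \<Rightarrow> ('a \<Rightarrow> real) \<Rightarrow> 'a \<Rightarrow> real"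
  where "cpartial c i f x = partial i (\<lambda>y. f (cinv c y)) (cmap c x)"

definition compatible_charts :: "nat \<Rightarrow> 'a chart \<Rightarrow> 'a chart \<Rightarrow> bool"
  where "compatible_charts n c d \<longleftrightarrow>
    (\<forall>k<n. smooth_in_chart n d (cdom c \<inter> cdom d) (\<lambda>x. cmap c x k) \<and>
           smooth_in_chart n c (cdom c \<inter> cdom d) (\<lambda>x. cmap d x k))"

text \<open>
  The components \<open>g\<close> with respect to \<open>c\<close> and \<open>h\<close> with respect to \<open>d\<close> belong to the same
  covariant 2-tensor field.
\<close>

definition same_tensor2 ::
  "nat \<Rightarrow> 'a chart \<Rightarrow> ('a \<Rightarrow> nat \<Rightarrow> nat \<Rightarrow> real) \<Rightarrow> 'a chart \<Rightarrow> ('a \<Rightarrow> nat \<Rightarrow> nat \<Rightarrow> real) \<Rightarrow> bool"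
  where "same_tensor2 n c g d h \<longleftrightarrow>
    (\<forall>x\<in>cdom c \<inter> cdom d. \<forall>i<n. \<forall>j<n.
       h x i j = (\<Sum>k<n. \<Sum>l<n. g x k l * cpartial d i (\<lambda>z. cmap c z k) x
                                        * cpartial d j (\<lambda>z. cmap c z l) x))"

subsection \<open>Riemannian manifolds\<close>

text \<open>
  The atlas need not be maximal; it represents the smooth structure it generates. The metric is
  given by its components \<^term>\<open>gmetric M c x i j\<close> in every chart \<open>c\<close> of the atlas.
\<close>

record 'a riem =
  mtop :: "'a topology"
  mdim :: nat
  atlas :: "'a chart set"
  gmetric :: "'a chart \<Rightarrow> 'a \<Rightarrow> nat \<Rightarrow> nat \<Rightarrow> real"

definition riemannian_manifold :: "'a riem \<Rightarrow> bool"
  where "riemannian_manifold M \<longleftrightarrow>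
    Hausdorff_space (mtop M) \<and> second_countable (mtop M) \<and>
    (\<Union>c\<in>atlas M. cdom c) = topspace (mtop M) \<and>
    (\<forall>c\<in>atlas M. is_chart (mtop M) (mdim M) c) \<and>
    (\<forall>c\<in>atlas M. \<forall>d\<in>atlas M. compatible_charts (mdim M) c d) \<and>
    (\<forall>c\<in>atlas M. \<forall>i<mdim M. \<forall>j<mdim M.
       smooth_in_chart (mdim M) c (cdom c) (\<lambda>x. gmetric M c x i j)) \<and>
    (\<forall>c\<in>atlas M. \<forall>d\<in>atlas M. same_tensor2 (mdim M) c (gmetric M c) d (gmetric M d)) \<and>
    (\<forall>c\<in>atlas M. \<forall>x\<in>cdom c.
       (\<forall>i<mdim M. \<forall>j<mdim M. gmetric M c x i j = gmetric M c x j i) \<and>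
       (\<forall>v. (\<exists>i<mdim M. v i \<noteq> 0) \<longrightarrow>
            (\<Sum>i<mdim M. \<Sum>j<mdim M. gmetric M c x i j * v i * v j) > 0))"

definition metric_mat :: "'a riem \<Rightarrow> 'a chart \<Rightarrow> 'a \<Rightarrow> real mat"
  where "metric_mat M c x = Matrix.mat (mdim M) (mdim M) (\<lambda>(i, j). gmetric M c x i j)"

text \<open>The components \<open>g\<^sup>i\<^sup>j\<close> of the inverse metric.\<close>

definition ginv :: "'a riem \<Rightarrow> 'a chart \<Rightarrow> 'a \<Rightarrow> nat \<Rightarrow> nat \<Rightarrow> real"
  where "ginv M c x i j = index_mat (the (mat_inverse (metric_mat M c x))) (i, j)"

text \<open>
  The Christoffel symbols \<open>\<Gamma>\<^sup>k\<^sub>i\<^sub>j\<close> of the Levi-Civita connection, as given by the Koszul formula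
  for coordinate vector fields.
\<close>

definition christoffel :: "'a riem \<Rightarrow> 'a chart \<Rightarrow> 'a \<Rightarrow> nat \<Rightarrow> nat \<Rightarrow> nat \<Rightarrow> real"
  where "christoffel M c x k i j =
    (\<Sum>l<mdim M. ginv M c x k l *
       (cpartial c i (\<lambda>z. gmetric M c z j l) x + cpartial c j (\<lambda>z. gmetric M c z i l) x
        - cpartial c l (\<lambda>z. gmetric M c z i j) x)) / 2"

text \<open>
  \<open>(\<nabla>\<^bsub>\<partial>\<^sub>i\<^esub> \<omega>)(\<partial>\<^sub>j)\<close> for the Levi-Civita connection and a 1-form with components \<open>\<omega> x j\<close>.
\<close>

definition cov_deriv1 ::
  "'a riem \<Rightarrow> 'a chart \<Rightarrow> ('a \<Rightarrow> nat \<Rightarrow> real) \<Rightarrow> 'a \<Rightarrow> nat \<Rightarrow> nat \<Rightarrow> real"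
  where "cov_deriv1 M c \<omega> x i j =
    cpartial c i (\<lambda>z. \<omega> z j) x - (\<Sum>k<mdim M. christoffel M c x k i j * \<omega> x k)"

definition differential :: "'a chart \<Rightarrow> ('a \<Rightarrow> real) \<Rightarrow> 'a \<Rightarrow> nat \<Rightarrow> real"
  where "differential c u x i = cpartial c i u x"

definition gradient :: "'a riem \<Rightarrow> 'a chart \<Rightarrow> ('a \<Rightarrow> real) \<Rightarrow> 'a \<Rightarrow> nat \<Rightarrow> real"
  where "gradient M c u x i = (\<Sum>j<mdim M. ginv M c x i j * differential c u x j)"

definition hessian :: "'a riem \<Rightarrow> 'a chart \<Rightarrow> ('a \<Rightarrow> real) \<Rightarrow> 'a \<Rightarrow> nat \<Rightarrow> nat \<Rightarrow> real"
  where "hessian M c u = cov_deriv1 M c (differential c u)"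

text \<open>
  The following three quantities do not depend on the chart around \<open>x\<close> in which they are computed;
  one is chosen.
\<close>

definition chart_at :: "'a riem \<Rightarrow> 'a \<Rightarrow> 'a chart"
  where "chart_at M x = (SOME c. c \<in> atlas M \<and> x \<in> cdom c)"

definition norm_grad :: "'a riem \<Rightarrow> ('a \<Rightarrow> real) \<Rightarrow> 'a \<Rightarrow> real"
  where "norm_grad M u x = (let c = chart_at M x in
    sqrt (\<Sum>i<mdim M. \<Sum>j<mdim M. gmetric M c x i j * gradient M c u x i * gradient M c u x j))"

definition norm_hess :: "'a riem \<Rightarrow> ('a \<Rightarrow> real) \<Rightarrow> 'a \<Rightarrow> real"
  where "norm_hess M u x = (let c = chart_at M x in
    sqrt (\<Sum>i<mdim M. \<Sum>j<mdim M. \<Sum>k<mdim M. \<Sum>l<mdim M.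
            ginv M c x i k * ginv M c x j l * hessian M c u x i j * hessian M c u x k l))"

definition laplacian :: "'a riem \<Rightarrow> ('a \<Rightarrow> real) \<Rightarrow> 'a \<Rightarrow> real"
  where "laplacian M u x = (let c = chart_at M x in
    - (\<Sum>i<mdim M. \<Sum>j<mdim M. ginv M c x i j * hessian M c u x i j))"

definition Cc_infty :: "'a riem \<Rightarrow> ('a \<Rightarrow> real) set"
  where "Cc_infty M = {u. (\<forall>c\<in>atlas M. smooth_in_chart (mdim M) c (cdom c) u) \<and>
    compactin (mtop M) (Abstract_Topology.closure_of (mtop M) {x \<in> topspace (mtop M). u x \<noteq> 0})}"

subsection \<open>Volume measure and Lp norms\<close>

text \<open>
  The Riemannian volume measure is the unique Borel measure that is \<open>sqrt (det g) dx\<close> in every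
  chart. Existence is standard (change of variables), and uniqueness follows since countably many
  charts cover the manifold.
\<close>

definition riemannian_volume :: "'a riem \<Rightarrow> 'a measure \<Rightarrow> bool"
  where "riemannian_volume M vol \<longleftrightarrow>
    space vol = topspace (mtop M) \<and>
    sets vol = sigma_sets (topspace (mtop M)) {U. openin (mtop M) U} \<and>
    (\<forall>c\<in>atlas M. \<forall>A\<in>sets vol. A \<subseteq> cdom c \<longrightarrow>
       emeasure vol A =
         (\<integral>\<^sup>+ y\<in>cmap c ` A. ennreal (sqrt (Determinant.det (metric_mat M c (cinv c y))))
            \<partial>Pi\<^sub>M {..<mdim M} (\<lambda>_. lborel)))"

text \<open>
  Only used for continuous functions with compact support, for which the integral is finite.
\<close>

definition Lp_norm :: "'a measure \<Rightarrow> real \<Rightarrow> ('a \<Rightarrow> real) \<Rightarrow> real"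
  where "Lp_norm vol p f = (\<integral>x. \<bar>f x\<bar> powr p \<partial>vol) powr (1 / p)"

subsection \<open>Geodesic completeness and relatively compact open subsets\<close>

text \<open>
  Smooth curves \<open>\<gamma> : real \<rightarrow> M\<close> with \<open>\<nabla>\<^bsub>\<gamma>'\<^esub> \<gamma>' = 0\<close>. Derivatives at \<open>t\<close> see \<open>\<gamma>\<close> only near \<open>t\<close>,
  where it stays in the chart domain.
\<close>

definition geodesic :: "'a riem \<Rightarrow> (real \<Rightarrow> 'a) \<Rightarrow> bool"
  where "geodesic M \<gamma> \<longleftrightarrow>
    continuous_map euclideanreal (mtop M) \<gamma> \<and>
    (\<forall>c\<in>atlas M. \<forall>t. \<gamma> t \<in> cdom c \<longrightarrow>
      (let x = (\<lambda>k s. cmap c (\<gamma> s) k) in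
        \<forall>k<mdim M.
          (\<forall>m. (deriv ^^ m) (x k) differentiable (at t)) \<and>
          (deriv ^^ 2) (x k) t +
            (\<Sum>i<mdim M. \<Sum>j<mdim M.
               christoffel M c (\<gamma> t) k i j * deriv (x i) t * deriv (x j) t) = 0))"

text \<open>For every point and tangent vector (given by its components \<open>v\<close>), the corresponding geodesic
  is defined on all of \<open>real\<close>.\<close>

definition geodesically_complete :: "'a riem \<Rightarrow> bool"
  where "geodesically_complete M \<longleftrightarrow>
    (\<forall>c\<in>atlas M. \<forall>x\<in>cdom c. \<forall>v :: nat \<Rightarrow> real.
       \<exists>\<gamma>. geodesic M \<gamma> \<and> \<gamma> 0 = x \<and>
           (\<forall>k<mdim M. deriv (\<lambda>t. cmap c (\<gamma> t) k) 0 = v k))"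

text \<open>
  \<open>M\<close> is an open subset of \<open>N\<close> with the induced topology, smooth structure and metric. The atlas of
  \<open>M\<close> need not consist of restrictions of charts in the atlas of \<open>N\<close>.
\<close>

definition open_riemannian_submanifold :: "'a riem \<Rightarrow> 'a riem \<Rightarrow> bool"
  where "open_riemannian_submanifold M N \<longleftrightarrow>
    mdim M = mdim N \<and>
    openin (mtop N) (topspace (mtop M)) \<and>
    mtop M = subtopology (mtop N) (topspace (mtop M)) \<and>
    (\<forall>c\<in>atlas M. \<forall>d\<in>atlas N.
       compatible_charts (mdim N) c d \<and> same_tensor2 (mdim N) c (gmetric M c) d (gmetric N d))"

definition relatively_compact_open_in :: "'a riem \<Rightarrow> 'a riem \<Rightarrow> bool"
  where "relatively_compact_open_in M N \<longleftrightarrow>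
    open_riemannian_submanifold M N \<and>
    compactin (mtop N) (Abstract_Topology.closure_of (mtop N) (topspace (mtop M)))"

end

theory Submission
  imports Defs
begin

text \<open>
  Everything follows from Green's formula \<open>\<integral> \<langle>grad v, grad u\<rangle> = \<integral> v \<Delta>u\<close> for smooth \<open>u\<close> and compactly
  supported \<open>v\<close> of class \<open>C\<^sup>1\<close>, on an arbitrary Riemannian manifold. For \<open>1 < p \<le> 2\<close> one takes
  \<open>v = u (u\<^sup>2 + \<delta>)\<^bsup>(p-2)/2\<^esup>\<close>, so that the left-hand integrand is at least
  \<open>(p - 1) (u\<^sup>2 + \<delta>)\<^bsup>(p-2)/2\<^esup> |grad u|\<^sup>2\<close>, while \<open>|v| \<le> |u|\<^bsup>p-1\<^esup>\<close>. For \<open>p \<ge> 2\<close> one takes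
  \<open>v = u (|grad u|\<^sup>2 + \<delta>)\<^bsup>(p-2)/2\<^esup>\<close> and bounds \<open>\<langle>grad |grad u|\<^sup>2, grad u\<rangle> = 2 Hess u (grad u, grad u)\<close>
  and \<open>\<Delta>u\<close> pointwise by \<open>|Hess u|\<close>. Pointwise Young inequalities replace Hoelder's inequality, and
  finally \<open>\<delta> \<rightarrow> 0\<close>.
\<close>

subsection \<open>Calculus in the model space\<close>

text \<open>The regularisation by \<open>\<delta>\<close> is forced: \<open>u |u|^(p-2)\<close> is
  not C^1 in \<open>u\<close> at 0 for \<open>p < 2\<close>, and for small \<open>p > 2\<close> the
  weight \<open>|grad u|^(p-2)\<close> may fail to be C^1 at critical points. Its cost is an error
  proportional to vol(K) \<open>\<delta>\<close>^(p/2), with \<open>K\<close> a compact set off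
  which \<open>u\<close> vanishes. The dimension being a number, calculus is done along coordinate
  lines, and the chain rule and the symmetry of second derivatives come from the mean value theorem.
  The norms are computed in a chosen chart, so their independence of it has to be proved. Instead of
  transforming Christoffel symbols, the Hessian is characterised by the Koszul-type identity 2 Hess
  u(grad f, grad h) = <grad f, grad <grad u, grad h>> + <grad h, grad <grad u, grad f>> - <grad u,
  grad <grad f, grad h>>, whose right side contains gradient products only. In the integral
  estimates \<open>\<epsilon>\<close> appears as \<open>\<epsilon> powr (- p)\<close> and
  \<open>\<epsilon> powr p\<close>, never optimised; subadditivity of the power 1/p then gives the
  two terms of the claim with constant C^(1/p).\<close>

abbreviation En :: "nat \<Rightarrow> (nat \<Rightarrow> real) set"
  where "En n \<equiv> PiE {..<n} (\<lambda>_. UNIV)"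

abbreviation leb :: "nat \<Rightarrow> (nat \<Rightarrow> real) measure"
  where "leb n \<equiv> Pi\<^sub>M {..<n} (\<lambda>_. lborel)"

text \<open>Coordinates with index at least \<open>n\<close> are constantly \<open>undefined\<close>
  on \<open>En n\<close>, so continuity of the remaining ones decides both directions. With this,
  \<open>continuous_on\<close>, \<open>compact\<close> and the Borel sets of the full function space
  become available in the model space.\<close>

lemma Rn_eq: "Rn n = top_of_set (En n)"
proof -
  have 1: "continuous_map (Rn n) (top_of_set (En n)) id"
  proof -
    have "continuous_map (Rn n) euclideanreal (\<lambda>x. x k)" for k
    proof (cases "k < n")
      case True
      then show ?thesis by (intro continuous_map_product_projection) simp
    next
      case False
      show ?thesis
        by (rule continuous_map_eq[where f="\<lambda>_. undefined"]) (use False in \<open>auto simp: PiE_def extensional_def\<close>)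
    qed
    then have "continuous_map (Rn n) (powertop_real UNIV) id"
      by (simp add: continuous_map_componentwise_UNIV)
    then show ?thesis
      by (simp add: continuous_map_in_subtopology euclidean_product_topology)
  qed
  have "continuous_map (subtopology (powertop_real UNIV) (En n)) euclideanreal (\<lambda>x. x k)" for k
    by (intro continuous_map_from_subtopology continuous_map_product_projection) simp
  then have 2: "continuous_map (top_of_set (En n)) (Rn n) id"
    unfolding euclidean_product_topology[symmetric]
    by (auto simp: continuous_map_componentwise PiE_iff)
  show ?thesis
  proof (rule topology_eq[THEN iffD2], intro allI iffI)
    fix U assume U: "openin (Rn n) U"
    then have "openin (top_of_set (En n)) {x \<in> topspace (top_of_set (En n)). id x \<in> U}"
      using 2 openin_continuous_map_preimage by blast
    moreover have "{x \<in> topspace (top_of_set (En n)). id x \<in> U} = U"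
      using openin_subset[OF U] by auto
    ultimately show "openin (top_of_set (En n)) U" by simp
  next
    fix U assume U: "openin (top_of_set (En n)) U"
    then have "openin (Rn n) {x \<in> topspace (Rn n). id x \<in> U}"
      using 1 openin_continuous_map_preimage by blast
    moreover have "{x \<in> topspace (Rn n). id x \<in> U} = U"
      using openin_subset[OF U] by auto
    ultimately show "openin (Rn n) U" by simp
  qed
qed

lemma openin_Rn_subset: "openin (Rn n) V \<Longrightarrow> V \<subseteq> En n"
  using openin_subset by fastforce

lemma fun_upd_En: "y \<in> En n \<Longrightarrow> i < n \<Longrightarrow> y(i := t) \<in> En n"
  by (auto simp: PiE_def extensional_def)

lemma continuous_map_Rn_iff:
  assumes "V \<subseteq> En n"
  shows "continuous_map (subtopology (Rn n) V) euclideanreal f \<longleftrightarrow> continuous_on V f"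
proof -
  have "subtopology (Rn n) V = top_of_set V"
    using assms by (simp add: Rn_eq subtopology_subtopology Int_absorb1)
  then show ?thesis by simp
qed

text \<open>One radius for all coordinates replaces a norm: the later smallness arguments are
  phrased with such cubes.\<close>

lemma openin_Rn_box:
  assumes V: "openin (Rn n) V" and y: "y \<in> V"
  obtains e where "e > 0" "\<And>z. z \<in> En n \<Longrightarrow> (\<And>i. i < n \<Longrightarrow> \<bar>z i - y i\<bar> < e) \<Longrightarrow> z \<in> V"
proof -
  obtain U where U: "\<And>i. i < n \<Longrightarrow> open (U i)" "y \<in> PiE {..<n} U" "PiE {..<n} U \<subseteq> V"
  proof -
    obtain U where "\<And>i. i < n \<Longrightarrow> openin euclideanreal (U i)" "y \<in> PiE {..<n} U" "PiE {..<n} U \<subseteq> V"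
      using V y unfolding openin_product_topology_alt by (metis lessThan_iff)
    then show ?thesis by (intro that) auto
  qed
  have "\<exists>e>0. \<forall>t. \<bar>t - y i\<bar> < e \<longrightarrow> t \<in> U i" if "i < n" for i
    using U(1)[OF that] U(2) that unfolding open_dist by (auto simp: dist_real_def PiE_def)
  then obtain e where e: "\<And>i. i < n \<Longrightarrow> e i > 0" "\<And>i t. i < n \<Longrightarrow> \<bar>t - y i\<bar> < e i \<Longrightarrow> t \<in> U i"
    by metis
  \<comment> \<open>The extra \<open>1\<close> keeps the set nonempty, so that the minimum is
    meaningful for \<open>n = 0\<close>.\<close>
  define d where "d = Min (insert 1 (e ` {..<n}))"
  have "d > 0" unfolding d_def using e(1) by (subst Min_gr_iff) auto
  moreover have "d \<le> e i" if "i < n" for i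
    unfolding d_def using that by (intro Min_le) auto
  moreover have "z \<in> V" if z: "z \<in> En n" "\<And>i. i < n \<Longrightarrow> \<bar>z i - y i\<bar> < d" for z
  proof -
    have "z \<in> PiE {..<n} U"
      using z e(2) \<open>\<And>i. i < n \<Longrightarrow> d \<le> e i\<close> by (force simp: PiE_def)
    then show ?thesis using U(3) by blast
  qed
  ultimately show ?thesis using that[of d] by blast
qed

lemma continuous_on_Rn_box:
  fixes f :: "(nat \<Rightarrow> real) \<Rightarrow> real"
  assumes V: "openin (Rn n) V" and y: "y \<in> V" and f: "continuous_on V f" and e: "e > 0"
  obtains d where "d > 0"
    "\<And>z. z \<in> En n \<Longrightarrow> (\<And>i. i < n \<Longrightarrow> \<bar>z i - y i\<bar> < d) \<Longrightarrow> z \<in> V \<and> \<bar>f z - f y\<bar> < e"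
proof -
  have "openin (top_of_set V) (V \<inter> f -` ball (f y) e)"
    using f continuous_openin_preimage_gen by blast
  then have "openin (Rn n) (V \<inter> f -` ball (f y) e)"
    using V unfolding Rn_eq by (metis openin_trans)
  then show ?thesis
    by (rule openin_Rn_box[where y=y]) (use y e that in \<open>auto simp: dist_real_def abs_minus_commute\<close>)
qed

lemma eventually_slice:
  assumes V: "openin (Rn n) V" and y: "y \<in> V" and i: "i < n"
  shows "eventually (\<lambda>t. y(i := t) \<in> V) (nhds (y i))"
proof -
  obtain e where e: "e > 0" "\<And>z. z \<in> En n \<Longrightarrow> (\<And>i. i < n \<Longrightarrow> \<bar>z i - y i\<bar> < e) \<Longrightarrow> z \<in> V"
    using openin_Rn_box[OF V y] by blast
  have "y \<in> En n" using V y openin_Rn_subset by blast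
  then have "y(i := t) \<in> V" if "dist t (y i) < e" for t
    using that i e fun_upd_En by (auto simp: dist_real_def)
  then show ?thesis unfolding eventually_nhds_metric using e(1) by blast
qed

text \<open>The C^1 level of \<open>Ck_on\<close>, kept separate because the bump and test functions
  below are only C^1. Continuous partials already give the chain rule, so no total derivative is
  recorded.\<close>

definition C1_on :: "nat \<Rightarrow> (nat \<Rightarrow> real) set \<Rightarrow> ((nat \<Rightarrow> real) \<Rightarrow> real) \<Rightarrow> bool"
  where "C1_on n V f \<longleftrightarrow> continuous_on V f \<and>
    (\<forall>i<n. (\<forall>y\<in>V. (\<lambda>t. f (y(i := t))) differentiable (at (y i))) \<and> continuous_on V (partial i f))"

lemma smooth_on_C1: "V \<subseteq> En n \<Longrightarrow> smooth_on n V f \<Longrightarrow> C1_on n V f"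
proof -
  assume a: "V \<subseteq> En n" "smooth_on n V f"
  then have "Ck_on n (Suc 0) V f" unfolding smooth_on_def by blast
  then show ?thesis using a by (auto simp: C1_on_def continuous_map_Rn_iff)
qed

lemma smooth_on_partial: "smooth_on n V f \<Longrightarrow> i < n \<Longrightarrow> smooth_on n V (partial i f)"
  unfolding smooth_on_def by (metis Ck_on.simps(2))

lemma C1_on_continuous: "C1_on n V f \<Longrightarrow> continuous_on V f"
  and C1_on_continuous_partial: "C1_on n V f \<Longrightarrow> i < n \<Longrightarrow> continuous_on V (partial i f)"
  by (auto simp: C1_on_def)

lemma C1_on_subset: "C1_on n V f \<Longrightarrow> W \<subseteq> V \<Longrightarrow> C1_on n W f"
  unfolding C1_on_def by (meson continuous_on_subset subset_iff)

lemma C1_on_DERIV: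
  "C1_on n V f \<Longrightarrow> y \<in> V \<Longrightarrow> i < n \<Longrightarrow>
    ((\<lambda>t. f (y(i := t))) has_real_derivative partial i f y) (at (y i))"
  unfolding C1_on_def partial_def by (simp add: DERIV_deriv_iff_real_differentiable)

lemma C1_on_DERIV_slice:
  assumes "C1_on n V f" "y(i := s) \<in> V" "i < n"
  shows "((\<lambda>t. f (y(i := t))) has_real_derivative partial i f (y(i := s))) (at s)"
  using C1_on_DERIV[OF assms] by simp

lemma partial_eqI:
  "((\<lambda>t. f (y(i := t))) has_real_derivative D) (at (y i)) \<Longrightarrow> partial i f y = D"
  unfolding partial_def by (rule DERIV_imp_deriv)

lemma C1_onI:
  assumes "continuous_on V f"
    and D: "\<And>i y. i < n \<Longrightarrow> y \<in> V \<Longrightarrow> ((\<lambda>t. f (y(i := t))) has_real_derivative D i y) (at (y i))"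
    and c: "\<And>i. i < n \<Longrightarrow> continuous_on V (D i)"
  shows "C1_on n V f"
proof -
  have "continuous_on V (partial i f)" if "i < n" for i
    using c[OF that] by (rule continuous_on_eq) (use partial_eqI D that in metis)
  then show ?thesis
    using assms(1) D unfolding C1_on_def real_differentiable_def by blast
qed

lemma partial_cong:
  assumes V: "openin (Rn n) V" and y: "y \<in> V" and i: "i < n" and eq: "\<And>z. z \<in> V \<Longrightarrow> f z = g z"
  shows "partial i f y = partial i g y"
  unfolding partial_def
  by (rule deriv_cong_ev) (use eventually_mono[OF eventually_slice[OF V y i]] eq in auto)

lemma C1_on_cong:
  assumes V: "openin (Rn n) V" and eq: "\<And>z. z \<in> V \<Longrightarrow> f z = g z" and f: "C1_on n V f"
  shows "C1_on n V g"
proof (rule C1_onI[where D="\<lambda>i. partial i f"])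
  show "continuous_on V g" using C1_on_continuous[OF f] eq by (rule continuous_on_eq)
  fix i assume i: "i < n"
  show "continuous_on V (partial i f)" using f i by (rule C1_on_continuous_partial)
  fix y assume y: "y \<in> V"
  show "((\<lambda>t. g (y(i := t))) has_real_derivative partial i f y) (at (y i))"
    using C1_on_DERIV[OF f y i]
  proof (rule DERIV_cong_ev[OF refl _ refl, THEN iffD1, rotated])
    show "\<forall>\<^sub>F t in nhds (y i). f (y(i := t)) = g (y(i := t))"
      using eventually_slice[OF V y i] by (rule eventually_mono) (rule eq)
  qed
qed

lemma C1_on_const [intro]: "C1_on n V (\<lambda>_. c)"
  by (rule C1_onI[where D="\<lambda>_ _. 0"]) (auto intro!: derivative_eq_intros continuous_intros)

lemma C1_on_coord: "C1_on n V (\<lambda>y. y k)"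
  by (rule C1_onI[where D="\<lambda>i _. if i = k then 1 else 0"])
     (auto intro!: derivative_eq_intros continuous_intros continuous_on_coordinatewise_then_product
       continuous_on_product_then_coordinatewise)

lemma partial_const [simp]: "partial i (\<lambda>_. c) y = 0"
  by (rule partial_eqI) (auto intro!: derivative_eq_intros)

context
  fixes n :: nat and V :: "(nat \<Rightarrow> real) set" and f g :: "(nat \<Rightarrow> real) \<Rightarrow> real"
  assumes f: "C1_on n V f" and g: "C1_on n V g"
begin

lemma C1_on_add: "C1_on n V (\<lambda>y. f y + g y)"
  by (rule C1_onI[where D="\<lambda>i y. partial i f y + partial i g y"])
    (intro continuous_intros DERIV_add C1_on_DERIV[OF f] C1_on_DERIV[OF g] C1_on_continuous[OF f]
      C1_on_continuous[OF g] C1_on_continuous_partial[OF f] C1_on_continuous_partial[OF g]; assumption)+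

lemma partial_add: "y \<in> V \<Longrightarrow> i < n \<Longrightarrow> partial i (\<lambda>y. f y + g y) y = partial i f y + partial i g y"
  by (intro partial_eqI DERIV_add C1_on_DERIV[OF f] C1_on_DERIV[OF g])

lemma C1_on_diff: "C1_on n V (\<lambda>y. f y - g y)"
  by (rule C1_onI[where D="\<lambda>i y. partial i f y - partial i g y"])
    (intro continuous_intros DERIV_diff C1_on_DERIV[OF f] C1_on_DERIV[OF g] C1_on_continuous[OF f]
      C1_on_continuous[OF g] C1_on_continuous_partial[OF f] C1_on_continuous_partial[OF g]; assumption)+

lemma DERIV_slice_mult:
  assumes "y \<in> V" "i < n"
  shows "((\<lambda>t. f (y(i := t)) * g (y(i := t))) has_real_derivative
      partial i f y * g y + f y * partial i g y) (at (y i))"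
  using DERIV_mult[OF C1_on_DERIV[OF f assms] C1_on_DERIV[OF g assms]] by (simp add: mult.commute add.commute)

lemma C1_on_mult: "C1_on n V (\<lambda>y. f y * g y)"
  by (rule C1_onI[where D="\<lambda>i y. partial i f y * g y + f y * partial i g y"])
    (intro continuous_intros DERIV_slice_mult C1_on_continuous[OF f]
      C1_on_continuous[OF g] C1_on_continuous_partial[OF f] C1_on_continuous_partial[OF g]; assumption)+

lemma partial_mult:
  "y \<in> V \<Longrightarrow> i < n \<Longrightarrow> partial i (\<lambda>y. f y * g y) y = partial i f y * g y + f y * partial i g y"
  by (intro partial_eqI DERIV_slice_mult)

end

lemma C1_on_sum:
  "(\<And>a. a \<in> A \<Longrightarrow> C1_on n V (f a)) \<Longrightarrow> C1_on n V (\<lambda>y. \<Sum>a\<in>A. f a y)"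
  by (induction A rule: infinite_finite_induct) (auto intro!: C1_on_add)

lemma partial_sum:
  assumes "\<And>a. a \<in> A \<Longrightarrow> C1_on n V (f a)" "y \<in> V" "i < n"
  shows "partial i (\<lambda>y. \<Sum>a\<in>A. f a y) y = (\<Sum>a\<in>A. partial i (f a) y)"
  using assms by (intro partial_eqI DERIV_sum C1_on_DERIV)

lemma C1_on_prod:
  "(\<And>a. a \<in> A \<Longrightarrow> C1_on n V (f a)) \<Longrightarrow> C1_on n V (\<lambda>y. \<Prod>a\<in>A. f a y)"
  by (induction A rule: infinite_finite_induct) (auto intro!: C1_on_mult)

lemma C1_on_cmult: "C1_on n V f \<Longrightarrow> C1_on n V (\<lambda>y. c * f y)"
  by (rule C1_on_mult) auto

lemma DERIV_slice_compose:
  assumes f: "C1_on n V f" and g: "\<And>y. y \<in> V \<Longrightarrow> (g has_real_derivative g' (f y)) (at (f y))"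
    and "y \<in> V" "i < n"
  shows "((\<lambda>t. g (f (y(i := t)))) has_real_derivative g' (f y) * partial i f y) (at (y i))"
  using DERIV_chain[of g "g' (f y)" "\<lambda>t. f (y(i := t))" "y i" "partial i f y" UNIV]
    g[OF \<open>y \<in> V\<close>] C1_on_DERIV[OF f \<open>y \<in> V\<close> \<open>i < n\<close>] by (simp add: o_def)

lemma partial_compose:
  assumes "C1_on n V f" "\<And>y. y \<in> V \<Longrightarrow> (g has_real_derivative g' (f y)) (at (f y))"
    and "y \<in> V" "i < n"
  shows "partial i (\<lambda>y. g (f y)) y = g' (f y) * partial i f y"
  using DERIV_slice_compose[OF assms] by (rule partial_eqI)

lemma C1_on_compose:
  assumes f: "C1_on n V f" and g: "\<And>y. y \<in> V \<Longrightarrow> (g has_real_derivative g' (f y)) (at (f y))"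
    and g': "continuous_on (f ` V) g'"
  shows "C1_on n V (\<lambda>y. g (f y))"
proof (rule C1_onI[where D="\<lambda>i y. g' (f y) * partial i f y"])
  have "continuous_on (f ` V) g"
    using g by (intro DERIV_continuous_on[where D=g']) (auto intro: has_field_derivative_at_within)
  then show "continuous_on V (\<lambda>y. g (f y))"
    using C1_on_continuous[OF f] continuous_on_compose2 by blast
  have "continuous_on V (\<lambda>y. g' (f y))"
    using C1_on_continuous[OF f] g' continuous_on_compose2 by blast
  then show "continuous_on V (\<lambda>y. g' (f y) * partial i f y)" if "i < n" for i
    using C1_on_continuous_partial[OF f that] by (intro continuous_intros)
qed (use DERIV_slice_compose[OF f g] in auto)

lemma C1_on_inverse:
  assumes f: "C1_on n V f" and nz: "\<And>y. y \<in> V \<Longrightarrow> f y \<noteq> 0"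
  shows "C1_on n V (\<lambda>y. inverse (f y))"
  by (rule C1_on_compose[OF f, where g'="\<lambda>x. - (inverse x * inverse x)"])
     (use nz in \<open>auto intro!: derivative_eq_intros continuous_intros\<close>)

lemma C1_on_divide:
  assumes "C1_on n V f" "C1_on n V g" "\<And>y. y \<in> V \<Longrightarrow> g y \<noteq> 0"
  shows "C1_on n V (\<lambda>y. f y / g y)"
  unfolding divide_inverse using assms by (intro C1_on_mult C1_on_inverse)

text \<open>Serves to extend by zero: one open set carries the formula, the other avoids its
  support. Openness of both pieces makes continuity glue.\<close>

lemma C1_on_Un:
  assumes "openin (Rn n) V" "openin (Rn n) W" "C1_on n V f" "C1_on n W f"
  shows "C1_on n (V \<union> W) f"
proof -
  have "openin (top_of_set (V \<union> W)) V" "openin (top_of_set (V \<union> W)) W"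
    using assms(1,2)[unfolded Rn_eq] by (metis Un_upper1 Un_upper2 openin_subset_trans openin_Un openin_imp_subset)+
  then show ?thesis
    using assms(3,4) unfolding C1_on_def by (auto intro!: continuous_on_Un_local_open)
qed

lemma openin_Rn_En: "openin (Rn n) (En n)"
  using openin_topspace[of "Rn n"] by simp

section \<open>Mean value arguments: the chain rule and the symmetry of second partial
  derivatives\<close>

lemma MVT_segment:
  fixes g :: "real \<Rightarrow> real"
  assumes g: "\<And>s. min a b \<le> s \<Longrightarrow> s \<le> max a b \<Longrightarrow> (g has_real_derivative g' s) (at s)" and "a \<noteq> b"
  obtains s where "min a b \<le> s" "s \<le> max a b" "g b - g a = (b - a) * g' s"
proof (cases "a < b")
  case True
  then obtain s where "s > a" "s < b" "g b - g a = (b - a) * g' s"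
    using MVT2[of a b g g'] g by (auto simp: min_def max_def)
  then show ?thesis using that[of s] True by auto
next
  case False
  then have "b < a" using \<open>a \<noteq> b\<close> by simp
  then obtain s where "s > b" "s < a" "g a - g b = (a - b) * g' s"
    using MVT2[of b a g g'] g by (auto simp: min_def max_def)
  moreover from this have "g b - g a = (b - a) * g' s" by (simp add: algebra_simps)
  ultimately show ?thesis using that[of s] \<open>b < a\<close> by auto
qed

text \<open>One step of the chain rule: the coordinates below \<open>m\<close> have already moved to
  \<open>\<gamma> t\<close>, those above are still at \<open>y\<close>, and only coordinate
  \<open>m\<close> moves. The mean value theorem turns the increment into a partial derivative at an
  intermediate point, and continuity of the partial gives the limit.\<close>

lemma DERIV_partial_increment:
  fixes \<gamma> :: "real \<Rightarrow> nat \<Rightarrow> real"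
  assumes V: "openin (Rn n) V" and f: "C1_on n V f" and y: "y \<in> V" and m: "m < n"
    and \<gamma>0: "\<And>k. k < n \<Longrightarrow> \<gamma> t0 k = y k"
    and d: "\<And>k. k < n \<Longrightarrow> ((\<lambda>t. \<gamma> t k) has_real_derivative \<gamma>' k) (at t0)"
  shows "((\<lambda>t. f (\<lambda>k. if k < Suc m then \<gamma> t k else y k) - f (\<lambda>k. if k < m then \<gamma> t k else y k))
     has_real_derivative partial m f y * \<gamma>' m) (at t0)"
proof -
  define z where "z = (\<lambda>t k. if k < m then \<gamma> t k else y k)"
  have zS: "(\<lambda>k. if k < Suc m then \<gamma> t k else y k) = (z t)(m := \<gamma> t m)" for t
    by (auto simp: z_def less_Suc_eq)
  have z0: "z t = (z t)(m := y m)" for t by (auto simp: z_def)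
  \<comment> \<open>A Caratheodory slope in coordinate \<open>m\<close>. Where that coordinate has
    not moved, the increment is 0 and any value would satisfy the slope equation; the partial at
    \<open>y\<close> is the value that makes \<open>q\<close> continuous at
    \<open>t0\<close>.\<close>
  define q where "q = (\<lambda>t. if \<gamma> t m = y m then partial m f y
     else (f ((z t)(m := \<gamma> t m)) - f (z t)) / (\<gamma> t m - y m))"
  have yE: "y \<in> En n" using y V openin_Rn_subset by blast
  have q: "f ((z t)(m := \<gamma> t m)) - f (z t) = q t * (\<gamma> t m - y m)" for t
    using z0[of t] by (auto simp: q_def)
  have q0: "q t0 = partial m f y" using \<gamma>0 m by (simp add: q_def)
  have "(q \<longlongrightarrow> q t0) (at t0)"
  proof (rule tendstoI)
    fix e :: real assume "e > 0"
    then obtain r where r: "r > 0" "\<And>w. w \<in> En n \<Longrightarrow> (\<And>i. i < n \<Longrightarrow> \<bar>w i - y i\<bar> < r) \<Longrightarrow>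
        w \<in> V \<and> \<bar>partial m f w - partial m f y\<bar> < e"
      using continuous_on_Rn_box[OF V y C1_on_continuous_partial[OF f m]] by blast
    have "eventually (\<lambda>t. \<forall>k\<in>{..<n}. \<bar>\<gamma> t k - y k\<bar> < r) (at t0)"
    proof (rule eventually_ball_finite, simp, intro ballI)
      fix k assume k: "k \<in> {..<n}"
      then have "((\<lambda>t. \<gamma> t k) \<longlongrightarrow> \<gamma> t0 k) (at t0)"
        using d DERIV_isCont isCont_def by blast
      then show "eventually (\<lambda>t. \<bar>\<gamma> t k - y k\<bar> < r) (at t0)"
        using tendstoD[OF _ \<open>r > 0\<close>] \<gamma>0 k by (fastforce simp: dist_real_def)
    qed
    then show "eventually (\<lambda>t. dist (q t) (q t0) < e) (at t0)"
    proof (rule eventually_mono)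
      fix t assume t: "\<forall>k\<in>{..<n}. \<bar>\<gamma> t k - y k\<bar> < r"
      show "dist (q t) (q t0) < e"
      proof (cases "\<gamma> t m = y m")
        case True then show ?thesis using \<open>e > 0\<close> q0 by (simp add: q_def)
      next
        case False
        have in_box: "(z t)(m := s) \<in> V \<and> \<bar>partial m f ((z t)(m := s)) - partial m f y\<bar> < e"
          if "min (y m) (\<gamma> t m) \<le> s" "s \<le> max (y m) (\<gamma> t m)" for s
        proof (rule r(2))
          show "(z t)(m := s) \<in> En n"
            using yE m by (auto simp: z_def PiE_def extensional_def)
          fix i assume i: "i < n"
          have "\<bar>s - y m\<bar> \<le> \<bar>\<gamma> t m - y m\<bar>" using that by auto
          then show "\<bar>((z t)(m := s)) i - y i\<bar> < r"
            using t i m r(1) by (auto simp: z_def intro: le_less_trans)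
        qed
        obtain s where s: "min (y m) (\<gamma> t m) \<le> s" "s \<le> max (y m) (\<gamma> t m)"
          "f ((z t)(m := \<gamma> t m)) - f ((z t)(m := y m)) = (\<gamma> t m - y m) * partial m f ((z t)(m := s))"
          by (rule MVT_segment[where g="\<lambda>s. f ((z t)(m := s))" and a="y m" and b="\<gamma> t m"
              and g'="\<lambda>s. partial m f ((z t)(m := s))"])
             (use False in_box C1_on_DERIV_slice[OF f _ m] in auto)
        then have "q t = partial m f ((z t)(m := s))"
          using False z0[of t] by (simp add: q_def field_simps)
        then show ?thesis using in_box[OF s(1,2)] q0 by (simp add: dist_real_def)
      qed
    qed
  qed
  then have qc: "isCont q t0" by (simp add: isCont_def)
  \<comment> \<open>The curve's coordinate \<open>m\<close> in Caratheodory form; the product of the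
    two slopes is the slope of the composition.\<close>
  obtain g where g: "\<And>t. \<gamma> t m - \<gamma> t0 m = g t * (t - t0)" "isCont g t0" "g t0 = \<gamma>' m"
    using d[OF m] unfolding CARAT_DERIV by blast
  have "((\<lambda>t. f ((z t)(m := \<gamma> t m)) - f (z t)) has_real_derivative partial m f y * \<gamma>' m) (at t0)"
    unfolding CARAT_DERIV
  proof (intro exI[of _ "\<lambda>t. q t * g t"] conjI allI)
    fix t
    have "f ((z t0)(m := \<gamma> t0 m)) - f (z t0) = 0" using z0[of t0] \<gamma>0[OF m] by simp
    then show "f ((z t)(m := \<gamma> t m)) - f (z t) - (f ((z t0)(m := \<gamma> t0 m)) - f (z t0)) = q t * g t * (t - t0)"
      using q[of t] g(1)[of t] \<gamma>0[OF m] by simp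
  qed (use qc g q0 in auto)
  then show ?thesis by (simp add: zS z_def)
qed

text \<open>The increment from \<open>\<gamma> t0\<close> to \<open>\<gamma> t\<close> telescopes
  when the coordinates are changed one at a time. The last stage equals \<open>\<gamma> t\<close> as
  a function because both are \<open>undefined\<close> at indices from \<open>n\<close> on.\<close>

lemma DERIV_chain_curve:
  fixes \<gamma> :: "real \<Rightarrow> nat \<Rightarrow> real"
  assumes V: "openin (Rn n) V" and f: "C1_on n V f" and y: "\<gamma> t0 \<in> V"
    and E: "eventually (\<lambda>t. \<gamma> t \<in> En n) (nhds t0)"
    and d: "\<And>k. k < n \<Longrightarrow> ((\<lambda>t. \<gamma> t k) has_real_derivative \<gamma>' k) (at t0)"
  shows "((\<lambda>t. f (\<gamma> t)) has_real_derivative (\<Sum>k<n. partial k f (\<gamma> t0) * \<gamma>' k)) (at t0)"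
proof -
  define z where "z = (\<lambda>m t k. if k < m then \<gamma> t k else \<gamma> t0 k)"
  have yE: "\<gamma> t0 \<in> En n" using y V openin_Rn_subset by blast
  have "((\<lambda>t. \<Sum>m<n. f (z (Suc m) t) - f (z m t)) has_real_derivative (\<Sum>k<n. partial k f (\<gamma> t0) * \<gamma>' k)) (at t0)"
    unfolding z_def by (intro DERIV_sum DERIV_partial_increment[OF V f y]) (use d in auto)
  then have "((\<lambda>t. f (z n t) - f (z 0 t)) has_real_derivative (\<Sum>k<n. partial k f (\<gamma> t0) * \<gamma>' k)) (at t0)"
    using sum_lessThan_telescope[of "\<lambda>m. f (z m t)" n for t] by simp
  then have *: "((\<lambda>t. f (z n t) - f (z 0 t) + f (\<gamma> t0)) has_real_derivative (\<Sum>k<n. partial k f (\<gamma> t0) * \<gamma>' k) + 0) (at t0)"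
    by (rule DERIV_add) simp
  have "z n t = \<gamma> t" if "\<gamma> t \<in> En n" for t
    using that yE by (auto simp: z_def PiE_def extensional_def)
  then have "eventually (\<lambda>t. f (z n t) - f (z 0 t) + f (\<gamma> t0) = f (\<gamma> t)) (nhds t0)"
    by (intro eventually_mono[OF E]) (simp add: z_def)
  from DERIV_cong_ev[OF refl this refl, THEN iffD1, OF *] show ?thesis by simp
qed

lemma
  assumes V: "openin (Rn n) V" and W: "openin (Rn n) W" and f: "C1_on n V f"
    and \<phi>: "\<And>y. y \<in> W \<Longrightarrow> \<phi> y \<in> V" and c: "\<And>k. k < n \<Longrightarrow> C1_on n W (\<lambda>y. \<phi> y k)"
  shows C1_on_chain: "C1_on n W (\<lambda>y. f (\<phi> y))"
    and partial_chain: "y \<in> W \<Longrightarrow> i < n \<Longrightarrow>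
      partial i (\<lambda>y. f (\<phi> y)) y = (\<Sum>k<n. partial k f (\<phi> y) * partial i (\<lambda>y. \<phi> y k) y)"
proof -
  have D: "((\<lambda>t. f (\<phi> (y(i := t)))) has_real_derivative
      (\<Sum>k<n. partial k f (\<phi> y) * partial i (\<lambda>y. \<phi> y k) y)) (at (y i))" if "y \<in> W" "i < n" for y i
  proof -
    have "eventually (\<lambda>t. \<phi> (y(i := t)) \<in> En n) (nhds (y i))"
      using eventually_slice[OF W that] by (rule eventually_mono) (use \<phi> openin_Rn_subset[OF V] in blast)
    then show ?thesis
      using DERIV_chain_curve[OF V f, of "\<lambda>t. \<phi> (y(i := t))" "y i"] that \<phi> C1_on_DERIV[OF c] by simp
  qed
  have "continuous_on W \<phi>"
  proof (rule continuous_on_coordinatewise_then_product)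
    fix k show "continuous_on W (\<lambda>y. \<phi> y k)"
    proof (cases "k < n")
      case True then show ?thesis using c C1_on_continuous by blast
    next
      case False
      have "\<phi> y k = undefined" if "y \<in> W" for y
        using \<phi>[OF that] V openin_Rn_subset False by (fastforce simp: PiE_def extensional_def)
      then show ?thesis by (simp cong: continuous_on_cong)
    qed
  qed
  then have cont: "continuous_on W (\<lambda>y. h (\<phi> y))" if "continuous_on V h" for h :: "_ \<Rightarrow> real"
    using continuous_on_compose2[OF that] \<phi> by blast
  show "C1_on n W (\<lambda>y. f (\<phi> y))"
    by (rule C1_onI[OF _ D]) (auto intro!: continuous_intros cont C1_on_continuous[OF f]
        C1_on_continuous_partial[OF f] C1_on_continuous_partial[OF c])
  show "y \<in> W \<Longrightarrow> i < n \<Longrightarrow>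
      partial i (\<lambda>y. f (\<phi> y)) y = (\<Sum>k<n. partial k f (\<phi> y) * partial i (\<lambda>y. \<phi> y k) y)"
    by (rule partial_eqI[OF D])
qed

text \<open>The second difference is an increment in direction \<open>i\<close> of an increment in
  direction \<open>j\<close>. Two applications of the mean value theorem make its quotient by
  \<open>h\<^sup>2\<close> a mixed partial at a nearby point.\<close>

lemma second_difference_partial:
  assumes V: "openin (Rn n) V" and f: "C1_on n V f" and fi: "C1_on n V (partial i f)"
    and y: "y \<in> V" and i: "i < n" and j: "j < n" and ij: "i \<noteq> j" and e: "e > 0"
  obtains d where "d > 0" "\<And>h. 0 < h \<Longrightarrow> h < d \<Longrightarrow>
    \<bar>(f (y(i := y i + h, j := y j + h)) - f (y(i := y i + h)) - f (y(j := y j + h)) + f y) / h\<^sup>2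
      - partial j (partial i f) y\<bar> < e"
proof -
  have yE: "y \<in> En n" using y V openin_Rn_subset by blast
  obtain d where d: "d > 0" "\<And>w. w \<in> En n \<Longrightarrow> (\<And>i. i < n \<Longrightarrow> \<bar>w i - y i\<bar> < d) \<Longrightarrow>
      w \<in> V \<and> \<bar>partial j (partial i f) w - partial j (partial i f) y\<bar> < e"
    using continuous_on_Rn_box[OF V y C1_on_continuous_partial[OF fi j] e] by blast
  have box: "y(i := s, j := r) \<in> V \<and> \<bar>partial j (partial i f) (y(i := s, j := r)) - partial j (partial i f) y\<bar> < e"
    if "\<bar>s - y i\<bar> < d" "\<bar>r - y j\<bar> < d" for s r
    by (rule d(2)) (use that d(1) fun_upd_En yE i j in auto)
  have "\<bar>(f (y(i := y i + h, j := y j + h)) - f (y(i := y i + h)) - f (y(j := y j + h)) + f y) / h\<^sup>2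
      - partial j (partial i f) y\<bar> < e" if h: "0 < h" "h < d" for h
  proof -
    \<comment> \<open>The increment in direction \<open>j\<close> as a function of coordinate
      \<open>i\<close>; its derivative is an increment of \<open>partial i f\<close>.\<close>
    define g where "g = (\<lambda>s. f ((y(j := y j + h))(i := s)) - f (y(i := s)))"
    have tw: "(y(j := r))(i := s) = y(i := s, j := r)" for r s using ij by (simp add: fun_upd_twist)
    have tw': "y(i := s) = y(i := s, j := y j)" for s using ij by auto
    obtain s where s: "y i < s" "s < y i + h" "g (y i + h) - g (y i) =
        (y i + h - y i) * (partial i f ((y(j := y j + h))(i := s)) - partial i f (y(i := s)))"
    proof (rule exE[OF MVT2[of "y i" "y i + h" g "\<lambda>s. partial i f ((y(j := y j + h))(i := s)) - partial i f (y(i := s))"]])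
      fix s assume "y i \<le> s" "s \<le> y i + h"
      then have "(y(j := y j + h))(i := s) \<in> V" "y(i := s) \<in> V"
        using box[of s "y j + h"] box[of s "y j"] h d(1) tw tw'[of s] by auto
      then show "(g has_real_derivative
          partial i f ((y(j := y j + h))(i := s)) - partial i f (y(i := s))) (at s)"
        unfolding g_def by (intro DERIV_diff C1_on_DERIV_slice[OF f _ i])
    qed (use h that in auto)
    obtain r where r: "y j < r" "r < y j + h"
      "partial i f ((y(i := s))(j := y j + h)) - partial i f ((y(i := s))(j := y j)) =
       (y j + h - y j) * partial j (partial i f) ((y(i := s))(j := r))"
    proof (rule exE[OF MVT2[of "y j" "y j + h" "\<lambda>r. partial i f ((y(i := s))(j := r))"
          "\<lambda>r. partial j (partial i f) ((y(i := s))(j := r))"]])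
      fix r assume "y j \<le> r" "r \<le> y j + h"
      then have "(y(i := s))(j := r) \<in> V" using box[of s r] h s by auto
      then show "((\<lambda>r. partial i f ((y(i := s))(j := r))) has_real_derivative
         partial j (partial i f) ((y(i := s))(j := r))) (at r)"
        by (rule C1_on_DERIV_slice[OF fi _ j])
    qed (use h that in auto)
    have "f (y(i := y i + h, j := y j + h)) - f (y(i := y i + h)) - f (y(j := y j + h)) + f y
       = g (y i + h) - g (y i)"
      using ij by (simp add: g_def tw)
    also have "\<dots> = h * (h * partial j (partial i f) ((y(i := s))(j := r)))"
      using s(3) r(3) tw'[of s] by (simp add: tw)
    finally have "(f (y(i := y i + h, j := y j + h)) - f (y(i := y i + h)) - f (y(j := y j + h)) + f y) / h\<^sup>2
       = partial j (partial i f) (y(i := s, j := r))"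
      using h by (simp add: power2_eq_square)
    then show ?thesis using box[of s r] s r h by auto
  qed
  then show ?thesis using that d(1) by blast
qed

text \<open>The second difference does not see the order of \<open>i\<close> and \<open>j\<close>,
  so both mixed partials are limits of the same quotient.\<close>

lemma partial_commute:
  assumes V: "openin (Rn n) V" and f: "C1_on n V f" and fi: "C1_on n V (partial i f)"
    and fj: "C1_on n V (partial j f)" and y: "y \<in> V" and i: "i < n" and j: "j < n"
  shows "partial i (partial j f) y = partial j (partial i f) y"
proof (rule ccontr)
  \<comment> \<open>Half the supposed gap: no number is closer than this to both mixed
    partials.\<close>
  define e where "e = \<bar>partial i (partial j f) y - partial j (partial i f) y\<bar> / 2"
  assume ne: "partial i (partial j f) y \<noteq> partial j (partial i f) y"
  then have e: "e > 0" and ij: "i \<noteq> j" by (auto simp: e_def)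
  obtain d1 where d1: "d1 > 0" "\<And>h. 0 < h \<Longrightarrow> h < d1 \<Longrightarrow>
    \<bar>(f (y(i := y i + h, j := y j + h)) - f (y(i := y i + h)) - f (y(j := y j + h)) + f y) / h\<^sup>2
      - partial j (partial i f) y\<bar> < e"
    using second_difference_partial[OF V f fi y i j ij e] by blast
  obtain d2 where d2: "d2 > 0" "\<And>h. 0 < h \<Longrightarrow> h < d2 \<Longrightarrow>
    \<bar>(f (y(j := y j + h, i := y i + h)) - f (y(j := y j + h)) - f (y(i := y i + h)) + f y) / h\<^sup>2
      - partial i (partial j f) y\<bar> < e"
    using second_difference_partial[OF V f fj y j i ij[symmetric] e] by blast
  define h where "h = min d1 d2 / 2"
  have h: "0 < h" "h < d1" "h < d2" using d1(1) d2(1) by (auto simp: h_def)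
  have "f (y(j := y j + h, i := y i + h)) = f (y(i := y i + h, j := y j + h))"
    using ij by (simp add: fun_upd_twist)
  then have "\<bar>(f (y(i := y i + h, j := y j + h)) - f (y(i := y i + h)) - f (y(j := y j + h)) + f y) / h\<^sup>2
      - partial i (partial j f) y\<bar> < e"
    using d2(2)[OF h(1,3)] by (simp add: algebra_simps)
  moreover have False if "\<bar>x - a\<bar> < \<bar>b - a\<bar> / 2" "\<bar>x - b\<bar> < \<bar>b - a\<bar> / 2" for x a b :: real
    using that by (auto simp: abs_if split: if_splits)
  ultimately show False using d1(2)[OF h(1,2)] unfolding e_def by blast
qed

section \<open>Measurability and integration in the model space\<close>

lemma continuous_on_restrict_Rn: "continuous_on UNIV (\<lambda>x::nat \<Rightarrow> real. restrict x {..<n})"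
proof (rule continuous_on_coordinatewise_then_product)
  fix i show "continuous_on UNIV (\<lambda>x::nat \<Rightarrow> real. restrict x {..<n} i)"
    by (cases "i < n") (auto simp: restrict_def)
qed

text \<open>The product measure lives on extensional functions, the Borel sets on all functions.
  Measurability of the inclusion transfers open sets and continuous functions, which are first
  extended along the retraction \<open>restrict\<close>.\<close>

lemma id_measurable_leb: "(\<lambda>x. x) \<in> leb n \<rightarrow>\<^sub>M (borel :: (nat \<Rightarrow> real) measure)"
proof (rule measurable_coordinatewise_then_product)
  fix i show "(\<lambda>x. x i) \<in> borel_measurable (leb n)"
  proof (cases "i < n")
    case True then show ?thesis
      using measurable_component_singleton[of i "{..<n}" "\<lambda>_. lborel :: real measure"] by simp
  next
    case False
    then have "x i = undefined" if "x \<in> space (leb n)" for x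
      using that by (auto simp: space_PiM PiE_def extensional_def)
    then show ?thesis
      using measurable_cong[of "leb n" "\<lambda>x. x i" "\<lambda>_. undefined" "borel :: real measure"] by simp
  qed
qed

lemma space_leb: "space (leb n) = En n" by (simp add: space_PiM)

lemma openin_Rn_preimage:
  assumes V: "openin (Rn n) V"
  shows "open {x. restrict x {..<n} \<in> V}"
proof -
  have "openin (top_of_set (En n)) V" using V Rn_eq by metis
  then obtain T where T: "open T" "V = En n \<inter> T" by (auto simp: openin_open)
  have "open ((\<lambda>x::nat \<Rightarrow> real. restrict x {..<n}) -` T)"
    using continuous_on_restrict_Rn T(1) by (rule open_vimage[rotated])
  moreover have "(\<lambda>x. restrict x {..<n}) -` T = {x. restrict x {..<n} \<in> V}"
    using T(2) by auto
  ultimately show ?thesis by simp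
qed

lemma restrict_En: "x \<in> En n \<Longrightarrow> restrict x {..<n} = x"
  by (auto simp: PiE_def extensional_restrict)

lemma sets_leb_openin:
  assumes V: "openin (Rn n) V"
  shows "V \<in> sets (leb n)"
proof -
  have "(\<lambda>x. x) -` {x. restrict x {..<n} \<in> V} \<inter> space (leb n) \<in> sets (leb n)"
    using id_measurable_leb borel_open[OF openin_Rn_preimage[OF V]] by (rule measurable_sets)
  moreover have "(\<lambda>x. x) -` {x. restrict x {..<n} \<in> V} \<inter> space (leb n) = V"
    using openin_Rn_subset[OF V] by (auto simp: space_leb restrict_En)
  ultimately show ?thesis by simp
qed

lemma borel_measurable_leb_extend:
  fixes f :: "(nat \<Rightarrow> real) \<Rightarrow> real"
  assumes V: "openin (Rn n) V" and f: "continuous_on V f"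
  shows "(\<lambda>y. if y \<in> V then f y else 0) \<in> borel_measurable (leb n)"
proof -
  let ?V = "{x. restrict x {..<n} \<in> V}"
  have "continuous_on ?V (\<lambda>x. f (restrict x {..<n}))"
    using continuous_on_subset[OF continuous_on_restrict_Rn]
    by (intro continuous_on_compose2[OF f]) auto
  then have "(\<lambda>x. if x \<in> ?V then f (restrict x {..<n}) else 0) \<in> borel_measurable borel"
    using borel_open[OF openin_Rn_preimage[OF V]]
    by (intro borel_measurable_continuous_on_if) auto
  from measurable_compose[OF id_measurable_leb this]
  show ?thesis by (rule measurable_cong[THEN iffD1, rotated]) (auto simp: space_leb restrict_En)
qed

lemma compact_coordinate_bound:
  assumes K: "compactin (Rn n) K"
  obtains R where "R > 0" "\<And>y i. y \<in> K \<Longrightarrow> i < n \<Longrightarrow> \<bar>y i\<bar> < R"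
proof -
  have "compact K" using K unfolding Rn_eq by (simp add: compactin_subtopology)
  then have "bounded ((\<lambda>y. y i) ` K)" for i
    by (intro compact_imp_bounded compact_continuous_image) (auto intro: continuous_on_product_then_coordinatewise)
  then have "\<exists>b. \<forall>y\<in>K. \<bar>y i\<bar> \<le> b" for i by (auto simp: bounded_real)
  then obtain b where b: "\<And>i y. y \<in> K \<Longrightarrow> \<bar>y i\<bar> \<le> b i" by metis
  have "\<bar>y i\<bar> < 1 + (\<Sum>i<n. \<bar>b i\<bar>)" if "y \<in> K" "i < n" for y i
    using b[OF that(1), of i] member_le_sum[of i "{..<n}" "\<lambda>i. \<bar>b i\<bar>"] that(2) by simp
  moreover have "1 + (\<Sum>i<n. \<bar>b i\<bar>) > 0" by (intro add_pos_nonneg sum_nonneg) auto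
  ultimately show ?thesis using that by blast
qed

lemma emeasure_leb_box: "emeasure (leb n) (PiE {..<n} (\<lambda>_. {-R..R})) < \<infinity>"
proof -
  interpret product_sigma_finite "\<lambda>_::nat. lborel :: real measure" by standard
  have "emeasure (leb n) (PiE {..<n} (\<lambda>_. {-R..R})) = (\<Prod>i<n. emeasure lborel {-R..R})"
    by (rule emeasure_PiM) auto
  also have "\<dots> < \<infinity>" by (simp add: emeasure_lborel_Icc_eq ennreal_prod_eq_top power_less_top_ennreal)
  finally show ?thesis .
qed

lemma integrable_leb_compact:
  fixes f :: "(nat \<Rightarrow> real) \<Rightarrow> real"
  assumes K: "compactin (Rn n) K" and f: "continuous_on (En n) f" and z: "\<And>y. y \<in> En n - K \<Longrightarrow> f y = 0"
  shows "integrable (leb n) f"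
proof -
  obtain R where R: "R > 0" "\<And>y i. y \<in> K \<Longrightarrow> i < n \<Longrightarrow> \<bar>y i\<bar> < R"
    using compact_coordinate_bound[OF K] by blast
  have KE: "K \<subseteq> En n" using K compactin_subset_topspace by fastforce
  have "compact K" using K unfolding Rn_eq by (simp add: compactin_subtopology)
  then have "bounded (f ` K)"
    by (intro compact_imp_bounded compact_continuous_image continuous_on_subset[OF f KE])
  then obtain B where B: "\<And>y. y \<in> K \<Longrightarrow> \<bar>f y\<bar> \<le> B" by (auto simp: bounded_real)
  let ?box = "PiE {..<n} (\<lambda>_. {-R..R})"
  have Kb: "K \<subseteq> ?box" using R(2) KE by (force simp: PiE_iff abs_less_iff)
  have m: "f \<in> borel_measurable (leb n)"
  proof -
    show ?thesis using borel_measurable_leb_extend[OF openin_Rn_En f]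
      by (rule measurable_cong[THEN iffD1, rotated]) (auto simp: space_leb)
  qed
  have "?box \<in> sets (leb n)" by (rule sets_PiM_I_finite) auto
  then have "integrable (leb n) (\<lambda>y. \<bar>B\<bar> * indicator ?box y)"
    using emeasure_leb_box by (intro integrable_mult_right integrable_real_indicator)
  then show ?thesis
  proof (rule Bochner_Integration.integrable_bound[OF _ m], intro AE_I2)
    fix y assume "y \<in> space (leb n)"
    then show "norm (f y) \<le> norm (\<bar>B\<bar> * indicator ?box y)"
      using B[of y] z[of y] Kb by (cases "y \<in> K") (auto simp: space_leb indicator_def)
  qed
qed

text \<open>Fubini with coordinate \<open>i\<close> innermost: each inner integral is the difference
  of the values of \<open>F\<close> at two points off \<open>K\<close>.\<close>

lemma integral_partial_compact:
  assumes K: "compactin (Rn n) K" and F: "C1_on n (En n) F"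
    and z: "\<And>y. y \<in> En n - K \<Longrightarrow> F y = 0" and i: "i < n"
  shows "integrable (leb n) (partial i F)" "integral\<^sup>L (leb n) (partial i F) = 0"
proof -
  interpret product_sigma_finite "\<lambda>_::nat. lborel :: real measure" by standard
  have KE: "K \<subseteq> En n" using K compactin_subset_topspace by fastforce
  have "closedin (Rn n) K" using K by (intro compactin_imp_closedin) (auto simp: Hausdorff_space_product_topology)
  then have o: "openin (Rn n) (En n - K)" by (rule openin_diff[OF openin_Rn_En])
  have z': "partial i F y = 0" if "y \<in> En n - K" for y
    using partial_cong[OF o that i, of F "\<lambda>_. 0"] z by simp
  show int: "integrable (leb n) (partial i F)"
    using K C1_on_continuous_partial[OF F i] z' by (rule integrable_leb_compact)
  obtain R where R: "R > 0" "\<And>y i. y \<in> K \<Longrightarrow> i < n \<Longrightarrow> \<bar>y i\<bar> < R"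
    using compact_coordinate_bound[OF K] by blast
  have ins: "insert i ({..<n} - {i}) = {..<n}" using i by auto
  have "integral\<^sup>L (leb n) (partial i F) =
      (\<integral>x. (\<integral>t. partial i F (x(i := t)) \<partial>lborel) \<partial>Pi\<^sub>M ({..<n} - {i}) (\<lambda>_. lborel))"
    using product_integral_insert[of "{..<n} - {i}" i "partial i F", unfolded ins] int by simp
  also have "\<dots> = (\<integral>x. 0 \<partial>Pi\<^sub>M ({..<n} - {i}) (\<lambda>_. lborel :: real measure))"
  proof (rule Bochner_Integration.integral_cong[OF refl])
    fix x assume "x \<in> space (Pi\<^sub>M ({..<n} - {i}) (\<lambda>_. lborel :: real measure))"
    then have xE: "x(i := t) \<in> En n" for t using i by (auto simp: space_PiM PiE_def extensional_def)
    \<comment> \<open>Coordinates of points of \<open>K\<close> are strictly below \<open>R\<close>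
      in absolute value, so the endpoints \<open>-R\<close> and \<open>R\<close> themselves lie off
      \<open>K\<close>.\<close>
    have K0: "x(i := t) \<notin> K" if "R \<le> \<bar>t\<bar>" for t using R(2)[of "x(i := t)" i] i that by auto
    have D: "((\<lambda>t. F (x(i := t))) has_real_derivative partial i F (x(i := t))) (at t)" for t
      by (rule C1_on_DERIV_slice[OF F xE i])
    have "continuous_on UNIV (\<lambda>t. x(i := t))"
    proof (rule continuous_on_coordinatewise_then_product)
      fix k show "continuous_on UNIV (\<lambda>t. (x(i := t)) k)" by (cases "k = i") auto
    qed
    then have c: "continuous_on {-R..R} (\<lambda>t. partial i F (x(i := t)))"
      using xE by (intro continuous_on_compose2[OF C1_on_continuous_partial[OF F i]])
         (auto intro: continuous_on_subset)
    have "(\<integral>t. partial i F (x(i := t)) \<partial>lborel) = (\<integral>t. indicator {-R..R} t *\<^sub>R partial i F (x(i := t)) \<partial>lborel)"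
    proof (intro Bochner_Integration.integral_cong refl)
      fix t show "partial i F (x(i := t)) = indicator {-R..R} t *\<^sub>R partial i F (x(i := t))"
      proof (cases "R \<le> \<bar>t\<bar>")
        case True
        then have "partial i F (x(i := t)) = 0" by (intro z' DiffI xE K0)
        then show ?thesis by simp
      next
        case False
        then have "t \<in> {-R..R}" by auto
        then show ?thesis by simp
      qed
    qed
    also have "\<dots> = F (x(i := R)) - F (x(i := -R))"
      using R(1) c
      by (intro integral_FTC_atLeastAtMost[where F="\<lambda>t. F (x(i := t))"]
          has_field_derivative_at_within[OF D, unfolded has_real_derivative_iff_has_vector_derivative]) auto
    also have "\<dots> = 0" using z xE K0[of R] K0[of "-R"] R(1) by auto
    finally show "(\<integral>t. partial i F (x(i := t)) \<partial>lborel) = 0" .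
  qed
  finally show "integral\<^sup>L (leb n) (partial i F) = 0" by simp
qed

subsection \<open>Positive definite matrices\<close>

definition coeff_mat :: "nat \<Rightarrow> (nat \<Rightarrow> nat \<Rightarrow> real) \<Rightarrow> real mat"
  where "coeff_mat n A = Matrix.mat n n (\<lambda>(i, j). A i j)"

text \<open>The body of \<open>ginv\<close> for a bare array of coefficients, so that the linear
  algebra needs no chart.\<close>

definition inv_coeff :: "nat \<Rightarrow> (nat \<Rightarrow> nat \<Rightarrow> real) \<Rightarrow> nat \<Rightarrow> nat \<Rightarrow> real"
  where "inv_coeff n A i j = index_mat (the (mat_inverse (coeff_mat n A))) (i, j)"

definition pos_def :: "nat \<Rightarrow> (nat \<Rightarrow> nat \<Rightarrow> real) \<Rightarrow> bool"
  where "pos_def n A \<longleftrightarrow> (\<forall>i<n. \<forall>j<n. A i j = A j i) \<and>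
    (\<forall>v. (\<exists>i<n. v i \<noteq> 0) \<longrightarrow> (\<Sum>i<n. \<Sum>j<n. A i j * v i * v j) > 0)"

lemma coeff_mat_carrier [simp]: "coeff_mat n A \<in> carrier_mat n n"
  by (simp add: coeff_mat_def)

lemma coeff_mat_index [simp]: "i < n \<Longrightarrow> j < n \<Longrightarrow> coeff_mat n A $$ (i, j) = A i j"
  by (simp add: coeff_mat_def)

lemma coeff_mat_dim [simp]: "dim_row (coeff_mat n A) = n" "dim_col (coeff_mat n A) = n"
  by (simp_all add: coeff_mat_def)

lemma coeff_mat_mult:
  "coeff_mat n A * coeff_mat n B = coeff_mat n (\<lambda>i k. \<Sum>j<n. A i j * B j k)"
  by (rule eq_matI) (auto simp: scalar_prod_def atLeast0LessThan coeff_mat_def)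

lemma coeff_mat_eq_iff:
  "coeff_mat n A = coeff_mat n B \<longleftrightarrow> (\<forall>i<n. \<forall>j<n. A i j = B i j)"
  by (auto simp: coeff_mat_def mat_eq_iff)

lemma coeff_mat_delta: "coeff_mat n (\<lambda>i j. if i = j then 1 else 0) = 1\<^sub>m n"
  by (rule eq_matI) auto

lemma coeff_mat_entries: "M \<in> carrier_mat n n \<Longrightarrow> M = coeff_mat n (\<lambda>i j. M $$ (i, j))"
  by (rule eq_matI) auto

lemma pos_def_det_nonzero:
  assumes "pos_def n A"
  shows "Determinant.det (coeff_mat n A) \<noteq> 0"
proof
  assume "Determinant.det (coeff_mat n A) = 0"
  then obtain v where v: "v \<in> carrier_vec n" "v \<noteq> 0\<^sub>v n" "coeff_mat n A *\<^sub>v v = 0\<^sub>v n"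
    using det_0_iff_vec_prod_zero[OF coeff_mat_carrier] by blast
  have Av: "(\<Sum>j<n. A i j * vec_index v j) = 0" if "i < n" for i
  proof -
    have "vec_index (coeff_mat n A *\<^sub>v v) i = 0" using v(3) that by simp
    then show ?thesis using that v(1)
      by (simp add: scalar_prod_def atLeast0LessThan coeff_mat_def)
  qed
  have "\<exists>i<n. vec_index v i \<noteq> 0"
    using v(1,2) by (metis carrier_vecD eq_vecI index_zero_vec)
  then have "(\<Sum>i<n. \<Sum>j<n. A i j * vec_index v i * vec_index v j) > 0"
    using assms unfolding pos_def_def by blast
  moreover have "(\<Sum>i<n. \<Sum>j<n. A i j * vec_index v i * vec_index v j)
      = (\<Sum>i<n. vec_index v i * (\<Sum>j<n. A i j * vec_index v j))"
    by (simp add: sum_distrib_left ac_simps)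
  ultimately show False using Av by simp
qed

lemma inv_coeff_mat:
  assumes "Determinant.det (coeff_mat n A) \<noteq> 0"
  shows "coeff_mat n A * coeff_mat n (inv_coeff n A) = 1\<^sub>m n"
    and "coeff_mat n (inv_coeff n A) * coeff_mat n A = 1\<^sub>m n"
proof -
  have "coeff_mat n A \<in> Units (ring_mat TYPE(real) n n)"
    using assms by (intro det_non_zero_imp_unit) auto
  then have "mat_inverse (coeff_mat n A) \<noteq> None"
    using mat_inverse(1)[OF coeff_mat_carrier[of n A], where b=n] by blast
  then obtain B where B: "mat_inverse (coeff_mat n A) = Some B" by auto
  note inv = mat_inverse(2)[OF coeff_mat_carrier B]
  have "B = coeff_mat n (inv_coeff n A)"
    using inv coeff_mat_entries[of B n] unfolding inv_coeff_def B by simp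
  then show "coeff_mat n A * coeff_mat n (inv_coeff n A) = 1\<^sub>m n"
    and "coeff_mat n (inv_coeff n A) * coeff_mat n A = 1\<^sub>m n"
    using inv by auto
qed

lemma
  assumes "Determinant.det (coeff_mat n A) \<noteq> 0" and i: "i < n" and k: "k < n"
  shows mult_inv_coeff: "(\<Sum>j<n. A i j * inv_coeff n A j k) = (if i = k then 1 else 0)"
    and inv_coeff_mult: "(\<Sum>j<n. inv_coeff n A i j * A j k) = (if i = k then 1 else 0)"
  using inv_coeff_mat[OF assms(1)] i k
  unfolding coeff_mat_mult coeff_mat_delta[symmetric] coeff_mat_eq_iff by blast+

text \<open>A right inverse suffices: multiplicativity of the determinant forces \<open>A\<close> to
  be invertible.\<close>

lemma inv_coeff_unique:
  assumes AB: "\<And>i k. i < n \<Longrightarrow> k < n \<Longrightarrow> (\<Sum>j<n. A i j * B j k) = (if i = k then 1 else 0)"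
    and i: "i < n" and k: "k < n"
  shows "B i k = inv_coeff n A i k"
proof -
  have 1: "coeff_mat n A * coeff_mat n B = 1\<^sub>m n"
    using AB unfolding coeff_mat_mult coeff_mat_delta[symmetric] coeff_mat_eq_iff by blast
  then have "Determinant.det (coeff_mat n A) * Determinant.det (coeff_mat n B) = 1"
    using det_mult[OF coeff_mat_carrier coeff_mat_carrier, of n A B] by simp
  then have d: "Determinant.det (coeff_mat n A) \<noteq> 0" by auto
  have "coeff_mat n B = (coeff_mat n (inv_coeff n A) * coeff_mat n A) * coeff_mat n B"
    using inv_coeff_mat(2)[OF d] by simp
  also have "\<dots> = coeff_mat n (inv_coeff n A)"
    using 1 by (subst assoc_mult_mat[of _ n n _ n _ n]) auto
  finally show ?thesis using i k unfolding coeff_mat_eq_iff by blast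
qed

lemma inv_coeff_sym:
  assumes d: "Determinant.det (coeff_mat n A) \<noteq> 0" and s: "\<And>i j. i < n \<Longrightarrow> j < n \<Longrightarrow> A i j = A j i"
    and i: "i < n" and j: "j < n"
  shows "inv_coeff n A i j = inv_coeff n A j i"
proof (rule inv_coeff_unique[where B="\<lambda>i j. inv_coeff n A j i", symmetric])
  fix i k assume ik: "i < n" "k < n"
  have "(\<Sum>j<n. A i j * inv_coeff n A k j) = (\<Sum>j<n. inv_coeff n A k j * A j i)"
    using s ik by (intro sum.cong) auto
  also have "\<dots> = (if i = k then 1 else 0)" using inv_coeff_mult[OF d ik(2,1)] by auto
  finally show "(\<Sum>j<n. A i j * inv_coeff n A k j) = (if i = k then 1 else 0)" .
qed (use i j in auto)

text \<open>Cramer's rule exhibits the inverse metric as a quotient of polynomials in the metric,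
  which is how its C^1 regularity is obtained.\<close>

lemma inv_coeff_cofactor:
  assumes d: "Determinant.det (coeff_mat n A) \<noteq> 0" and i: "i < n" and j: "j < n"
  shows "inv_coeff n A i j = cofactor (coeff_mat n A) j i / Determinant.det (coeff_mat n A)"
proof (rule inv_coeff_unique[symmetric, OF _ i j])
  fix i k assume ik: "i < n" "k < n"
  have "(coeff_mat n A * adj_mat (coeff_mat n A)) $$ (i, k)
      = (Determinant.det (coeff_mat n A) \<cdot>\<^sub>m 1\<^sub>m n) $$ (i, k)"
    using adj_mat(2)[OF coeff_mat_carrier] by simp
  then have "(\<Sum>j<n. A i j * cofactor (coeff_mat n A) k j) = (if i = k then Determinant.det (coeff_mat n A) else 0)"
    using ik by (simp add: adj_mat_def scalar_prod_def atLeast0LessThan coeff_mat_def)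
  then show "(\<Sum>j<n. A i j * (cofactor (coeff_mat n A) k j / Determinant.det (coeff_mat n A))) = (if i = k then 1 else 0)"
    using d by (simp add: sum_divide_distrib[symmetric])
qed

text \<open>Completing the square in the last variable, by induction on \<open>n\<close>. For
  \<open>A\<close> an inverse metric, the columns of \<open>E\<close> form an orthonormal
  frame.\<close>

lemma pos_def_imp_factor:
  assumes "pos_def n A"
  shows "\<exists>E. \<forall>i<n. \<forall>j<n. A i j = (\<Sum>a<n. E i a * E j a)"
  using assms
proof (induction n arbitrary: A)
  case 0 then show ?case by simp
next
  case (Suc n)
  have sym: "A i j = A j i" if "i < Suc n" "j < Suc n" for i j
    using Suc.prems that unfolding pos_def_def by blast
  have pos: "(\<Sum>i<Suc n. \<Sum>j<Suc n. A i j * v i * v j) > 0" if "\<exists>i<Suc n. v i \<noteq> 0" for v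
    using Suc.prems that unfolding pos_def_def by blast
  define q where "q = A n n"
  have split: "(\<Sum>i<Suc n. \<Sum>j<Suc n. A i j * v i * v j) =
     (\<Sum>i<n. \<Sum>j<n. A i j * v i * v j) + 2 * v n * (\<Sum>i<n. A i n * v i) + q * v n * v n" for v
  proof -
    have "(\<Sum>j<n. A n j * v n * v j) = v n * (\<Sum>i<n. A i n * v i)"
      unfolding sum_distrib_left by (intro sum.cong) (auto simp: sym)
    moreover have "(\<Sum>i<n. A i n * v i * v n) = v n * (\<Sum>i<n. A i n * v i)"
      unfolding sum_distrib_left by (intro sum.cong) auto
    ultimately show ?thesis by (simp add: sum.distrib q_def)
  qed
  have q: "q > 0"
    using pos[of "\<lambda>i. if i = n then 1 else 0"] unfolding split by auto
  \<comment> \<open>The Schur complement of the last diagonal entry: what remains of the quadratic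
    form once the square in the last variable is split off.\<close>
  define A' where "A' = (\<lambda>i j. A i j - A i n * A j n / q)"
  have "pos_def n A'"
    unfolding pos_def_def
  proof (intro conjI allI impI)
    fix i j assume "i < n" "j < n"
    then show "A' i j = A' j i" using sym[of i j] by (simp add: A'_def)
  next
    fix v :: "nat \<Rightarrow> real" assume v: "\<exists>i<n. v i \<noteq> 0"
    define s where "s = (\<Sum>i<n. A i n * v i)"
    \<comment> \<open>The last coordinate minimises the form for the given first \<open>n\<close>
      coordinates; the minimum is the form of \<open>A'\<close> at \<open>v\<close>.\<close>
    define w where "w = v(n := - s / q)"
    have "\<exists>i<Suc n. w i \<noteq> 0" using v by (auto simp: w_def less_Suc_eq)
    then have "0 < (\<Sum>i<n. \<Sum>j<n. A i j * w i * w j) + 2 * w n * (\<Sum>i<n. A i n * w i) + q * w n * w n"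
      unfolding split[symmetric] by (rule pos)
    moreover have "(\<Sum>i<n. A i n * w i) = s" by (simp add: w_def s_def)
    moreover have "(\<Sum>i<n. \<Sum>j<n. A i j * w i * w j) = (\<Sum>i<n. \<Sum>j<n. A i j * v i * v j)"
      by (simp add: w_def)
    moreover have "2 * w n * s + q * w n * w n = - (s * s / q)"
      using q by (simp add: w_def field_simps)
    ultimately have "0 < (\<Sum>i<n. \<Sum>j<n. A i j * v i * v j) - s * s / q"
      by simp
    also have "s * s = (\<Sum>i<n. \<Sum>j<n. (A i n * v i) * (A j n * v j))"
      by (simp add: s_def sum_product)
    also have "(\<Sum>i<n. \<Sum>j<n. A i j * v i * v j) - (\<Sum>i<n. \<Sum>j<n. (A i n * v i) * (A j n * v j)) / q
      = (\<Sum>i<n. \<Sum>j<n. A' i j * v i * v j)"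
      by (simp add: A'_def sum_divide_distrib sum_subtractf[symmetric] algebra_simps)
    finally show "0 < (\<Sum>i<n. \<Sum>j<n. A' i j * v i * v j)" .
  qed
  then obtain E where E: "\<And>i j. i < n \<Longrightarrow> j < n \<Longrightarrow> A' i j = (\<Sum>a<n. E i a * E j a)"
    using Suc.IH by blast
  \<comment> \<open>Column \<open>n\<close> carries the square that was split off; row
    \<open>n\<close> vanishes in all other columns.\<close>
  define F where "F = (\<lambda>i a. if a = n then A i n / sqrt q else if i = n then 0 else E i a)"
  have "A i j = (\<Sum>a<Suc n. F i a * F j a)" if ij: "i < Suc n" "j < Suc n" for i j
  proof -
    have last: "F i n * F j n = A i n * A j n / q"
      using q by (simp add: F_def)
    show ?thesis
    proof (cases "i < n \<and> j < n")
      case True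
      then have "(\<Sum>a<n. F i a * F j a) = A' i j" using E by (simp add: F_def)
      then show ?thesis using last by (simp add: A'_def)
    next
      case False
      then have "(\<Sum>a<n. F i a * F j a) = 0" using ij by (auto simp: F_def intro!: sum.neutral)
      moreover have "A i n * A j n / q = A i j"
        using False ij q sym[of n j] by (auto simp: less_Suc_eq q_def)
      ultimately show ?thesis using last by simp
    qed
  qed
  then show ?case by blast
qed

text \<open>Factoring \<open>A\<close> as \<open>E\<close> times its transpose makes the determinant
  a square, and it is not 0.\<close>

lemma pos_def_det_pos:
  assumes "pos_def n A"
  shows "Determinant.det (coeff_mat n A) > 0"
proof -
  obtain E where E: "\<And>i j. i < n \<Longrightarrow> j < n \<Longrightarrow> A i j = (\<Sum>a<n. E i a * E j a)"
    using pos_def_imp_factor[OF assms] by blast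
  have "coeff_mat n A = coeff_mat n E * coeff_mat n (\<lambda>i j. E j i)"
    unfolding coeff_mat_mult coeff_mat_eq_iff using E by blast
  moreover have "coeff_mat n (\<lambda>i j. E j i) = transpose_mat (coeff_mat n E)"
    by (rule eq_matI) auto
  ultimately have "Determinant.det (coeff_mat n A) = (Determinant.det (coeff_mat n E))\<^sup>2"
    by (simp add: det_mult[of _ n] det_transpose[of _ n] power2_eq_square)
  then show ?thesis using pos_def_det_nonzero[OF assms] by (simp add: zero_less_power2)
qed

text \<open>The substitution \<open>v = A w\<close> turns the form of the inverse at
  \<open>v\<close> into the form of \<open>A\<close> at \<open>w\<close>.\<close>

lemma pos_def_inv_coeff:
  assumes A: "pos_def n A"
  shows "pos_def n (inv_coeff n A)"
  unfolding pos_def_def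
proof (intro conjI allI impI)
  have sym: "\<And>i j. i < n \<Longrightarrow> j < n \<Longrightarrow> A i j = A j i" using A by (auto simp: pos_def_def)
  note d = pos_def_det_nonzero[OF A]
  fix i j assume "i < n" "j < n"
  then show "inv_coeff n A i j = inv_coeff n A j i" using inv_coeff_sym[OF d sym] by blast
next
  have sym: "\<And>i j. i < n \<Longrightarrow> j < n \<Longrightarrow> A i j = A j i" using A by (auto simp: pos_def_def)
  note d = pos_def_det_nonzero[OF A]
  fix v :: "nat \<Rightarrow> real" assume v: "\<exists>i<n. v i \<noteq> 0"
  define w where "w = (\<lambda>i. \<Sum>j<n. inv_coeff n A i j * v j)"
  have Aw: "(\<Sum>j<n. A i j * w j) = v i" if "i < n" for i
  proof -
    have "(\<Sum>j<n. A i j * w j) = (\<Sum>j<n. \<Sum>k<n. A i j * inv_coeff n A j k * v k)"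
      by (simp add: w_def sum_distrib_left mult.assoc)
    also have "\<dots> = (\<Sum>k<n. (\<Sum>j<n. A i j * inv_coeff n A j k) * v k)"
      by (subst sum.swap) (simp add: sum_distrib_right)
    also have "\<dots> = (\<Sum>k<n. (if i = k then 1 else 0) * v k)"
      using mult_inv_coeff[OF d that] by simp
    also have "\<dots> = v i" using that by (simp add: if_distrib[of "\<lambda>x. x * _"] cong: if_cong)
    finally show ?thesis .
  qed
  have "\<exists>i<n. w i \<noteq> 0"
  proof (rule ccontr)
    assume "\<not> ?thesis"
    then have "v i = 0" if "i < n" for i using Aw[OF that] by simp
    then show False using v by blast
  qed
  then have "0 < (\<Sum>i<n. \<Sum>j<n. A i j * w i * w j)" using A by (auto simp: pos_def_def)
  also have "\<dots> = (\<Sum>i<n. w i * (\<Sum>j<n. A i j * w j))"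
    by (simp add: sum_distrib_left ac_simps)
  also have "\<dots> = (\<Sum>i<n. w i * v i)" using Aw by simp
  also have "\<dots> = (\<Sum>i<n. \<Sum>j<n. inv_coeff n A i j * v i * v j)"
    by (simp add: w_def sum_distrib_left sum_distrib_right mult_ac)
  finally show "0 < (\<Sum>i<n. \<Sum>j<n. inv_coeff n A i j * v i * v j)" .
qed

text \<open>The product rule removes one factor from each term of the Leibniz expansion. A
  permutation other than the identity moves at least two indices, so an off-diagonal entry remains,
  which is 0 at the identity matrix; only the diagonal product contributes.\<close>

lemma DERIV_det_at_identity:
  assumes d: "\<And>i j. i < n \<Longrightarrow> j < n \<Longrightarrow> ((\<lambda>t. C t i j) has_real_derivative C' i j) (at t0)"
    and 1: "\<And>i j. i < n \<Longrightarrow> j < n \<Longrightarrow> C t0 i j = (if i = j then 1 else 0)"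
  shows "((\<lambda>t. Determinant.det (coeff_mat n (C t))) has_real_derivative (\<Sum>i<n. C' i i)) (at t0)"
proof -
  let ?S = "{p. p permutes {0..<n}}"
  have lt: "p i < n" if "p \<in> ?S" "i < n" for p i
    using that permutes_in_image[of p "{0..<n}" i] by simp
  have det: "Determinant.det (coeff_mat n (C t)) = (\<Sum>p\<in>?S. signof p * (\<Prod>i<n. C t i (p i)))" for t
    unfolding det_def'[OF coeff_mat_carrier]
    by (intro sum.cong refl arg_cong2[where f="(*)"] prod.cong) (auto simp: atLeast0LessThan lt)
  have prod: "((\<lambda>t. \<Prod>i<n. C t i (p i)) has_real_derivative
      (\<Sum>i<n. C' i (p i) * (\<Prod>j\<in>{..<n} - {i}. C t0 j (p j)))) (at t0)" if "p \<in> ?S" for p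
    by (rule has_field_derivative_prod) (use d lt[OF that] in auto)
  have "((\<lambda>t. Determinant.det (coeff_mat n (C t))) has_real_derivative
      (\<Sum>p\<in>?S. signof p * (\<Sum>i<n. C' i (p i) * (\<Prod>j\<in>{..<n} - {i}. C t0 j (p j))))) (at t0)"
    unfolding det by (intro DERIV_sum DERIV_cmult prod)
  moreover have "(\<Sum>p\<in>?S. signof p * (\<Sum>i<n. C' i (p i) * (\<Prod>j\<in>{..<n} - {i}. C t0 j (p j))))
     = (\<Sum>p\<in>{id}. signof p * (\<Sum>i<n. C' i (p i) * (\<Prod>j\<in>{..<n} - {i}. C t0 j (p j))))"
  proof (rule sum.mono_neutral_right)
    show "{id} \<subseteq> ?S" by (auto intro: permutes_id)
    show "\<forall>p\<in>?S - {id}. signof p * (\<Sum>i<n. C' i (p i) * (\<Prod>j\<in>{..<n} - {i}. C t0 j (p j))) = 0"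
    proof
      fix p assume p: "p \<in> ?S - {id}"
      have "(\<Prod>j\<in>{..<n} - {i}. C t0 j (p j)) = 0" if i: "i < n" for i
      proof -
        \<comment> \<open>An injective map that fixes every index other than \<open>i\<close> also
          fixes \<open>i\<close>.\<close>
        have "\<exists>j<n. j \<noteq> i \<and> p j \<noteq> j"
        proof (rule ccontr)
          assume a: "\<not> ?thesis"
          have pp: "p permutes {0..<n}" using p by simp
          have "p j = j" if "j \<noteq> i" for j
            using a that permutes_not_in[OF pp, of j] by (cases "j < n") auto
          moreover from this have "p i = i"
            using permutes_inj[OF pp] by (metis injD)
          ultimately have "p = id" by (metis eq_id_iff)
          with p show False by simp
        qed
        then obtain j where "j < n" "j \<noteq> i" "p j \<noteq> j" by blast
        then show ?thesis using 1[of j "p j"] lt[of p j] p by (intro prod_zero) auto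
      qed
      then have "(\<Sum>i<n. C' i (p i) * (\<Prod>j\<in>{..<n} - {i}. C t0 j (p j))) = 0"
        by (intro sum.neutral ballI) (simp only: lessThan_iff mult_zero_right)
      then show "signof p * (\<Sum>i<n. C' i (p i) * (\<Prod>j\<in>{..<n} - {i}. C t0 j (p j))) = 0"
        by (simp only: mult_zero_right)
    qed
  qed (simp add: finite_permutations)
  moreover have "(\<Sum>i<n. C' i i * (\<Prod>j\<in>{..<n} - {i}. C t0 j j)) = (\<Sum>i<n. C' i i)"
    using 1 by (intro sum.cong) auto
  ultimately show ?thesis by simp
qed

text \<open>Jacobi's formula, reduced to the derivative at the identity by multiplicativity.\<close>

lemma DERIV_det:
  assumes d: "\<And>i j. i < n \<Longrightarrow> j < n \<Longrightarrow> ((\<lambda>t. A t i j) has_real_derivative A' i j) (at t0)"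
    and nz: "Determinant.det (coeff_mat n (A t0)) \<noteq> 0"
  shows "((\<lambda>t. Determinant.det (coeff_mat n (A t))) has_real_derivative
    Determinant.det (coeff_mat n (A t0)) * (\<Sum>i<n. \<Sum>j<n. inv_coeff n (A t0) i j * A' j i)) (at t0)"
proof -
  define B where "B = inv_coeff n (A t0)"
  define C where "C = (\<lambda>t i k. \<Sum>j<n. B i j * A t j k)"
  have m: "coeff_mat n (C t) = coeff_mat n B * coeff_mat n (A t)" for t
    by (simp add: C_def coeff_mat_mult)
  have "Determinant.det (coeff_mat n (A t0)) * Determinant.det (coeff_mat n B) = 1"
    using inv_coeff_mat(1)[OF nz] det_mult[OF coeff_mat_carrier coeff_mat_carrier, of n "A t0" B]
    by (simp add: B_def)
  then have eq: "Determinant.det (coeff_mat n (A t)) =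
      Determinant.det (coeff_mat n (A t0)) * Determinant.det (coeff_mat n (C t))" for t
    unfolding m det_mult[OF coeff_mat_carrier coeff_mat_carrier] by (simp add: mult.assoc[symmetric])
  have "((\<lambda>t. Determinant.det (coeff_mat n (C t))) has_real_derivative
      (\<Sum>i<n. (\<Sum>j<n. B i j * A' j i))) (at t0)"
    unfolding C_def
    by (rule DERIV_det_at_identity)
       (auto intro!: DERIV_sum DERIV_cmult d simp: B_def inv_coeff_mult[OF nz])
  from DERIV_cmult[OF this, of "Determinant.det (coeff_mat n (A t0))"] show ?thesis
    unfolding eq[symmetric] B_def .
qed

section \<open>Change of basis and norm bounds for covariant 2-tensors\<close>

lemma sum_swap22:
  "(\<Sum>i\<in>A. \<Sum>j\<in>B. \<Sum>a\<in>C. \<Sum>b\<in>D. F i j a b) = (\<Sum>a\<in>C. \<Sum>b\<in>D. \<Sum>i\<in>A. \<Sum>j\<in>B. F i j a b)"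
proof -
  have "(\<Sum>i\<in>A. \<Sum>j\<in>B. \<Sum>a\<in>C. \<Sum>b\<in>D. F i j a b) = (\<Sum>i\<in>A. \<Sum>a\<in>C. \<Sum>j\<in>B. \<Sum>b\<in>D. F i j a b)"
    by (intro sum.cong refl sum.swap)
  also have "\<dots> = (\<Sum>a\<in>C. \<Sum>i\<in>A. \<Sum>j\<in>B. \<Sum>b\<in>D. F i j a b)" by (rule sum.swap)
  also have "\<dots> = (\<Sum>a\<in>C. \<Sum>i\<in>A. \<Sum>b\<in>D. \<Sum>j\<in>B. F i j a b)"
    by (intro sum.cong refl sum.swap)
  also have "\<dots> = (\<Sum>a\<in>C. \<Sum>b\<in>D. \<Sum>i\<in>A. \<Sum>j\<in>B. F i j a b)"
    by (intro sum.cong refl sum.swap)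
  finally show ?thesis .
qed

lemma abs_le_sqrtI: "x\<^sup>2 \<le> y \<Longrightarrow> \<bar>x\<bar> \<le> sqrt y"
  using real_sqrt_le_mono[of "x\<^sup>2" y] by simp

lemma sum_delta_mult:
  fixes f :: "nat \<Rightarrow> real"
  assumes "i < n"
  shows "(\<Sum>j<n. (if i = j then 1 else 0) * f j) = f i" "(\<Sum>j<n. f j * (if j = i then 1 else 0)) = f i"
  using assms by (simp_all add: if_distrib[of "\<lambda>x. x * _"] if_distrib[of "\<lambda>x. _ * x"] cong: if_cong)

text \<open>In matrices \<open>H = J^T G J\<close>, hence \<open>J^T (G J H^-1) = 1\<close>. For
  square matrices the two factors may be exchanged, giving \<open>G (J H^-1 J^T) = 1\<close>, so the
  bracket is the inverse of \<open>G\<close>.\<close>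

lemma inv_coeff_transform:
  assumes G: "pos_def n G" and H: "pos_def n H"
    and HG: "\<And>i j. i < n \<Longrightarrow> j < n \<Longrightarrow> H i j = (\<Sum>k<n. \<Sum>l<n. G k l * J k i * J l j)"
    and k: "k < n" and l: "l < n"
  shows "(\<Sum>i<n. \<Sum>j<n. inv_coeff n H i j * (J k i * J l j)) = inv_coeff n G k l"
proof -
  let ?JT = "\<lambda>i k. J k i"
  let ?c = "coeff_mat n"
  have "H i j = (\<Sum>l<n. (\<Sum>k<n. J k i * G k l) * J l j)" if "i < n" "j < n" for i j
    unfolding HG[OF that] sum_distrib_right by (subst sum.swap) (simp add: mult_ac)
  then have HM: "?c H = ?c ?JT * ?c G * ?c J"
    unfolding coeff_mat_mult coeff_mat_eq_iff by blast
  let ?A = "?c G * (?c J * ?c (inv_coeff n H))"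
  have A: "?A \<in> carrier_mat n n" by (intro mult_carrier_mat[of _ n n _ n] coeff_mat_carrier)
  have assoc: "X * Y * Z = X * (Y * Z)" if "X \<in> carrier_mat n n" "Y \<in> carrier_mat n n" "Z \<in> carrier_mat n n"
    for X Y Z :: "real mat"
    using assoc_mult_mat[OF that] .
  have "?c ?JT * ?A = ?c H * ?c (inv_coeff n H)"
    unfolding HM by (simp add: assoc mult_carrier_mat[of _ n n])
  also have "\<dots> = 1\<^sub>m n" by (rule inv_coeff_mat[OF pos_def_det_nonzero[OF H]])
  finally have "?A * ?c ?JT = 1\<^sub>m n"
    by (rule mat_mult_left_right_inverse[OF coeff_mat_carrier A])
  then have "?c G * (?c J * ?c (inv_coeff n H) * ?c ?JT) = 1\<^sub>m n"
    by (simp add: assoc mult_carrier_mat[of _ n n])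
  then have "(\<Sum>j<n. (\<Sum>i<n. J k i * inv_coeff n H i j) * J l j) = inv_coeff n G k l"
    unfolding coeff_mat_mult coeff_mat_delta[symmetric] coeff_mat_eq_iff
    by (intro inv_coeff_unique[where B="\<lambda>k l. \<Sum>j<n. (\<Sum>i<n. J k i * inv_coeff n H i j) * J l j"] k l) auto
  then show ?thesis
    unfolding sum_distrib_right by (subst sum.swap) (simp add: mult_ac)
qed

text \<open>Follows by collecting the factors \<open>J\<close> around the inverse metric. The array
  \<open>T\<close> is arbitrary so that a contraction over four indices can be treated two indices
  at a time.\<close>

lemma inv_coeff_contract:
  assumes "pos_def n G" "pos_def n H"
    and "\<And>i j. i < n \<Longrightarrow> j < n \<Longrightarrow> H i j = (\<Sum>k<n. \<Sum>l<n. G k l * J k i * J l j)"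
  shows "(\<Sum>i<n. \<Sum>j<n. inv_coeff n H i j * (\<Sum>k<n. \<Sum>l<n. J k i * J l j * T k l)) =
    (\<Sum>k<n. \<Sum>l<n. inv_coeff n G k l * T k l)"
proof -
  have "(\<Sum>i<n. \<Sum>j<n. inv_coeff n H i j * (\<Sum>k<n. \<Sum>l<n. J k i * J l j * T k l)) =
     (\<Sum>k<n. \<Sum>l<n. \<Sum>i<n. \<Sum>j<n. inv_coeff n H i j * (J k i * J l j * T k l))"
    unfolding sum_distrib_left by (rule sum_swap22)
  also have "\<dots> = (\<Sum>k<n. \<Sum>l<n. (\<Sum>i<n. \<Sum>j<n. inv_coeff n H i j * (J k i * J l j)) * T k l)"
    by (simp add: sum_distrib_right mult.assoc)
  also have "\<dots> = (\<Sum>k<n. \<Sum>l<n. inv_coeff n G k l * T k l)"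
    using inv_coeff_transform[OF assms] by simp
  finally show ?thesis .
qed

context
  fixes n :: nat and P :: "nat \<Rightarrow> nat \<Rightarrow> real"
  assumes P: "pos_def n P"
begin

lemma pos_def_nonneg: "(\<Sum>i<n. \<Sum>j<n. P i j * v i * v j) \<ge> 0"
proof (cases "\<exists>i<n. v i \<noteq> 0")
  case True then show ?thesis using P by (auto simp: pos_def_def intro: less_imp_le)
qed simp

text \<open>In an orthonormal frame both bounds are the Cauchy-Schwarz inequality for sums.\<close>

lemma
  fixes H :: "nat \<Rightarrow> nat \<Rightarrow> real"
  defines "N \<equiv> (\<Sum>i<n. \<Sum>j<n. \<Sum>k<n. \<Sum>l<n. P i k * P j l * H i j * H k l)"
  shows tensor_quadratic_bound:
      "\<bar>\<Sum>i<n. \<Sum>j<n. H i j * (\<Sum>k<n. P i k * u k) * (\<Sum>k<n. P j k * u k)\<bar>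
        \<le> sqrt N * (\<Sum>i<n. \<Sum>j<n. P i j * u i * u j)"
    and tensor_trace_bound: "\<bar>\<Sum>i<n. \<Sum>j<n. P i j * H i j\<bar> \<le> sqrt (real n) * sqrt N"
    and tensor_norm_nonneg: "N \<ge> 0"
proof -
  obtain E where E: "\<And>i j. i < n \<Longrightarrow> j < n \<Longrightarrow> P i j = (\<Sum>a<n. E i a * E j a)"
    using pos_def_imp_factor[OF P] by blast
  \<comment> \<open>As \<open>P\<close> is \<open>E\<close> times its transpose, the columns of
    \<open>E\<close> are the frame vectors; \<open>T\<close> and \<open>p\<close> are the tensor
    \<open>H\<close> and the covector \<open>u\<close> in this frame.\<close>
  define T where "T = (\<lambda>a b. \<Sum>i<n. \<Sum>j<n. E i a * E j b * H i j)"
  define p where "p = (\<lambda>a. \<Sum>i<n. E i a * u i)"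
  have "N = (\<Sum>i<n. \<Sum>j<n. \<Sum>k<n. \<Sum>l<n. \<Sum>a<n. \<Sum>b<n. (E i a * E j b * H i j) * (E k a * E l b * H k l))"
    unfolding N_def
  proof (intro sum.cong refl)
    fix i j k l assume "i \<in> {..<n}" "j \<in> {..<n}" "k \<in> {..<n}" "l \<in> {..<n}"
    then have "P i k * P j l * H i j * H k l =
        (\<Sum>a<n. E i a * E k a) * (\<Sum>b<n. E j b * E l b) * (H i j * H k l)"
      by (simp add: E mult.assoc)
    also have "\<dots> = (\<Sum>a<n. \<Sum>b<n. (E i a * E j b * H i j) * (E k a * E l b * H k l))"
      unfolding sum_product by (simp add: sum_distrib_left sum_distrib_right mult_ac)
    finally show "P i k * P j l * H i j * H k l =
        (\<Sum>a<n. \<Sum>b<n. (E i a * E j b * H i j) * (E k a * E l b * H k l))" .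
  qed
  also have "\<dots> = (\<Sum>i<n. \<Sum>j<n. \<Sum>a<n. \<Sum>b<n. \<Sum>k<n. \<Sum>l<n. (E i a * E j b * H i j) * (E k a * E l b * H k l))"
    by (intro sum.cong refl sum_swap22)
  also have "\<dots> = (\<Sum>a<n. \<Sum>b<n. \<Sum>i<n. \<Sum>j<n. \<Sum>k<n. \<Sum>l<n. (E i a * E j b * H i j) * (E k a * E l b * H k l))"
    by (rule sum_swap22)
  also have "\<dots> = (\<Sum>a<n. \<Sum>b<n. (T a b)\<^sup>2)"
  proof -
    have "(\<Sum>i<n. \<Sum>j<n. \<Sum>k<n. \<Sum>l<n. e i j * e k l) = (\<Sum>i<n. \<Sum>j<n. e i j)\<^sup>2"
      for e :: "nat \<Rightarrow> nat \<Rightarrow> real"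
      by (simp only: power2_eq_square sum_product) (intro sum.cong refl sum.swap)
    then show ?thesis unfolding T_def by simp
  qed
  finally have N: "N = (\<Sum>a<n. \<Sum>b<n. (T a b)\<^sup>2)" .
  then show "N \<ge> 0" by (simp add: sum_nonneg)
  have up: "(\<Sum>k<n. P i k * u k) = (\<Sum>a<n. E i a * p a)" if "i < n" for i
    unfolding p_def sum_distrib_left by (subst sum.swap) (simp add: E that sum_distrib_right mult.assoc)
  have "(\<Sum>i<n. \<Sum>j<n. P i j * u i * u j) = (\<Sum>i<n. u i * (\<Sum>j<n. P i j * u j))"
    by (simp add: sum_distrib_left mult_ac)
  also have "\<dots> = (\<Sum>i<n. u i * (\<Sum>a<n. E i a * p a))" by (simp add: up)
  also have "\<dots> = (\<Sum>a<n. \<Sum>i<n. u i * (E i a * p a))"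
    unfolding sum_distrib_left by (rule sum.swap)
  also have "\<dots> = (\<Sum>a<n. (p a)\<^sup>2)"
    by (simp add: p_def power2_eq_square sum_distrib_left sum_distrib_right mult_ac)
  finally have q: "(\<Sum>i<n. \<Sum>j<n. P i j * u i * u j) = (\<Sum>a<n. (p a)\<^sup>2)" .
  have "(\<Sum>i<n. \<Sum>j<n. H i j * (\<Sum>k<n. P i k * u k) * (\<Sum>k<n. P j k * u k))
     = (\<Sum>i<n. \<Sum>j<n. \<Sum>a<n. \<Sum>b<n. E i a * E j b * H i j * (p a * p b))"
  proof (intro sum.cong refl)
    fix i j assume "i \<in> {..<n}" "j \<in> {..<n}"
    then have "H i j * (\<Sum>k<n. P i k * u k) * (\<Sum>k<n. P j k * u k) =
        H i j * ((\<Sum>a<n. E i a * p a) * (\<Sum>a<n. E j a * p a))"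
      by (simp only: up lessThan_iff mult.assoc)
    also have "\<dots> = (\<Sum>a<n. \<Sum>b<n. E i a * E j b * H i j * (p a * p b))"
      unfolding sum_product by (simp add: sum_distrib_left mult_ac)
    finally show "H i j * (\<Sum>k<n. P i k * u k) * (\<Sum>k<n. P j k * u k) =
      (\<Sum>a<n. \<Sum>b<n. E i a * E j b * H i j * (p a * p b))" .
  qed
  also have "\<dots> = (\<Sum>a<n. \<Sum>b<n. \<Sum>i<n. \<Sum>j<n. E i a * E j b * H i j * (p a * p b))"
    by (rule sum_swap22)
  also have "\<dots> = (\<Sum>a<n. \<Sum>b<n. T a b * (p a * p b))"
    by (simp add: T_def sum_distrib_right)
  \<comment> \<open>Pairs become single indices, so that one Cauchy-Schwarz inequality compares
    \<open>T\<close> with the rank one tensor \<open>p a * p b\<close>.\<close>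
  also have "\<dots> = (\<Sum>(a, b)\<in>{..<n}\<times>{..<n}. T a b * (p a * p b))"
    by (rule sum.cartesian_product)
  finally have "(\<Sum>i<n. \<Sum>j<n. H i j * (\<Sum>k<n. P i k * u k) * (\<Sum>k<n. P j k * u k))\<^sup>2
      = (\<Sum>x\<in>{..<n}\<times>{..<n}. T (fst x) (snd x) * (p (fst x) * p (snd x)))\<^sup>2"
    by (simp add: case_prod_beta)
  also have "\<dots> \<le> (\<Sum>x\<in>{..<n}\<times>{..<n}. (T (fst x) (snd x))\<^sup>2) * (\<Sum>x\<in>{..<n}\<times>{..<n}. (p (fst x) * p (snd x))\<^sup>2)"
    by (rule Cauchy_Schwarz_ineq_sum)
  also have "(\<Sum>x\<in>{..<n}\<times>{..<n}. (T (fst x) (snd x))\<^sup>2) = N"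
    unfolding N sum.cartesian_product by (simp add: case_prod_beta)
  also have "(\<Sum>x\<in>{..<n}\<times>{..<n}. (p (fst x) * p (snd x))\<^sup>2) = (\<Sum>a<n. (p a)\<^sup>2)\<^sup>2"
    unfolding power2_eq_square[of "\<Sum>a<n. (p a)\<^sup>2"] sum_product sum.cartesian_product
    by (simp add: case_prod_beta power_mult_distrib)
  finally have "\<bar>\<Sum>i<n. \<Sum>j<n. H i j * (\<Sum>k<n. P i k * u k) * (\<Sum>k<n. P j k * u k)\<bar>
      \<le> sqrt (N * (\<Sum>a<n. (p a)\<^sup>2)\<^sup>2)"
    by (rule abs_le_sqrtI)
  then show "\<bar>\<Sum>i<n. \<Sum>j<n. H i j * (\<Sum>k<n. P i k * u k) * (\<Sum>k<n. P j k * u k)\<bar>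
        \<le> sqrt N * (\<Sum>i<n. \<Sum>j<n. P i j * u i * u j)"
    unfolding q by (simp add: real_sqrt_mult sum_nonneg)
  have "(\<Sum>i<n. \<Sum>j<n. P i j * H i j) = (\<Sum>i<n. \<Sum>j<n. \<Sum>a<n. E i a * E j a * H i j)"
    by (intro sum.cong refl) (simp add: E sum_distrib_right)
  also have "\<dots> = (\<Sum>i<n. \<Sum>a<n. \<Sum>j<n. E i a * E j a * H i j)"
    by (intro sum.cong refl sum.swap)
  also have "\<dots> = (\<Sum>a<n. T a a)" unfolding T_def by (rule sum.swap)
  \<comment> \<open>The explicit factor 1 makes the trace a scalar product with the constant vector
    1, whose squared norm \<open>n\<close> brings the dimension into the bound.\<close>
  finally have "(\<Sum>i<n. \<Sum>j<n. P i j * H i j)\<^sup>2 = (\<Sum>a<n. 1 * T a a)\<^sup>2" by simp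
  also have "\<dots> \<le> (\<Sum>a<n. 1\<^sup>2) * (\<Sum>a<n. (T a a)\<^sup>2)" by (rule Cauchy_Schwarz_ineq_sum)
  also have "\<dots> \<le> real n * N"
  proof -
    have "(\<Sum>a<n. (T a a)\<^sup>2) \<le> N"
      unfolding N by (intro sum_mono member_le_sum) auto
    then show ?thesis by (simp add: mult_left_mono)
  qed
  finally show "\<bar>\<Sum>i<n. \<Sum>j<n. P i j * H i j\<bar> \<le> sqrt (real n) * sqrt N"
    unfolding real_sqrt_mult[symmetric] by (rule abs_le_sqrtI)
qed

end

subsection \<open>Metrics on open subsets of the model space\<close>

text \<open>\<open>m\<close> is the dimension of the domain and \<open>n\<close> the size of the
  matrix; they are kept apart so that minors of size \<open>n - 1\<close> are covered.\<close>

lemma C1_on_det: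
  assumes "\<And>i j. i < n \<Longrightarrow> j < n \<Longrightarrow> C1_on m V (\<lambda>y. A y i j)"
  shows "C1_on m V (\<lambda>y. Determinant.det (coeff_mat n (A y)))"
proof -
  have det: "Determinant.det (coeff_mat n (A y)) =
      (\<Sum>p\<in>{p. p permutes {0..<n}}. signof p * (\<Prod>i=0..<n. A y i (p i)))" for y
    unfolding det_def'[OF coeff_mat_carrier]
    by (intro sum.cong refl arg_cong2[where f="(*)"] prod.cong)
       (auto dest: permutes_in_image[where x=i for i])
  show ?thesis
    unfolding det
    by (intro C1_on_sum C1_on_cmult C1_on_prod assms) (auto dest: permutes_in_image[where x=i for i])
qed

text \<open>In this form a minor is again a \<open>coeff_mat\<close>, with the indices past the
  deleted row and column shifted by one, and \<open>C1_on_det\<close> applies.\<close>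

lemma cofactor_coeff_mat:
  "cofactor (coeff_mat n A) i j = (-1) ^ (i + j) * Determinant.det (coeff_mat (n - 1)
     (\<lambda>i' j'. A (if i' < i then i' else Suc i') (if j' < j then j' else Suc j')))"
proof -
  have "mat_delete (coeff_mat n A) i j = coeff_mat (n - 1)
     (\<lambda>i' j'. A (if i' < i then i' else Suc i') (if j' < j then j' else Suc j'))"
    unfolding mat_delete_def by (rule eq_matI) auto
  then show ?thesis by (simp add: cofactor_def)
qed

text \<open>A metric in coordinates. Its components are taken C^1: their first derivatives enter
  through the Christoffel symbols, which are never differentiated.\<close>

locale local_metric =
  fixes n :: nat and V :: "(nat \<Rightarrow> real) set" and G :: "(nat \<Rightarrow> real) \<Rightarrow> nat \<Rightarrow> nat \<Rightarrow> real"
  assumes V: "openin (Rn n) V"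
    and G_C1: "\<And>i j. i < n \<Longrightarrow> j < n \<Longrightarrow> C1_on n V (\<lambda>y. G y i j)"
    and G_pos: "\<And>y. y \<in> V \<Longrightarrow> pos_def n (G y)"
begin

abbreviation P :: "(nat \<Rightarrow> real) \<Rightarrow> nat \<Rightarrow> nat \<Rightarrow> real"
  where "P y \<equiv> inv_coeff n (G y)"

abbreviation dG :: "(nat \<Rightarrow> real) \<Rightarrow> nat \<Rightarrow> nat \<Rightarrow> nat \<Rightarrow> real"
  where "dG y l a b \<equiv> partial l (\<lambda>z. G z a b) y"

text \<open>The density of the Riemannian volume with respect to Lebesgue measure.\<close>

definition sdet :: "(nat \<Rightarrow> real) \<Rightarrow> real"
  where "sdet y = sqrt (Determinant.det (coeff_mat n (G y)))"

text \<open>The components of the gradient of \<open>u\<close>.\<close>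

definition up :: "((nat \<Rightarrow> real) \<Rightarrow> real) \<Rightarrow> (nat \<Rightarrow> real) \<Rightarrow> nat \<Rightarrow> real"
  where "up u y i = (\<Sum>j<n. P y i j * partial j u y)"

text \<open>The inner product of two gradients, computed from the differentials with the inverse
  metric.\<close>

definition gprod :: "((nat \<Rightarrow> real) \<Rightarrow> real) \<Rightarrow> ((nat \<Rightarrow> real) \<Rightarrow> real) \<Rightarrow> (nat \<Rightarrow> real) \<Rightarrow> real"
  where "gprod u w y = (\<Sum>i<n. \<Sum>j<n. P y i j * partial i u y * partial j w y)"

definition chr :: "(nat \<Rightarrow> real) \<Rightarrow> nat \<Rightarrow> nat \<Rightarrow> nat \<Rightarrow> real"
  where "chr y k i j = (\<Sum>l<n. P y k l * (dG y i j l + dG y j i l - dG y l i j)) / 2"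

definition hess :: "((nat \<Rightarrow> real) \<Rightarrow> real) \<Rightarrow> (nat \<Rightarrow> real) \<Rightarrow> nat \<Rightarrow> nat \<Rightarrow> real"
  where "hess u y i j = partial i (partial j u) y - (\<Sum>k<n. chr y k i j * partial k u y)"

definition C2 :: "((nat \<Rightarrow> real) \<Rightarrow> real) \<Rightarrow> bool"
  where "C2 u \<longleftrightarrow> C1_on n V u \<and> (\<forall>i<n. C1_on n V (partial i u))"

lemma G_sym: "y \<in> V \<Longrightarrow> i < n \<Longrightarrow> j < n \<Longrightarrow> G y i j = G y j i"
  using G_pos unfolding pos_def_def by blast

lemma det_pos: "y \<in> V \<Longrightarrow> Determinant.det (coeff_mat n (G y)) > 0"
  using pos_def_det_pos[OF G_pos] .

lemma P_pos: "y \<in> V \<Longrightarrow> pos_def n (P y)"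
  using pos_def_inv_coeff[OF G_pos] .

lemma P_sym: "y \<in> V \<Longrightarrow> i < n \<Longrightarrow> j < n \<Longrightarrow> P y i j = P y j i"
  using P_pos unfolding pos_def_def by blast

lemma dG_sym: "y \<in> V \<Longrightarrow> l < n \<Longrightarrow> i < n \<Longrightarrow> j < n \<Longrightarrow> dG y l i j = dG y l j i"
  by (rule partial_cong[OF V]) (auto intro: G_sym)

lemma P_C1:
  assumes ij: "i < n" "j < n"
  shows "C1_on n V (\<lambda>y. P y i j)"
proof (rule C1_on_cong[OF V])
  show "C1_on n V (\<lambda>y. cofactor (coeff_mat n (G y)) j i / Determinant.det (coeff_mat n (G y)))"
    unfolding cofactor_coeff_mat using det_pos
    by (intro C1_on_divide C1_on_cmult C1_on_det G_C1) (fastforce simp: less_diff_conv)+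
  show "cofactor (coeff_mat n (G z)) j i / Determinant.det (coeff_mat n (G z)) = P z i j" if "z \<in> V" for z
    using inv_coeff_cofactor[of n "G z" i j] det_pos[OF that] ij by simp
qed

text \<open>Differentiate the identity \<open>P G = 1\<close> and multiply by \<open>P\<close> on
  the right; the cofactor formula never has to be differentiated.\<close>

lemma partial_P:
  assumes y: "y \<in> V" and l: "l < n" and i: "i < n" and m: "m < n"
  shows "partial l (\<lambda>z. P z i m) y = - (\<Sum>a<n. \<Sum>b<n. P y i a * dG y l a b * P y b m)"
proof -
  have d: "Determinant.det (coeff_mat n (G z)) \<noteq> 0" if "z \<in> V" for z using det_pos[OF that] by simp
  have 0: "(\<Sum>a<n. partial l (\<lambda>z. P z i a) y * G y a b + P y i a * dG y l a b) = 0" if b: "b < n" for b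
  proof -
    have "partial l (\<lambda>z. \<Sum>a<n. P z i a * G z a b) y = partial l (\<lambda>z. if i = b then 1 else 0) y"
      by (rule partial_cong[OF V y l]) (use inv_coeff_mult[OF d i b] in auto)
    moreover have "partial l (\<lambda>z. \<Sum>a<n. P z i a * G z a b) y
        = (\<Sum>a<n. partial l (\<lambda>z. P z i a) y * G y a b + P y i a * dG y l a b)"
      by (subst partial_sum[OF _ y l])
         (auto intro!: C1_on_mult P_C1 G_C1 sum.cong partial_mult[OF _ _ y l] i b)
    ultimately show ?thesis by simp
  qed
  have "0 = (\<Sum>b<n. (\<Sum>a<n. partial l (\<lambda>z. P z i a) y * G y a b + P y i a * dG y l a b) * P y b m)"
    using 0 by simp
  also have "\<dots> = (\<Sum>b<n. \<Sum>a<n. partial l (\<lambda>z. P z i a) y * (G y a b * P y b m))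
      + (\<Sum>b<n. \<Sum>a<n. P y i a * dG y l a b * P y b m)"
    by (simp add: sum_distrib_left sum_distrib_right sum.distrib algebra_simps)
  also have "(\<Sum>b<n. \<Sum>a<n. partial l (\<lambda>z. P z i a) y * (G y a b * P y b m))
      = (\<Sum>a<n. partial l (\<lambda>z. P z i a) y * (\<Sum>b<n. G y a b * P y b m))"
    unfolding sum_distrib_left by (rule sum.swap)
  also have "\<dots> = (\<Sum>a<n. partial l (\<lambda>z. P z i a) y * (if a = m then 1 else 0))"
    using mult_inv_coeff[OF d[OF y] _ m] by (intro sum.cong) auto
  also have "\<dots> = partial l (\<lambda>z. P z i m) y" by (rule sum_delta_mult(2)[OF m])
  also have "(\<Sum>b<n. \<Sum>a<n. P y i a * dG y l a b * P y b m) = (\<Sum>a<n. \<Sum>b<n. P y i a * dG y l a b * P y b m)"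
    by (rule sum.swap)
  finally show ?thesis by simp
qed

lemma sdet_pos: "y \<in> V \<Longrightarrow> sdet y > 0"
  using det_pos by (simp add: sdet_def)

lemma sdet_C1: "C1_on n V sdet"
  unfolding sdet_def[abs_def]
proof (rule C1_on_compose[where g=sqrt and g'="\<lambda>x. inverse (sqrt x) / 2"
      and f="\<lambda>y. Determinant.det (coeff_mat n (G y))"])
  show "C1_on n V (\<lambda>y. Determinant.det (coeff_mat n (G y)))" by (intro C1_on_det G_C1)
  show "(sqrt has_real_derivative inverse (sqrt (Determinant.det (coeff_mat n (G y)))) / 2)
      (at (Determinant.det (coeff_mat n (G y))))" if "y \<in> V" for y
    using DERIV_real_sqrt[OF det_pos[OF that]] .
  show "continuous_on ((\<lambda>y. Determinant.det (coeff_mat n (G y))) ` V) (\<lambda>x. inverse (sqrt x) / 2)"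
    by (intro continuous_intros) (use det_pos in fastforce)+
qed

lemma partial_sdet:
  assumes y: "y \<in> V" and l: "l < n"
  shows "partial l sdet y = sdet y * (\<Sum>a<n. \<Sum>b<n. P y a b * dG y l a b) / 2"
proof (rule partial_eqI)
  let ?D = "Determinant.det (coeff_mat n (G y))"
  let ?t = "\<Sum>a<n. \<Sum>b<n. P y a b * dG y l a b"
  have "((\<lambda>t. Determinant.det (coeff_mat n (G (y(l := t))))) has_real_derivative
    Determinant.det (coeff_mat n (G (y(l := y l)))) * (\<Sum>i<n. \<Sum>j<n. inv_coeff n (G (y(l := y l))) i j * dG y l j i)) (at (y l))"
    by (rule DERIV_det) (use det_pos[OF y] in \<open>auto intro!: C1_on_DERIV[OF G_C1 y l]\<close>)
  moreover have "(\<Sum>i<n. \<Sum>j<n. P y i j * dG y l j i) = ?t"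
    using dG_sym[OF y l] by (intro sum.cong) auto
  ultimately have D: "((\<lambda>t. Determinant.det (coeff_mat n (G (y(l := t))))) has_real_derivative ?D * ?t) (at (y l))"
    by simp
  have "((\<lambda>t. sqrt (Determinant.det (coeff_mat n (G (y(l := t)))))) has_real_derivative
     (inverse (sqrt ?D) / 2) * (?D * ?t)) (at (y l))"
    by (rule DERIV_chain2[OF _ D]) (use DERIV_real_sqrt[OF det_pos[OF y]] in simp)
  moreover have "(inverse (sqrt ?D) / 2) * (?D * ?t) = sqrt ?D * ?t / 2"
    using det_pos[OF y] by (simp add: field_simps)
  ultimately show "((\<lambda>t. sdet (y(l := t))) has_real_derivative sdet y * ?t / 2) (at (y l))"
    by (simp only: sdet_def)
qed

lemma gprod_sym: "y \<in> V \<Longrightarrow> gprod u w y = gprod w u y"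
  unfolding gprod_def by (subst sum.swap) (intro sum.cong refl, simp add: P_sym)

lemma gprod_up: "y \<in> V \<Longrightarrow> gprod u w y = (\<Sum>i<n. up u y i * partial i w y)"
  by (subst gprod_sym) (simp_all add: gprod_def up_def sum_distrib_left sum_distrib_right mult_ac)

lemma gprod_nonneg: "y \<in> V \<Longrightarrow> gprod u u y \<ge> 0"
  unfolding gprod_def by (rule pos_def_nonneg[OF P_pos])

text \<open>Lowering the index of the gradient recovers the differential. This links
  \<open>gprod\<close> with the expression used in \<open>norm_grad\<close>.\<close>

lemma gprod_G_up:
  assumes y: "y \<in> V"
  shows "gprod u u y = (\<Sum>i<n. \<Sum>j<n. G y i j * up u y i * up u y j)"
proof -
  have "(\<Sum>j<n. G y i j * up u y j) = partial i u y" if i: "i < n" for i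
  proof -
    have "(\<Sum>j<n. G y i j * up u y j) = (\<Sum>k<n. \<Sum>j<n. G y i j * P y j k * partial k u y)"
      unfolding up_def sum_distrib_left by (subst sum.swap) (simp add: mult.assoc)
    also have "\<dots> = (\<Sum>k<n. (if i = k then 1 else 0) * partial k u y)"
      using mult_inv_coeff[of n "G y", OF _ i] det_pos[OF y]
      by (intro sum.cong refl) (simp add: sum_distrib_right[symmetric])
    also have "\<dots> = partial i u y" by (rule sum_delta_mult(1)[OF i])
    finally show ?thesis .
  qed
  then have "gprod u u y = (\<Sum>i<n. up u y i * (\<Sum>j<n. G y i j * up u y j))"
    by (simp add: gprod_up[OF y])
  then show ?thesis by (simp add: sum_distrib_left mult_ac)
qed

lemma C2_C1: "C2 u \<Longrightarrow> C1_on n V u" "C2 u \<Longrightarrow> i < n \<Longrightarrow> C1_on n V (partial i u)"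
  by (auto simp: C2_def)

lemma up_C1: "C2 u \<Longrightarrow> i < n \<Longrightarrow> C1_on n V (\<lambda>y. up u y i)"
  unfolding up_def by (intro C1_on_sum C1_on_mult P_C1 C2_C1) auto

lemma gprod_C1: "C2 u \<Longrightarrow> C2 w \<Longrightarrow> C1_on n V (gprod u w)"
  unfolding gprod_def[abs_def] by (intro C1_on_sum C1_on_mult P_C1 C2_C1) auto

lemma partial_up:
  assumes u: "C2 u" and y: "y \<in> V" and l: "l < n" and i: "i < n"
  shows "partial l (\<lambda>z. up u z i) y =
    (\<Sum>k<n. P y i k * partial l (partial k u) y) - (\<Sum>a<n. \<Sum>b<n. P y i a * dG y l a b * up u y b)"
proof -
  have "partial l (\<lambda>z. up u z i) y =
     (\<Sum>k<n. partial l (\<lambda>z. P z i k) y * partial k u y + P y i k * partial l (partial k u) y)"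
    unfolding up_def
    by (subst partial_sum[OF _ y l])
       (auto intro!: C1_on_mult P_C1 C2_C1[OF u] sum.cong partial_mult[OF _ _ y l] i)
  also have "\<dots> = (\<Sum>k<n. partial l (\<lambda>z. P z i k) y * partial k u y) + (\<Sum>k<n. P y i k * partial l (partial k u) y)"
    by (rule sum.distrib)
  also have "(\<Sum>k<n. partial l (\<lambda>z. P z i k) y * partial k u y)
      = - (\<Sum>k<n. \<Sum>a<n. \<Sum>b<n. P y i a * dG y l a b * P y b k * partial k u y)"
    by (simp add: partial_P[OF y l i] sum_distrib_right sum_negf)
  also have "(\<Sum>k<n. \<Sum>a<n. \<Sum>b<n. P y i a * dG y l a b * P y b k * partial k u y)
      = (\<Sum>a<n. \<Sum>k<n. \<Sum>b<n. P y i a * dG y l a b * P y b k * partial k u y)"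
    by (rule sum.swap)
  also have "\<dots> = (\<Sum>a<n. \<Sum>b<n. \<Sum>k<n. P y i a * dG y l a b * P y b k * partial k u y)"
    by (intro sum.cong refl sum.swap)
  also have "\<dots> = (\<Sum>a<n. \<Sum>b<n. P y i a * dG y l a b * up u y b)"
    by (simp add: up_def sum_distrib_left mult.assoc)
  finally show ?thesis by simp
qed

text \<open>The product rule, with the derivative of the inverse metric replaced through
  \<open>partial_P\<close> by minus \<open>dG\<close> on the two gradients.\<close>

lemma partial_gprod:
  assumes u: "C2 u" and w: "C2 w" and y: "y \<in> V" and l: "l < n"
  shows "partial l (gprod u w) y =
    (\<Sum>j<n. up u y j * partial l (partial j w) y) + (\<Sum>j<n. up w y j * partial l (partial j u) y)
     - (\<Sum>a<n. \<Sum>b<n. up u y a * up w y b * dG y l a b)"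
proof -
  have "partial l (gprod u w) y = partial l (\<lambda>y. \<Sum>i<n. up u y i * partial i w y) y"
    by (rule partial_cong[OF V y l]) (rule gprod_up)
  also have "\<dots> = (\<Sum>j<n. partial l (\<lambda>z. up u z j) y * partial j w y + up u y j * partial l (partial j w) y)"
    by (subst partial_sum[OF _ y l])
       (auto intro!: C1_on_mult up_C1[OF u] C2_C1[OF w] sum.cong partial_mult[OF _ _ y l])
  also have "\<dots> = (\<Sum>j<n. partial l (\<lambda>z. up u z j) y * partial j w y) + (\<Sum>j<n. up u y j * partial l (partial j w) y)"
    by (rule sum.distrib)
  also have "(\<Sum>j<n. partial l (\<lambda>z. up u z j) y * partial j w y)
     = (\<Sum>j<n. \<Sum>k<n. P y j k * partial l (partial k u) y * partial j w y)
       - (\<Sum>j<n. \<Sum>a<n. \<Sum>b<n. P y j a * dG y l a b * up u y b * partial j w y)"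
    by (simp add: partial_up[OF u y l] left_diff_distrib sum_subtractf sum_distrib_right)
  also have "(\<Sum>j<n. \<Sum>k<n. P y j k * partial l (partial k u) y * partial j w y)
     = (\<Sum>k<n. \<Sum>j<n. P y k j * partial l (partial k u) y * partial j w y)"
    by (subst sum.swap) (intro sum.cong refl, simp add: P_sym[OF y])
  also have "\<dots> = (\<Sum>k<n. up w y k * partial l (partial k u) y)"
    by (simp add: up_def sum_distrib_left sum_distrib_right mult_ac)
  also have "(\<Sum>j<n. \<Sum>a<n. \<Sum>b<n. P y j a * dG y l a b * up u y b * partial j w y)
     = (\<Sum>a<n. \<Sum>j<n. \<Sum>b<n. P y j a * dG y l a b * up u y b * partial j w y)"
    by (rule sum.swap)
  also have "\<dots> = (\<Sum>a<n. \<Sum>b<n. \<Sum>j<n. P y j a * dG y l a b * up u y b * partial j w y)"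
    by (intro sum.cong refl sum.swap)
  also have "\<dots> = (\<Sum>a<n. \<Sum>b<n. \<Sum>j<n. (P y a j * partial j w y) * up u y b * dG y l b a)"
    by (intro sum.cong refl) (simp add: P_sym[OF y] dG_sym[OF y l] mult_ac)
  also have "\<dots> = (\<Sum>a<n. \<Sum>b<n. up w y a * up u y b * dG y l b a)"
    by (simp add: up_def sum_distrib_right)
  also have "\<dots> = (\<Sum>a<n. \<Sum>b<n. up u y a * up w y b * dG y l a b)"
    by (subst sum.swap) (simp add: mult_ac)
  finally show ?thesis by simp
qed

text \<open>\<open>tri\<close> and \<open>bil\<close> are \<open>dG\<close> and the coordinate
  second derivatives as multilinear forms. The first slot of \<open>tri\<close> is the direction of
  differentiation, so symmetry holds in the last two only.\<close>

definition tri :: "(nat \<Rightarrow> real) \<Rightarrow> (nat \<Rightarrow> real) \<Rightarrow> (nat \<Rightarrow> real) \<Rightarrow> (nat \<Rightarrow> real) \<Rightarrow> real"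
  where "tri y x1 x2 x3 = (\<Sum>k<n. \<Sum>a<n. \<Sum>b<n. x1 k * x2 a * x3 b * dG y k a b)"

definition bil :: "(nat \<Rightarrow> real) \<Rightarrow> ((nat \<Rightarrow> real) \<Rightarrow> real) \<Rightarrow> (nat \<Rightarrow> real) \<Rightarrow> (nat \<Rightarrow> real) \<Rightarrow> real"
  where "bil y u x1 x2 = (\<Sum>k<n. \<Sum>j<n. x1 k * x2 j * partial k (partial j u) y)"

lemma tri_sym: "y \<in> V \<Longrightarrow> tri y x1 x2 x3 = tri y x1 x3 x2"
  unfolding tri_def
  by (rule sum.cong[OF refl], subst sum.swap, intro sum.cong refl) (simp add: dG_sym mult_ac)

lemma bil_sym: "C2 u \<Longrightarrow> y \<in> V \<Longrightarrow> bil y u x1 x2 = bil y u x2 x1"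
  unfolding bil_def
  by (subst sum.swap, intro sum.cong refl) (simp add: partial_commute[OF V C2_C1(1) C2_C1(2) C2_C1(2)] mult_ac)

lemma gprod_gprod:
  assumes u: "C2 u" and w: "C2 w" and y: "y \<in> V"
  shows "gprod f (gprod u w) y = bil y w (up f y) (up u y) + bil y u (up f y) (up w y) - tri y (up f y) (up u y) (up w y)"
  unfolding gprod_up[OF y] bil_def tri_def
  by (simp add: partial_gprod[OF u w y] distrib_left right_diff_distrib sum.distrib sum_subtractf
      sum_distrib_left mult.assoc)

text \<open>The inverse metric inside the Christoffel symbol is used up in raising the index of the
  differential, so only \<open>dG\<close> and the gradient of \<open>u\<close> remain.\<close>

lemma chr_contract:
  assumes "y \<in> V"
  shows "(\<Sum>k<n. chr y k i j * partial k u y) =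
    (\<Sum>l<n. up u y l * (dG y i j l + dG y j i l - dG y l i j)) / 2"
proof -
  have "(\<Sum>k<n. chr y k i j * partial k u y) =
     (\<Sum>k<n. \<Sum>l<n. (dG y i j l + dG y j i l - dG y l i j) * (P y k l * partial k u y)) / 2"
    unfolding chr_def sum_divide_distrib by (simp add: sum_divide_distrib sum_distrib_left sum_distrib_right mult_ac)
  also have "(\<Sum>k<n. \<Sum>l<n. (dG y i j l + dG y j i l - dG y l i j) * (P y k l * partial k u y))
     = (\<Sum>l<n. \<Sum>k<n. (dG y i j l + dG y j i l - dG y l i j) * (P y l k * partial k u y))"
    by (subst sum.swap) (intro sum.cong refl, simp add: P_sym[OF assms])
  finally show ?thesis by (simp add: up_def sum_distrib_left sum_distrib_right mult_ac)
qed

lemma hess_alt: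
  assumes "y \<in> V"
  shows "hess u y i j = partial i (partial j u) y - (\<Sum>l<n. up u y l * dG y i j l) / 2
    - (\<Sum>l<n. up u y l * dG y j i l) / 2 + (\<Sum>l<n. up u y l * dG y l i j) / 2"
  by (simp add: hess_def chr_contract[OF assms] distrib_left right_diff_distrib sum.distrib sum_subtractf
      add_divide_distrib diff_divide_distrib)

text \<open>A Koszul-type identity. When the right side is expanded by \<open>gprod_gprod\<close>,
  the second derivatives of \<open>f\<close> and \<open>h\<close> cancel by symmetry and the
  \<open>tri\<close> terms assemble to the Christoffel part. As only gradient products occur on the
  right, it carries the Hessian through changes of coordinates.\<close>

lemma hess_up:
  assumes y: "y \<in> V" and f: "C2 f" and h: "C2 h" and u: "C2 u"
  shows "2 * (\<Sum>i<n. \<Sum>j<n. hess u y i j * up f y i * up h y j) =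
    gprod f (gprod u h) y + gprod h (gprod u f) y - gprod u (gprod f h) y"
proof -
  define F H U where "F = up f y" and "H = up h y" and "U = up u y"
  have "hess u y i j * F i * H j = F i * H j * partial i (partial j u) y
      - (\<Sum>l<n. F i * H j * U l * dG y i j l) / 2 - (\<Sum>l<n. F i * H j * U l * dG y j i l) / 2
      + (\<Sum>l<n. F i * H j * U l * dG y l i j) / 2" for i j
    by (simp add: hess_alt[OF y] U_def sum_distrib_left[symmetric] mult.assoc algebra_simps)
  then have "2 * (\<Sum>i<n. \<Sum>j<n. hess u y i j * F i * H j) =
    2 * bil y u F H - (\<Sum>i<n. \<Sum>j<n. \<Sum>l<n. F i * H j * U l * dG y i j l)
      - (\<Sum>i<n. \<Sum>j<n. \<Sum>l<n. F i * H j * U l * dG y j i l)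
      + (\<Sum>i<n. \<Sum>j<n. \<Sum>l<n. F i * H j * U l * dG y l i j)"
    by (simp add: bil_def sum.distrib sum_subtractf sum_divide_distrib[symmetric])
  also have "(\<Sum>i<n. \<Sum>j<n. \<Sum>l<n. F i * H j * U l * dG y i j l) = tri y F H U"
    by (simp add: tri_def)
  also have "(\<Sum>i<n. \<Sum>j<n. \<Sum>l<n. F i * H j * U l * dG y j i l) = tri y H F U"
    unfolding tri_def by (subst sum.swap) (simp add: mult_ac)
  also have "(\<Sum>i<n. \<Sum>j<n. \<Sum>l<n. F i * H j * U l * dG y l i j) = (\<Sum>i<n. \<Sum>l<n. \<Sum>j<n. F i * H j * U l * dG y l i j)"
    by (intro sum.cong refl sum.swap)
  also have "\<dots> = tri y U F H"
    unfolding tri_def by (subst sum.swap) (simp add: mult_ac)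
  finally have "2 * (\<Sum>i<n. \<Sum>j<n. hess u y i j * F i * H j) =
    2 * bil y u F H - tri y F H U - tri y H F U + tri y U F H" .
  then show ?thesis
    using gprod_gprod[OF u h y, of f] gprod_gprod[OF u f y, of h] gprod_gprod[OF f h y, of u]
      tri_sym[OF y, of F H U] tri_sym[OF y, of H F U] bil_sym[OF u y, of F H]
      bil_sym[OF h y, of F U] bil_sym[OF f y, of H U]
    unfolding F_def H_def U_def by linarith
qed

text \<open>The left side is the divergence of the gradient, its second sum being the logarithmic
  derivative of \<open>sdet\<close>; the right side is the trace of the Hessian. Two Christoffel
  terms agree by symmetry of \<open>P\<close> and match the derivative of the inverse metric, the
  third matches the density term.\<close>

lemma divergence_up:
  assumes y: "y \<in> V" and u: "C2 u"
  shows "(\<Sum>i<n. partial i (\<lambda>z. up u z i) y) + (\<Sum>i<n. up u y i * (\<Sum>a<n. \<Sum>b<n. P y a b * dG y i a b)) / 2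
    = (\<Sum>i<n. \<Sum>j<n. P y i j * hess u y i j)"
proof -
  let ?U = "up u y"
  have "P y i j * hess u y i j = P y i j * partial i (partial j u) y
      - (\<Sum>l<n. P y i j * dG y i j l * ?U l) / 2 - (\<Sum>l<n. P y i j * dG y j i l * ?U l) / 2
      + (\<Sum>l<n. ?U l * (P y i j * dG y l i j)) / 2" for i j
  proof -
    have "(\<Sum>l<n. ?U l * (P y i j * dG y l i j)) = P y i j * (\<Sum>l<n. ?U l * dG y l i j)"
      by (simp add: sum_distrib_left mult_ac)
    moreover have "(\<Sum>l<n. P y i j * dG y a b l * ?U l) = P y i j * (\<Sum>l<n. ?U l * dG y a b l)" for a b
      by (simp add: sum_distrib_left mult_ac)
    ultimately show ?thesis by (simp add: hess_alt[OF y] algebra_simps)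
  qed
  then have "(\<Sum>i<n. \<Sum>j<n. P y i j * hess u y i j) =
    (\<Sum>i<n. \<Sum>j<n. P y i j * partial i (partial j u) y)
    - (\<Sum>i<n. \<Sum>j<n. \<Sum>l<n. P y i j * dG y i j l * ?U l) / 2
    - (\<Sum>i<n. \<Sum>j<n. \<Sum>l<n. P y i j * dG y j i l * ?U l) / 2
    + (\<Sum>i<n. \<Sum>j<n. \<Sum>l<n. ?U l * (P y i j * dG y l i j)) / 2"
    by (simp add: sum.distrib sum_subtractf sum_divide_distrib[symmetric])
  also have "(\<Sum>i<n. \<Sum>j<n. \<Sum>l<n. P y i j * dG y j i l * ?U l) = (\<Sum>i<n. \<Sum>j<n. \<Sum>l<n. P y i j * dG y i j l * ?U l)"
    by (subst sum.swap) (intro sum.cong refl, simp add: P_sym[OF y])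
  also have "(\<Sum>i<n. \<Sum>j<n. \<Sum>l<n. ?U l * (P y i j * dG y l i j))
     = (\<Sum>i<n. \<Sum>l<n. \<Sum>j<n. ?U l * (P y i j * dG y l i j))"
    by (intro sum.cong refl sum.swap)
  also have "\<dots> = (\<Sum>l<n. \<Sum>i<n. \<Sum>j<n. ?U l * (P y i j * dG y l i j))"
    by (rule sum.swap)
  finally show ?thesis
    by (simp add: partial_up[OF u y] sum_subtractf sum_distrib_left sum_negf)
qed

text \<open>The pointwise form of Green's formula: the left side is a coordinate divergence, which
  integrates to 0 for compact support, and \<open>sdet\<close> is the volume density.\<close>

lemma divergence_form:
  assumes y: "y \<in> V" and u: "C2 u" and v: "C1_on n V v"
  shows "(\<Sum>i<n. partial i (\<lambda>z. v z * (sdet z * up u z i)) y) =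
    sdet y * (gprod v u y + v y * (\<Sum>i<n. \<Sum>j<n. P y i j * hess u y i j))"
proof -
  have "partial i (\<lambda>z. v z * (sdet z * up u z i)) y = sdet y * (up u y i * partial i v y) +
     sdet y * v y * (partial i (\<lambda>z. up u z i) y + up u y i * (\<Sum>a<n. \<Sum>b<n. P y a b * dG y i a b) / 2)"
    if i: "i < n" for i
    by (subst partial_mult[OF v C1_on_mult[OF sdet_C1 up_C1[OF u i]] y i],
        subst partial_mult[OF sdet_C1 up_C1[OF u i] y i])
       (simp add: partial_sdet[OF y i] algebra_simps)
  then have "(\<Sum>i<n. partial i (\<lambda>z. v z * (sdet z * up u z i)) y) =
    sdet y * (\<Sum>i<n. up u y i * partial i v y) +
    sdet y * v y * ((\<Sum>i<n. partial i (\<lambda>z. up u z i) y)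
      + (\<Sum>i<n. up u y i * (\<Sum>a<n. \<Sum>b<n. P y a b * dG y i a b)) / 2)"
    by (simp add: sum.distrib sum_distrib_left sum_divide_distrib distrib_left)
  moreover have "(\<Sum>i<n. up u y i * partial i v y) = gprod v u y"
    using gprod_up[OF y] gprod_sym[OF y] by metis
  ultimately show ?thesis
    by (simp only: divergence_up[OF y u] distrib_left mult.assoc)
qed

end

text \<open>Contract \<open>j\<close> and \<open>l\<close> with \<open>i\<close> and
  \<open>k\<close> fixed, then \<open>i\<close> and \<open>k\<close>; each is one use of
  \<open>inv_coeff_contract\<close>.\<close>

lemma tensor_norm_transform:
  assumes G: "pos_def n G" and H: "pos_def n H"
    and GH: "\<And>k l. k < n \<Longrightarrow> l < n \<Longrightarrow> G k l = (\<Sum>i<n. \<Sum>j<n. H i j * K i k * K j l)"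
    and AB: "\<And>k l. k < n \<Longrightarrow> l < n \<Longrightarrow> A k l = (\<Sum>i<n. \<Sum>j<n. K i k * K j l * B i j)"
  shows "(\<Sum>i<n. \<Sum>j<n. \<Sum>k<n. \<Sum>l<n. inv_coeff n G i k * inv_coeff n G j l * A i j * A k l)
    = (\<Sum>i<n. \<Sum>j<n. \<Sum>k<n. \<Sum>l<n. inv_coeff n H i k * inv_coeff n H j l * B i j * B k l)"
proof -
  let ?P = "inv_coeff n G" and ?Q = "inv_coeff n H"
  note contract = inv_coeff_contract[OF H G GH]
  have "(\<Sum>i<n. \<Sum>j<n. \<Sum>k<n. \<Sum>l<n. ?P i k * ?P j l * A i j * A k l)
    = (\<Sum>i<n. \<Sum>k<n. ?P i k * (\<Sum>j<n. \<Sum>l<n. ?P j l * (A i j * A k l)))"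
    by (rule sum.cong[OF refl], subst sum.swap) (simp add: sum_distrib_left mult_ac)
  also have "\<dots> = (\<Sum>i<n. \<Sum>k<n. ?P i k * (\<Sum>b<n. \<Sum>d<n. ?Q b d * ((\<Sum>a<n. K a i * B a b) * (\<Sum>c<n. K c k * B c d))))"
  proof -
    have A: "A i j = (\<Sum>b<n. K b j * (\<Sum>a<n. K a i * B a b))" if "i < n" "j < n" for i j
      unfolding AB[OF that] sum_distrib_left by (subst sum.swap) (simp add: mult_ac)
    have AA: "A i j * A k l = (\<Sum>b<n. \<Sum>d<n. K b j * K d l * ((\<Sum>a<n. K a i * B a b) * (\<Sum>c<n. K c k * B c d)))"
      if "i < n" "j < n" "k < n" "l < n" for i j k l
    proof -
      have "A i j * A k l = (\<Sum>b<n. K b j * (\<Sum>a<n. K a i * B a b)) * (\<Sum>d<n. K d l * (\<Sum>c<n. K c k * B c d))"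
        using that A by simp
      then show ?thesis
        unfolding sum_product[of "\<lambda>b. K b j * (\<Sum>a<n. K a i * B a b)"] by (simp only: mult_ac)
    qed
    have "(\<Sum>j<n. \<Sum>l<n. ?P j l * (A i j * A k l)) =
        (\<Sum>b<n. \<Sum>d<n. ?Q b d * ((\<Sum>a<n. K a i * B a b) * (\<Sum>c<n. K c k * B c d)))"
      if "i < n" "k < n" for i k
    proof -
      have "(\<Sum>j<n. \<Sum>l<n. ?P j l * (A i j * A k l)) = (\<Sum>j<n. \<Sum>l<n. ?P j l *
          (\<Sum>b<n. \<Sum>d<n. K b j * K d l * ((\<Sum>a<n. K a i * B a b) * (\<Sum>c<n. K c k * B c d))))"
        by (intro sum.cong refl) (simp only: AA that lessThan_iff)
      then show ?thesis by (simp only: contract)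
    qed
    then show ?thesis by (intro sum.cong refl) (simp only: lessThan_iff)
  qed
  also have "\<dots> = (\<Sum>i<n. \<Sum>k<n. \<Sum>b<n. \<Sum>d<n. ?P i k * (?Q b d * ((\<Sum>a<n. K a i * B a b) * (\<Sum>c<n. K c k * B c d))))"
    by (simp only: sum_distrib_left)
  also have "\<dots> = (\<Sum>b<n. \<Sum>d<n. \<Sum>i<n. \<Sum>k<n. ?P i k * (?Q b d * ((\<Sum>a<n. K a i * B a b) * (\<Sum>c<n. K c k * B c d))))"
    by (rule sum_swap22)
  also have "\<dots> = (\<Sum>b<n. \<Sum>d<n. ?Q b d * (\<Sum>i<n. \<Sum>k<n. ?P i k * (\<Sum>a<n. \<Sum>c<n. K a i * K c k * (B a b * B c d))))"
    unfolding sum_product by (simp add: sum_distrib_left mult_ac)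
  also have "\<dots> = (\<Sum>b<n. \<Sum>d<n. ?Q b d * (\<Sum>a<n. \<Sum>c<n. ?Q a c * (B a b * B c d)))"
    by (simp only: contract)
  also have "\<dots> = (\<Sum>b<n. \<Sum>d<n. \<Sum>a<n. \<Sum>c<n. ?Q a c * ?Q b d * B a b * B c d)"
    by (simp add: sum_distrib_left mult_ac)
  also have "\<dots> = (\<Sum>a<n. \<Sum>c<n. \<Sum>b<n. \<Sum>d<n. ?Q a c * ?Q b d * B a b * B c d)"
    by (rule sum_swap22)
  also have "\<dots> = (\<Sum>a<n. \<Sum>b<n. \<Sum>c<n. \<Sum>d<n. ?Q a c * ?Q b d * B a b * B c d)"
    by (intro sum.cong refl sum.swap)
  finally show ?thesis .
qed

section \<open>Invariance of gradient and Hessian under local isometries\<close>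

context local_metric
begin

lemma local_metric_subset:
  assumes "openin (Rn n) W" "W \<subseteq> V"
  shows "local_metric n W G"
  by unfold_locales (use assms G_C1 G_pos in \<open>auto intro: C1_on_subset\<close>)

lemma C2_subset: "C2 u \<Longrightarrow> W \<subseteq> V \<Longrightarrow> local_metric.C2 n W u" if "openin (Rn n) W"
  using local_metric_subset[OF that] by (auto simp: C2_def local_metric.C2_def intro: C1_on_subset)

lemma gprod_cong: "y \<in> V \<Longrightarrow> (\<And>z. z \<in> V \<Longrightarrow> u z = w z) \<Longrightarrow> gprod f u y = gprod f w y"
  unfolding gprod_def by (intro sum.cong refl arg_cong2[where f="(*)"] partial_cong[OF V]) auto

lemma hess_cong:
  assumes "y \<in> V" "i < n" "j < n" "\<And>z. z \<in> V \<Longrightarrow> u z = w z"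
  shows "hess u y i j = hess w y i j"
proof -
  have "partial i (partial j u) y = partial i (partial j w) y"
    by (intro partial_cong[OF V] assms)
  moreover have "partial k u y = partial k w y" if "k < n" for k
    by (rule partial_cong[OF V]) (use assms that in auto)
  ultimately show ?thesis by (simp add: hess_def)
qed

lemma hess_continuous:
  assumes u: "C2 u" and ij: "i < n" "j < n"
  shows "continuous_on V (\<lambda>y. hess u y i j)"
proof -
  have c: "continuous_on V (partial i (partial j u))" "\<And>k. k < n \<Longrightarrow> continuous_on V (partial k u)"
    "\<And>k l. k < n \<Longrightarrow> l < n \<Longrightarrow> continuous_on V (\<lambda>y. P y k l)"
    using u C2_C1[OF u] ij P_C1 by (auto intro: C1_on_continuous C1_on_continuous_partial)
  have d: "continuous_on V (\<lambda>y. dG y l a b)" if "l < n" "a < n" "b < n" for a b l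
    by (rule C1_on_continuous_partial[OF G_C1[OF that(2,3)] that(1)])
  show ?thesis
    unfolding hess_def chr_def by (intro continuous_intros c d ij) auto
qed

text \<open>A function linear in the coordinates has constant partials, so every covector at
  \<open>x\<close> is a differential. Taking \<open>\<xi>\<close> with its index lowered makes the
  gradient \<open>\<xi>\<close>.\<close>

lemma exists_C2_up:
  assumes x: "x \<in> V"
  obtains f where "C2 f" "\<And>i. i < n \<Longrightarrow> up f x i = \<xi> i"
proof -
  define \<alpha> where "\<alpha> = (\<lambda>j. \<Sum>m<n. G x j m * \<xi> m)"
  define f where "f = (\<lambda>y::nat \<Rightarrow> real. \<Sum>j<n. \<alpha> j * y j)"
  have pf: "partial i f y = \<alpha> i" if "i < n" for i y
  proof (rule partial_eqI)
    have "((\<lambda>t. \<Sum>j<n. \<alpha> j * (y(i := t)) j) has_real_derivative (\<Sum>j<n. \<alpha> j * (if j = i then 1 else 0))) (at (y i))"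
    proof (rule DERIV_sum)
      fix j show "((\<lambda>t. \<alpha> j * (y(i := t)) j) has_real_derivative \<alpha> j * (if j = i then 1 else 0)) (at (y i))"
        by (cases "j = i") (auto intro!: derivative_eq_intros)
    qed
    then show "((\<lambda>t. f (y(i := t))) has_real_derivative \<alpha> i) (at (y i))"
      using sum_delta_mult(2)[OF that, of \<alpha>] unfolding f_def by simp
  qed
  have "C1_on n V f" unfolding f_def by (intro C1_on_sum C1_on_cmult C1_on_coord)
  moreover have "C1_on n V (partial i f)" if "i < n" for i
  proof -
    have "partial i f = (\<lambda>_. \<alpha> i)" using pf[OF that] by auto
    then show ?thesis by (simp add: C1_on_const)
  qed
  ultimately have "C2 f" by (simp add: C2_def)
  moreover have "up f x i = \<xi> i" if i: "i < n" for i
  proof -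
    have "up f x i = (\<Sum>m<n. \<Sum>j<n. P x i j * G x j m * \<xi> m)"
      unfolding up_def using pf by (subst sum.swap) (simp add: \<alpha>_def sum_distrib_left mult.assoc)
    also have "\<dots> = (\<Sum>m<n. (if i = m then 1 else 0) * \<xi> m)"
      using inv_coeff_mult[of n "G x", OF _ i] det_pos[OF x]
      by (intro sum.cong refl) (simp add: sum_distrib_right[symmetric])
    finally show ?thesis using sum_delta_mult(1)[OF i] by simp
  qed
  ultimately show ?thesis using that by blast
qed

end

text \<open>Modelled on a coordinate transition, with \<open>H\<close> the pullback of
  \<open>G\<close>. No inverse of \<open>\<phi>\<close> is mentioned: positive definiteness of
  \<open>H\<close> already makes its Jacobian invertible.\<close>

locale local_isometry =
  A: local_metric n W G + B: local_metric n W' H for n W G W' H +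
  fixes \<phi> :: "(nat \<Rightarrow> real) \<Rightarrow> nat \<Rightarrow> real"
  assumes maps: "\<And>y. y \<in> W' \<Longrightarrow> \<phi> y \<in> W"
    and C2_\<phi>: "\<And>k. k < n \<Longrightarrow> B.C2 (\<lambda>y. \<phi> y k)"
    and H_eq: "\<And>y i j. y \<in> W' \<Longrightarrow> i < n \<Longrightarrow> j < n \<Longrightarrow> H y i j =
      (\<Sum>k<n. \<Sum>l<n. G (\<phi> y) k l * partial i (\<lambda>z. \<phi> z k) y * partial j (\<lambda>z. \<phi> z l) y)"
begin

abbreviation J :: "(nat \<Rightarrow> real) \<Rightarrow> nat \<Rightarrow> nat \<Rightarrow> real"
  where "J y k i \<equiv> partial i (\<lambda>z. \<phi> z k) y"

lemma partial_pullback: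
  assumes "C1_on n W F" "y \<in> W'" "i < n"
  shows "partial i (\<lambda>y. F (\<phi> y)) y = (\<Sum>k<n. partial k F (\<phi> y) * J y k i)"
  using assms by (intro partial_chain[OF A.V B.V _ maps B.C2_C1(1)[OF C2_\<phi>]])

lemma C1_pullback: "C1_on n W F \<Longrightarrow> C1_on n W' (\<lambda>y. F (\<phi> y))"
  by (intro C1_on_chain[OF A.V B.V _ maps B.C2_C1(1)[OF C2_\<phi>]])

lemma C2_pullback:
  assumes F: "A.C2 F"
  shows "B.C2 (\<lambda>y. F (\<phi> y))"
  unfolding B.C2_def
proof (intro conjI allI impI)
  show "C1_on n W' (\<lambda>y. F (\<phi> y))" by (rule C1_pullback[OF A.C2_C1(1)[OF F]])
  fix i assume i: "i < n"
  have "C1_on n W' (\<lambda>y. \<Sum>k<n. partial k F (\<phi> y) * J y k i)"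
    by (intro C1_on_sum C1_on_mult C1_pullback A.C2_C1(2)[OF F] B.C2_C1(2)[OF C2_\<phi>]) (use i in auto)
  then show "C1_on n W' (partial i (\<lambda>y. F (\<phi> y)))"
    by (rule C1_on_cong[OF B.V, rotated]) (simp add: partial_pullback[OF A.C2_C1(1)[OF F] _ i])
qed

text \<open>Comes from \<open>inv_coeff_transform\<close> after the chain rule: differentials pull
  back, while the Jacobian pushes gradients forward.\<close>

lemma up_pullback:
  assumes F: "C1_on n W F" and y: "y \<in> W'" and k: "k < n"
  shows "A.up F (\<phi> y) k = (\<Sum>i<n. J y k i * B.up (\<lambda>y. F (\<phi> y)) y i)"
proof -
  have "(\<Sum>i<n. J y k i * B.up (\<lambda>y. F (\<phi> y)) y i)
     = (\<Sum>i<n. \<Sum>j<n. \<Sum>l<n. J y k i * B.P y i j * J y l j * partial l F (\<phi> y))"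
    by (simp add: B.up_def partial_pullback[OF F y] sum_distrib_left mult_ac)
  also have "\<dots> = (\<Sum>i<n. \<Sum>l<n. \<Sum>j<n. J y k i * B.P y i j * J y l j * partial l F (\<phi> y))"
    by (intro sum.cong refl sum.swap)
  also have "\<dots> = (\<Sum>l<n. \<Sum>i<n. \<Sum>j<n. J y k i * B.P y i j * J y l j * partial l F (\<phi> y))"
    by (rule sum.swap)
  also have "\<dots> = (\<Sum>l<n. (\<Sum>i<n. \<Sum>j<n. B.P y i j * (J y k i * J y l j)) * partial l F (\<phi> y))"
    by (simp add: sum_distrib_left sum_distrib_right mult_ac)
  also have "\<dots> = (\<Sum>l<n. A.P (\<phi> y) k l * partial l F (\<phi> y))"
    by (intro sum.cong refl arg_cong2[where f="(*)"]
        inv_coeff_transform[OF A.G_pos[OF maps[OF y]] B.G_pos[OF y] H_eq[OF y] k]) auto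
  finally show ?thesis by (simp add: A.up_def)
qed

lemma gprod_pullback:
  assumes F: "C1_on n W F" and F': "C1_on n W F'" and y: "y \<in> W'"
  shows "B.gprod (\<lambda>y. F (\<phi> y)) (\<lambda>y. F' (\<phi> y)) y = A.gprod F F' (\<phi> y)"
proof -
  have "A.gprod F F' (\<phi> y) = (\<Sum>k<n. \<Sum>i<n. J y k i * B.up (\<lambda>y. F (\<phi> y)) y i * partial k F' (\<phi> y))"
    unfolding A.gprod_up[OF maps[OF y]] by (simp add: up_pullback[OF F y] sum_distrib_right)
  also have "\<dots> = (\<Sum>i<n. \<Sum>k<n. J y k i * B.up (\<lambda>y. F (\<phi> y)) y i * partial k F' (\<phi> y))"
    by (rule sum.swap)
  also have "\<dots> = B.gprod (\<lambda>y. F (\<phi> y)) (\<lambda>y. F' (\<phi> y)) y"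
    unfolding B.gprod_up[OF y] by (simp add: partial_pullback[OF F' y] sum_distrib_left mult_ac)
  finally show ?thesis by simp
qed

text \<open>Test functions that are linear in the coordinates of \<open>W\<close> realise every gradient vector, so
  the coordinate-free formula for the Hessian determines its components.\<close>

lemma hess_pullback:
  assumes u: "A.C2 u" and y: "y \<in> W'"
  obtains K where
    "\<And>k l. k < n \<Longrightarrow> l < n \<Longrightarrow> G (\<phi> y) k l = (\<Sum>i<n. \<Sum>j<n. H y i j * K i k * K j l)"
    "\<And>k l. k < n \<Longrightarrow> l < n \<Longrightarrow> A.hess u (\<phi> y) k l =
      (\<Sum>i<n. \<Sum>j<n. K i k * K j l * B.hess (\<lambda>y. u (\<phi> y)) y i j)"
proof -
  let ?x = "\<phi> y"
  have x: "?x \<in> W" by (rule maps[OF y])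
  have "\<exists>f. A.C2 f \<and> (\<forall>i<n. A.up f ?x i = (if i = k then 1 else 0))" for k
    using A.exists_C2_up[OF x, of "\<lambda>i. if i = k then 1 else 0"] by metis
  then obtain f where f: "\<And>k. A.C2 (f k)" "\<And>i k. i < n \<Longrightarrow> A.up (f k) ?x i = (if i = k then 1 else 0)"
    by metis
  \<comment> \<open>Column \<open>k\<close> is the gradient, on the source side, of a function whose
    gradient on the target side is the \<open>k\<close>-th basis vector; hence \<open>K\<close>
    inverts the Jacobian.\<close>
  define K where "K = (\<lambda>i k. B.up (\<lambda>y. f k (\<phi> y)) y i)"
  have JK: "(\<Sum>i<n. J y a i * K i k) = (if a = k then 1 else 0)" if "a < n" for a k
    unfolding K_def using up_pullback[OF A.C2_C1(1)[OF f(1)] y that] f(2)[OF that] by simp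
  have "G ?x k l = (\<Sum>i<n. \<Sum>j<n. H y i j * K i k * K j l)" if kl: "k < n" "l < n" for k l
  proof -
    have "(\<Sum>i<n. \<Sum>j<n. H y i j * K i k * K j l)
      = (\<Sum>i<n. \<Sum>j<n. \<Sum>a<n. \<Sum>b<n. G ?x a b * (J y a i * K i k) * (J y b j * K j l))"
      by (intro sum.cong refl) (simp add: H_eq[OF y] sum_distrib_left sum_distrib_right mult_ac)
    also have "\<dots> = (\<Sum>a<n. \<Sum>b<n. \<Sum>i<n. \<Sum>j<n. G ?x a b * (J y a i * K i k) * (J y b j * K j l))"
      by (rule sum_swap22)
    also have "\<dots> = (\<Sum>a<n. \<Sum>b<n. G ?x a b * ((\<Sum>i<n. J y a i * K i k) * (\<Sum>j<n. J y b j * K j l)))"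
      unfolding sum_product by (simp add: sum_distrib_left mult.assoc)
    also have "\<dots> = (\<Sum>a<n. \<Sum>b<n. G ?x a b * ((if a = k then 1 else 0) * (if b = l then 1 else 0)))"
      by (intro sum.cong refl) (simp only: JK lessThan_iff)
    also have "\<dots> = (\<Sum>a<n. (\<Sum>b<n. G ?x a b * (if b = l then 1 else 0)) * (if a = k then 1 else 0))"
      by (simp only: sum_distrib_left sum_distrib_right mult_ac)
    also have "\<dots> = G ?x k l"
      by (simp only: sum_delta_mult(2)[OF kl(2)] sum_delta_mult(2)[OF kl(1)])
    finally show ?thesis by simp
  qed
  moreover have "A.hess u ?x k l = (\<Sum>i<n. \<Sum>j<n. K i k * K j l * B.hess (\<lambda>y. u (\<phi> y)) y i j)"
    if kl: "k < n" "l < n" for k l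
  proof -
    let ?p = "\<lambda>F y. F (\<phi> y)"
    have gg: "B.gprod (?p F) (B.gprod (?p F') (?p F'')) y = A.gprod F (A.gprod F' F'') ?x"
      if F: "A.C2 F" "A.C2 F'" "A.C2 F''" for F F' F''
    proof -
      have "B.gprod (?p F) (B.gprod (?p F') (?p F'')) y = B.gprod (?p F) (?p (A.gprod F' F'')) y"
        by (rule B.gprod_cong[OF y]) (rule gprod_pullback[OF A.C2_C1(1)[OF F(2)] A.C2_C1(1)[OF F(3)]])
      also have "\<dots> = A.gprod F (A.gprod F' F'') ?x"
        by (rule gprod_pullback[OF A.C2_C1(1)[OF F(1)] A.gprod_C1[OF F(2,3)] y])
      finally show ?thesis .
    qed
    have "(\<Sum>i<n. \<Sum>j<n. A.hess u ?x i j * A.up (f k) ?x i * A.up (f l) ?x j)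
      = (\<Sum>j<n. (\<Sum>i<n. A.hess u ?x i j * (if i = k then 1 else 0)) * (if j = l then 1 else 0))"
      by (subst sum.swap) (simp add: f(2) sum_distrib_left sum_distrib_right mult_ac)
    also have "\<dots> = A.hess u ?x k l"
      by (simp only: sum_delta_mult(2)[OF kl(2)] sum_delta_mult(2)[OF kl(1)])
    finally have "2 * A.hess u ?x k l = 2 * (\<Sum>i<n. \<Sum>j<n. A.hess u ?x i j * A.up (f k) ?x i * A.up (f l) ?x j)"
      by simp
    also have "\<dots> = 2 * (\<Sum>i<n. \<Sum>j<n. B.hess (?p u) y i j * B.up (?p (f k)) y i * B.up (?p (f l)) y j)"
      unfolding A.hess_up[OF x f(1) f(1) u] B.hess_up[OF y C2_pullback[OF f(1)] C2_pullback[OF f(1)] C2_pullback[OF u]]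
      by (simp only: gg[OF f(1) u f(1)] gg[OF u f(1) f(1)])
    finally show ?thesis by (simp add: K_def mult_ac)
  qed
  ultimately show ?thesis using that[of K] by blast
qed

lemma trace_hess_pullback:
  assumes "A.C2 u" "y \<in> W'"
  shows "(\<Sum>i<n. \<Sum>j<n. B.P y i j * B.hess (\<lambda>y. u (\<phi> y)) y i j) =
    (\<Sum>i<n. \<Sum>j<n. A.P (\<phi> y) i j * A.hess u (\<phi> y) i j)"
proof -
  obtain K where K: "\<And>k l. k < n \<Longrightarrow> l < n \<Longrightarrow> G (\<phi> y) k l = (\<Sum>i<n. \<Sum>j<n. H y i j * K i k * K j l)"
    "\<And>k l. k < n \<Longrightarrow> l < n \<Longrightarrow> A.hess u (\<phi> y) k l =
      (\<Sum>i<n. \<Sum>j<n. K i k * K j l * B.hess (\<lambda>y. u (\<phi> y)) y i j)"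
    using hess_pullback[OF assms] by blast
  then show ?thesis
    using inv_coeff_contract[OF B.G_pos[OF assms(2)] A.G_pos[OF maps[OF assms(2)]] K(1)] by simp
qed

lemma norm_hess_pullback:
  assumes "A.C2 u" "y \<in> W'"
  shows "(\<Sum>i<n. \<Sum>j<n. \<Sum>k<n. \<Sum>l<n. B.P y i k * B.P y j l *
      B.hess (\<lambda>y. u (\<phi> y)) y i j * B.hess (\<lambda>y. u (\<phi> y)) y k l) =
    (\<Sum>i<n. \<Sum>j<n. \<Sum>k<n. \<Sum>l<n. A.P (\<phi> y) i k * A.P (\<phi> y) j l *
      A.hess u (\<phi> y) i j * A.hess u (\<phi> y) k l)"
proof -
  obtain K where K: "\<And>k l. k < n \<Longrightarrow> l < n \<Longrightarrow> G (\<phi> y) k l = (\<Sum>i<n. \<Sum>j<n. H y i j * K i k * K j l)"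
    "\<And>k l. k < n \<Longrightarrow> l < n \<Longrightarrow> A.hess u (\<phi> y) k l =
      (\<Sum>i<n. \<Sum>j<n. K i k * K j l * B.hess (\<lambda>y. u (\<phi> y)) y i j)"
    using hess_pullback[OF assms] by blast
  show ?thesis
    by (rule tensor_norm_transform[OF A.G_pos[OF maps[OF assms(2)]] B.G_pos[OF assms(2)] K, symmetric])
qed

end

subsection \<open>Chart-independent quantities on a Riemannian manifold\<close>

locale riemannian =
  fixes M :: "'a riem"
  assumes riemannian: "riemannian_manifold M"
begin

abbreviation n :: nat where "n \<equiv> mdim M"
abbreviation X :: "'a topology" where "X \<equiv> mtop M"
abbreviation V :: "'a chart \<Rightarrow> (nat \<Rightarrow> real) set" where "V c \<equiv> cmap c ` cdom c"
abbreviation pull :: "'a chart \<Rightarrow> ('a \<Rightarrow> real) \<Rightarrow> (nat \<Rightarrow> real) \<Rightarrow> real" where "pull c f \<equiv> \<lambda>y. f (cinv c y)"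
abbreviation G :: "'a chart \<Rightarrow> (nat \<Rightarrow> real) \<Rightarrow> nat \<Rightarrow> nat \<Rightarrow> real" where "G c \<equiv> \<lambda>y. gmetric M c (cinv c y)"

lemma hausdorff: "Hausdorff_space X"
  using riemannian by (simp add: riemannian_manifold_def)

lemma cover: "x \<in> topspace X \<Longrightarrow> \<exists>c\<in>atlas M. x \<in> cdom c"
  using riemannian by (auto simp: riemannian_manifold_def)

context
  fixes c assumes c: "c \<in> atlas M"
begin

lemma chart: "is_chart X n c"
  using riemannian c by (simp add: riemannian_manifold_def)

lemma openin_cdom: "openin X (cdom c)"
  and openin_V: "openin (Rn n) (V c)"
  and homeo: "homeomorphic_map (subtopology X (cdom c)) (subtopology (Rn n) (V c)) (cmap c)"
  using chart by (simp_all add: is_chart_def)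

lemma cdom_subset: "cdom c \<subseteq> topspace X" using openin_cdom by (rule openin_subset)

lemma inj_cmap: "inj_on (cmap c) (cdom c)"
  using homeomorphic_imp_injective_map[OF homeo] cdom_subset by (simp add: Int_absorb1 inf.absorb2)

lemma cinv_cmap: "x \<in> cdom c \<Longrightarrow> cinv c (cmap c x) = x"
  unfolding cinv_def by (rule inv_into_f_f[OF inj_cmap])

lemma cmap_cinv: "y \<in> V c \<Longrightarrow> cmap c (cinv c y) = y"
  unfolding cinv_def by (rule f_inv_into_f)

lemma cinv_in: "y \<in> V c \<Longrightarrow> cinv c y \<in> cdom c"
  unfolding cinv_def by (rule inv_into_into)

lemma openin_cmap_image:
  assumes "openin X U" "U \<subseteq> cdom c"
  shows "openin (Rn n) (cmap c ` U)"
proof -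
  have "openin (subtopology X (cdom c)) U" using assms by (auto simp: openin_subtopology)
  then have "openin (subtopology (Rn n) (V c)) (cmap c ` U)"
    using homeomorphic_map_openness[OF homeo] openin_subset by blast
  then show ?thesis using openin_V openin_trans_full by blast
qed

lemma openin_cinv_image:
  assumes "openin (Rn n) W" "W \<subseteq> V c"
  shows "openin X (cinv c ` W)"
proof -
  have "openin (subtopology (Rn n) (V c)) W" using assms by (auto simp: openin_subtopology)
  moreover have "continuous_map (subtopology X (cdom c)) (subtopology (Rn n) (V c)) (cmap c)"
    using homeo homeomorphic_imp_continuous_map by blast
  ultimately have "openin (subtopology X (cdom c)) {x \<in> topspace (subtopology X (cdom c)). cmap c x \<in> W}"
    by (rule openin_continuous_map_preimage[rotated])
  moreover have "{x \<in> topspace (subtopology X (cdom c)). cmap c x \<in> W} = cinv c ` W"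
  proof (intro subset_antisym subsetI)
    fix x assume "x \<in> {x \<in> topspace (subtopology X (cdom c)). cmap c x \<in> W}"
    then show "x \<in> cinv c ` W" using cinv_cmap[of x] by (metis (lifting) IntE image_eqI mem_Collect_eq topspace_subtopology)
  next
    fix x assume "x \<in> cinv c ` W"
    then show "x \<in> {x \<in> topspace (subtopology X (cdom c)). cmap c x \<in> W}"
      using assms(2) cinv_in cmap_cinv cdom_subset by auto
  qed
  ultimately show ?thesis using openin_cdom openin_trans_full by metis
qed

lemma continuous_map_cmap: "continuous_map (subtopology X (cdom c)) (Rn n) (cmap c)"
  using homeomorphic_imp_continuous_map[OF homeo] by (simp add: continuous_map_in_subtopology)

lemma continuous_map_cinv: "continuous_map (subtopology (Rn n) (V c)) X (cinv c)"
  unfolding continuous_map_def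
proof (intro conjI allI impI)
  show "cinv c \<in> topspace (subtopology (Rn n) (V c)) \<rightarrow> topspace X"
    using cinv_in cdom_subset by auto
  fix U assume U: "openin X U"
  have "{y \<in> topspace (subtopology (Rn n) (V c)). cinv c y \<in> U} = cmap c ` (U \<inter> cdom c)"
    using openin_subset[OF openin_V] cinv_in cmap_cinv cinv_cmap by (auto simp: image_iff)
  moreover have "openin (Rn n) (cmap c ` (U \<inter> cdom c))"
    by (intro openin_cmap_image openin_Int U openin_cdom) auto
  ultimately show "openin (subtopology (Rn n) (V c)) {y \<in> topspace (subtopology (Rn n) (V c)). cinv c y \<in> U}"
    by (auto simp: openin_subtopology)
qed

lemma local_metric_chart: "local_metric n (V c) (G c)"
proof
  show "openin (Rn n) (V c)" by (rule openin_V)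
  show "C1_on n (V c) (\<lambda>y. G c y i j)" if "i < n" "j < n" for i j
  proof (rule smooth_on_C1[OF openin_Rn_subset[OF openin_V]])
    show "smooth_on n (V c) (\<lambda>y. G c y i j)"
      using riemannian c that unfolding riemannian_manifold_def smooth_in_chart_def by blast
  qed
  show "pos_def n (G c y)" if "y \<in> V c" for y
    using riemannian c cinv_in[OF that] unfolding riemannian_manifold_def pos_def_def by blast
qed

text \<open>The bridge from the definitions on the manifold to \<open>local_metric\<close>,
  everything being evaluated in one and the same chart.\<close>

lemma metric_chart_components:
  assumes x: "x \<in> cdom c"
  shows "ginv M c x = local_metric.P n (G c) (cmap c x)"
    "gradient M c f x = local_metric.up n (G c) (pull c f) (cmap c x)"
    "christoffel M c x = local_metric.chr n (G c) (cmap c x)"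
    "\<lbrakk>i < n; j < n\<rbrakk> \<Longrightarrow> hessian M c f x i j = local_metric.hess n (G c) (pull c f) (cmap c x) i j"
proof -
  interpret lm: local_metric n "V c" "G c" by (rule local_metric_chart)
  have y: "cmap c x \<in> V c" using x by simp
  show g: "ginv M c x = lm.P (cmap c x)"
    by (intro ext) (simp add: ginv_def inv_coeff_def coeff_mat_def metric_mat_def cinv_cmap[OF x])
  show "gradient M c f x = lm.up (pull c f) (cmap c x)"
    by (intro ext) (simp add: gradient_def lm.up_def g differential_def cpartial_def)
  show chr: "christoffel M c x = lm.chr (cmap c x)"
    by (intro ext) (simp add: christoffel_def lm.chr_def g cpartial_def)
  show "hessian M c f x i j = lm.hess (pull c f) (cmap c x) i j" if ij: "i < n" "j < n"
  proof -
    \<comment> \<open>The inner partial is taken after a round trip through \<open>cinv c\<close>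
      and \<open>cmap c\<close>, which is the identity on \<open>V c\<close> only; locality of
      partials removes it.\<close>
    have "cpartial c i (\<lambda>z. differential c f z j) x = partial i (partial j (pull c f)) (cmap c x)"
      unfolding cpartial_def differential_def
      by (rule partial_cong[OF openin_V y ij(1)]) (simp add: cmap_cinv)
    then show ?thesis
      by (simp add: hessian_def cov_deriv1_def lm.hess_def chr differential_def cpartial_def)
  qed
qed

end

abbreviation gp :: "'a chart \<Rightarrow> ('a \<Rightarrow> real) \<Rightarrow> ('a \<Rightarrow> real) \<Rightarrow> 'a \<Rightarrow> real"
  where "gp c f h x \<equiv> local_metric.gprod n (G c) (pull c f) (pull c h) (cmap c x)"

text \<open>The chart is chosen as in \<open>norm_grad\<close>; for C^1 functions any other chart
  around the point gives the same value, see \<open>grad_prod_chart\<close>.\<close>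

definition grad_prod :: "('a \<Rightarrow> real) \<Rightarrow> ('a \<Rightarrow> real) \<Rightarrow> 'a \<Rightarrow> real"
  where "grad_prod f h x = gp (chart_at M x) f h x"

definition C1 :: "('a \<Rightarrow> real) \<Rightarrow> bool"
  where "C1 f \<longleftrightarrow> (\<forall>c\<in>atlas M. C1_on n (V c) (pull c f))"

definition smooth :: "('a \<Rightarrow> real) \<Rightarrow> bool"
  where "smooth f \<longleftrightarrow> (\<forall>c\<in>atlas M. smooth_in_chart n c (cdom c) f)"

lemma C1D: "C1 f \<Longrightarrow> c \<in> atlas M \<Longrightarrow> C1_on n (V c) (pull c f)"
  by (simp add: C1_def)

lemma smooth_C2:
  assumes "smooth f" and c: "c \<in> atlas M"
  shows "local_metric.C2 n (V c) (pull c f)"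
proof -
  have s: "smooth_on n (V c) (pull c f)" using assms by (simp add: smooth_def smooth_in_chart_def)
  have E: "V c \<subseteq> En n" by (rule openin_Rn_subset[OF openin_V[OF c]])
  show ?thesis
    unfolding local_metric.C2_def[OF local_metric_chart[OF c]]
    using smooth_on_C1[OF E] s smooth_on_partial[OF s] by blast
qed

lemma smooth_C1: "smooth f \<Longrightarrow> C1 f"
  unfolding C1_def using smooth_C2 local_metric.C2_C1(1) local_metric_chart by blast

lemma chart_at: "x \<in> topspace X \<Longrightarrow> chart_at M x \<in> atlas M" "x \<in> topspace X \<Longrightarrow> x \<in> cdom (chart_at M x)"
  unfolding chart_at_def using someI_ex[of "\<lambda>c. c \<in> atlas M \<and> x \<in> cdom c"] cover by blast+

text \<open>The transition runs from \<open>d\<close>-coordinates to \<open>c\<close>-coordinates,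
  the direction in which \<open>same_tensor2\<close> expresses the components with respect to
  \<open>d\<close>.\<close>

lemma
  assumes c: "c \<in> atlas M" and d: "d \<in> atlas M"
  shows local_isometry_transition: "local_isometry n (cmap c ` (cdom c \<inter> cdom d)) (G c)
      (cmap d ` (cdom c \<inter> cdom d)) (G d) (\<lambda>y. cmap c (cinv d y))"
    and openin_overlap: "openin (Rn n) (cmap d ` (cdom c \<inter> cdom d))"
    and C1_on_transition: "k < n \<Longrightarrow> C1_on n (cmap d ` (cdom c \<inter> cdom d)) (\<lambda>y. cmap c (cinv d y) k)"
proof -
  let ?O = "cdom c \<inter> cdom d"
  have O: "openin X ?O" using openin_cdom[OF c] openin_cdom[OF d] by (rule openin_Int)
  have Wc: "openin (Rn n) (cmap c ` ?O)" by (rule openin_cmap_image[OF c O]) auto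
  show Wd: "openin (Rn n) (cmap d ` ?O)" by (rule openin_cmap_image[OF d O]) auto
  interpret A: local_metric n "cmap c ` ?O" "G c"
    by (rule local_metric.local_metric_subset[OF local_metric_chart[OF c] Wc]) auto
  interpret B: local_metric n "cmap d ` ?O" "G d"
    by (rule local_metric.local_metric_subset[OF local_metric_chart[OF d] Wd]) auto
  have s: "smooth_on n (cmap d ` ?O) (\<lambda>y. cmap c (cinv d y) k)" if "k < n" for k
    using riemannian c d that unfolding riemannian_manifold_def compatible_charts_def smooth_in_chart_def by blast
  have C2: "B.C2 (\<lambda>y. cmap c (cinv d y) k)" if "k < n" for k
    unfolding B.C2_def using smooth_on_C1[OF openin_Rn_subset[OF Wd]] s[OF that] smooth_on_partial[OF s[OF that]] by blast
  then show "k < n \<Longrightarrow> C1_on n (cmap d ` ?O) (\<lambda>y. cmap c (cinv d y) k)"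
    by (rule B.C2_C1(1))
  show "local_isometry n (cmap c ` ?O) (G c) (cmap d ` ?O) (G d) (\<lambda>y. cmap c (cinv d y))"
  proof
    fix y assume "y \<in> cmap d ` ?O"
    then obtain x where x: "x \<in> ?O" "y = cmap d x" by blast
    then have cx: "cinv d y = x" using cinv_cmap[OF d] by auto
    then show "cmap c (cinv d y) \<in> cmap c ` ?O" using x by auto
    fix i j assume ij: "i < n" "j < n"
    have "same_tensor2 n c (gmetric M c) d (gmetric M d)"
      using riemannian c d unfolding riemannian_manifold_def by blast
    then have "gmetric M d x i j = (\<Sum>k<n. \<Sum>l<n. gmetric M c x k l * cpartial d i (\<lambda>z. cmap c z k) x
                                        * cpartial d j (\<lambda>z. cmap c z l) x)"
      using x(1) ij unfolding same_tensor2_def by blast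
    then show "G d y i j = (\<Sum>k<n. \<Sum>l<n. G c (cmap c (cinv d y)) k l *
         partial i (\<lambda>z. cmap c (cinv d z) k) y * partial j (\<lambda>z. cmap c (cinv d z) l) y)"
      using cinv_cmap[OF c, of x] x cx by (simp add: cpartial_def)
  qed (use C2 in auto)
qed

lemma gp_chart_independent:
  assumes f: "C1 f" and h: "C1 h" and c: "c \<in> atlas M" and d: "d \<in> atlas M"
    and x: "x \<in> cdom c" "x \<in> cdom d"
  shows "gp c f h x = gp d f h x"
proof -
  let ?O = "cdom c \<inter> cdom d"
  interpret li: local_isometry n "cmap c ` ?O" "G c" "cmap d ` ?O" "G d" "\<lambda>y. cmap c (cinv d y)"
    by (rule local_isometry_transition[OF c d])
  have y: "cmap d x \<in> cmap d ` ?O" using x by blast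
  have e: "pull c f (cmap c (cinv d y)) = pull d f y" if "y \<in> cmap d ` ?O" for y and f :: "'a \<Rightarrow> real"
    using that cinv_cmap[OF c] cinv_cmap[OF d] by auto
  have sub: "cmap c ` ?O \<subseteq> V c" by blast
  have "gp c f h x = li.B.gprod (\<lambda>y. pull c f (cmap c (cinv d y))) (\<lambda>y. pull c h (cmap c (cinv d y))) (cmap d x)"
    using li.gprod_pullback[OF C1_on_subset[OF C1D[OF f c] sub] C1_on_subset[OF C1D[OF h c] sub] y]
      cinv_cmap[OF d x(2)] by simp
  also have "\<dots> = li.B.gprod (\<lambda>y. pull c f (cmap c (cinv d y))) (pull d h) (cmap d x)"
    by (rule li.B.gprod_cong[OF y e])
  also have "\<dots> = li.B.gprod (pull d h) (\<lambda>y. pull c f (cmap c (cinv d y))) (cmap d x)"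
    by (rule li.B.gprod_sym[OF y])
  also have "\<dots> = li.B.gprod (pull d h) (pull d f) (cmap d x)"
    by (rule li.B.gprod_cong[OF y e])
  also have "\<dots> = gp d f h x" by (rule li.B.gprod_sym[OF y])
  finally show ?thesis .
qed

lemma grad_prod_chart:
  assumes "C1 f" "C1 h" "c \<in> atlas M" "x \<in> cdom c"
  shows "grad_prod f h x = gp c f h x"
  unfolding grad_prod_def
  using gp_chart_independent[OF assms(1,2)] assms(3,4) chart_at cdom_subset by blast

lemma hess_chart_independent:
  assumes u: "smooth u" and c: "c \<in> atlas M" and d: "d \<in> atlas M" and x: "x \<in> cdom c" "x \<in> cdom d"
  shows "(\<Sum>i<n. \<Sum>j<n. ginv M c x i j * hessian M c u x i j) =
      (\<Sum>i<n. \<Sum>j<n. ginv M d x i j * hessian M d u x i j)"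
    and "(\<Sum>i<n. \<Sum>j<n. \<Sum>k<n. \<Sum>l<n. ginv M c x i k * ginv M c x j l * hessian M c u x i j * hessian M c u x k l) =
      (\<Sum>i<n. \<Sum>j<n. \<Sum>k<n. \<Sum>l<n. ginv M d x i k * ginv M d x j l * hessian M d u x i j * hessian M d u x k l)"
proof -
  let ?O = "cdom c \<inter> cdom d"
  interpret li: local_isometry n "cmap c ` ?O" "G c" "cmap d ` ?O" "G d" "\<lambda>y. cmap c (cinv d y)"
    by (rule local_isometry_transition[OF c d])
  have y: "cmap d x \<in> cmap d ` ?O" using x by blast
  have e: "pull c f (cmap c (cinv d y)) = pull d f y" if "y \<in> cmap d ` ?O" for y and f :: "'a \<Rightarrow> real"
    using that cinv_cmap[OF c] cinv_cmap[OF d] by auto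
  have u2: "li.A.C2 (pull c u)"
    by (rule local_metric.C2_subset[OF local_metric_chart[OF c] li.A.V smooth_C2[OF u c]]) blast
  have hd: "li.B.hess (\<lambda>y. pull c u (cmap c (cinv d y))) (cmap d x) i j = hessian M d u x i j"
    if "i < n" "j < n" for i j
    using li.B.hess_cong[OF y that e] metric_chart_components(4)[OF d x(2) that] by simp
  have hc: "li.A.hess (pull c u) (cmap c (cinv d (cmap d x))) i j = hessian M c u x i j"
    if "i < n" "j < n" for i j
    using metric_chart_components(4)[OF c x(1) that] cinv_cmap[OF d x(2)] by simp
  have g: "li.B.P (cmap d x) = ginv M d x" "li.A.P (cmap c (cinv d (cmap d x))) = ginv M c x"
    using metric_chart_components(1)[OF d x(2)] metric_chart_components(1)[OF c x(1)] cinv_cmap[OF d x(2)] by simp_all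
  show "(\<Sum>i<n. \<Sum>j<n. ginv M c x i j * hessian M c u x i j) =
      (\<Sum>i<n. \<Sum>j<n. ginv M d x i j * hessian M d u x i j)"
    using li.trace_hess_pullback[OF u2 y] by (simp add: g hd hc)
  show "(\<Sum>i<n. \<Sum>j<n. \<Sum>k<n. \<Sum>l<n. ginv M c x i k * ginv M c x j l * hessian M c u x i j * hessian M c u x k l) =
      (\<Sum>i<n. \<Sum>j<n. \<Sum>k<n. \<Sum>l<n. ginv M d x i k * ginv M d x j l * hessian M d u x i j * hessian M d u x k l)"
    using li.norm_hess_pullback[OF u2 y] by (simp add: g hd hc)
qed

lemma
  assumes u: "smooth u" and c: "c \<in> atlas M" and x: "x \<in> cdom c"
  shows laplacian_chart: "laplacian M u x = - (\<Sum>i<n. \<Sum>j<n. local_metric.P n (G c) (cmap c x) i j *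
        local_metric.hess n (G c) (pull c u) (cmap c x) i j)"
    and norm_hess_chart: "norm_hess M u x = sqrt (\<Sum>i<n. \<Sum>j<n. \<Sum>k<n. \<Sum>l<n.
        local_metric.P n (G c) (cmap c x) i k * local_metric.P n (G c) (cmap c x) j l *
        local_metric.hess n (G c) (pull c u) (cmap c x) i j * local_metric.hess n (G c) (pull c u) (cmap c x) k l)"
    and norm_grad_chart: "norm_grad M u x = sqrt (gp c u u x)"
proof -
  have xX: "x \<in> topspace X" using cdom_subset[OF c] x by blast
  note ca = chart_at[OF xX]
  show "laplacian M u x = - (\<Sum>i<n. \<Sum>j<n. local_metric.P n (G c) (cmap c x) i j *
        local_metric.hess n (G c) (pull c u) (cmap c x) i j)"
    unfolding laplacian_def Let_def hess_chart_independent(1)[OF u ca(1) c ca(2) x]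
    by (simp add: metric_chart_components[OF c x])
  show "norm_hess M u x = sqrt (\<Sum>i<n. \<Sum>j<n. \<Sum>k<n. \<Sum>l<n.
        local_metric.P n (G c) (cmap c x) i k * local_metric.P n (G c) (cmap c x) j l *
        local_metric.hess n (G c) (pull c u) (cmap c x) i j * local_metric.hess n (G c) (pull c u) (cmap c x) k l)"
    unfolding norm_hess_def Let_def hess_chart_independent(2)[OF u ca(1) c ca(2) x]
    by (simp add: metric_chart_components[OF c x])
  let ?d = "chart_at M x"
  have "gp ?d u u x = (\<Sum>i<n. \<Sum>j<n. gmetric M ?d x i j * gradient M ?d u x i * gradient M ?d u x j)"
    using local_metric.gprod_G_up[OF local_metric_chart[OF ca(1)], of "cmap ?d x"] ca(2)
    by (simp add: metric_chart_components[OF ca] cinv_cmap[OF ca])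
  then have "norm_grad M u x = sqrt (gp ?d u u x)"
    by (simp add: norm_grad_def Let_def)
  then show "norm_grad M u x = sqrt (gp c u u x)"
    using gp_chart_independent[OF smooth_C1[OF u] smooth_C1[OF u] ca(1) c ca(2) x] by simp
qed

lemma norm_grad_eq: "smooth u \<Longrightarrow> x \<in> topspace X \<Longrightarrow> norm_grad M u x = sqrt (grad_prod u u x)"
  unfolding grad_prod_def by (rule norm_grad_chart[OF _ chart_at])

lemma grad_prod_nonneg:
  assumes "x \<in> topspace X"
  shows "grad_prod u u x \<ge> 0"
  unfolding grad_prod_def
  using local_metric.gprod_nonneg[OF local_metric_chart[OF chart_at(1)[OF assms]]] chart_at(2)[OF assms] by blast

lemma norm_grad_square: "smooth u \<Longrightarrow> x \<in> topspace X \<Longrightarrow> (norm_grad M u x)\<^sup>2 = grad_prod u u x"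
  by (simp add: norm_grad_eq grad_prod_nonneg)

lemma continuous_map_charts:
  assumes f: "\<And>c. c \<in> atlas M \<Longrightarrow> continuous_on (V c) (pull c f)"
  shows "continuous_map X euclideanreal f"
  unfolding continuous_map_def
proof (intro conjI allI impI)
  fix U :: "real set" assume U: "openin euclideanreal U"
  have "openin X (cinv c ` {y \<in> V c. pull c f y \<in> U})" if c: "c \<in> atlas M" for c
  proof (rule openin_cinv_image[OF c])
    have "continuous_map (subtopology (Rn n) (V c)) euclideanreal (pull c f)"
      using f[OF c] continuous_map_Rn_iff[OF openin_Rn_subset[OF openin_V[OF c]]] by blast
    from openin_continuous_map_preimage[OF this U]
    have "openin (subtopology (Rn n) (V c)) {y \<in> V c. pull c f y \<in> U}"
      using openin_Rn_subset[OF openin_V[OF c]] by (simp add: Int_absorb1)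
    then show "openin (Rn n) {y \<in> V c. pull c f y \<in> U}"
      by (rule openin_trans_full) (rule openin_V[OF c])
  qed blast
  then have "openin X (\<Union>c\<in>atlas M. cinv c ` {y \<in> V c. pull c f y \<in> U})" by blast
  moreover have "(\<Union>c\<in>atlas M. cinv c ` {y \<in> V c. pull c f y \<in> U}) = {x \<in> topspace X. f x \<in> U}"
  proof (intro subset_antisym subsetI)
    fix x assume "x \<in> {x \<in> topspace X. f x \<in> U}"
    then obtain c where "c \<in> atlas M" "x \<in> cdom c" "f x \<in> U" using cover by blast
    moreover from this have "x = cinv c (cmap c x)" using cinv_cmap by simp
    ultimately show "x \<in> (\<Union>c\<in>atlas M. cinv c ` {y \<in> V c. pull c f y \<in> U})"
      by (metis (mono_tags, lifting) UN_I image_eqI mem_Collect_eq)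
  next
    fix x assume "x \<in> (\<Union>c\<in>atlas M. cinv c ` {y \<in> V c. pull c f y \<in> U})"
    then show "x \<in> {x \<in> topspace X. f x \<in> U}" using cinv_in cdom_subset by blast
  qed
  ultimately show "openin X {x \<in> topspace X. f x \<in> U}" by simp
qed simp

lemma C1_continuous_map: "C1 f \<Longrightarrow> continuous_map X euclideanreal f"
  by (rule continuous_map_charts) (auto intro: C1_on_continuous C1D)

lemma C1_grad_prod:
  assumes u: "smooth u" and w: "smooth w"
  shows "C1 (grad_prod u w)"
  unfolding C1_def
proof
  fix c assume c: "c \<in> atlas M"
  note lm = local_metric_chart[OF c]
  show "C1_on n (V c) (pull c (grad_prod u w))"
    by (rule C1_on_cong[OF openin_V[OF c] _ local_metric.gprod_C1[OF lm smooth_C2[OF u c] smooth_C2[OF w c]]])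
       (use grad_prod_chart[OF smooth_C1[OF u] smooth_C1[OF w] c] cinv_in[OF c] cmap_cinv[OF c] in auto)
qed

lemma continuous_laplacian:
  assumes u: "smooth u"
  shows "continuous_map X euclideanreal (laplacian M u)"
proof (rule continuous_map_charts)
  fix c assume c: "c \<in> atlas M"
  interpret lm: local_metric n "V c" "G c" by (rule local_metric_chart[OF c])
  have "continuous_on (V c) (\<lambda>y. - (\<Sum>i<n. \<Sum>j<n. lm.P y i j * lm.hess (pull c u) y i j))"
    by (intro continuous_intros C1_on_continuous[OF lm.P_C1] lm.hess_continuous smooth_C2[OF u c]) auto
  then show "continuous_on (V c) (pull c (laplacian M u))"
    by (rule continuous_on_eq) (use laplacian_chart[OF u c cinv_in[OF c]] cmap_cinv[OF c] in auto)
qed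

lemma continuous_norm_hess:
  assumes u: "smooth u"
  shows "continuous_map X euclideanreal (norm_hess M u)"
proof (rule continuous_map_charts)
  fix c assume c: "c \<in> atlas M"
  interpret lm: local_metric n "V c" "G c" by (rule local_metric_chart[OF c])
  have "continuous_on (V c) (\<lambda>y. sqrt (\<Sum>i<n. \<Sum>j<n. \<Sum>k<n. \<Sum>l<n. lm.P y i k * lm.P y j l *
      lm.hess (pull c u) y i j * lm.hess (pull c u) y k l))"
    by (intro continuous_intros C1_on_continuous[OF lm.P_C1] lm.hess_continuous smooth_C2[OF u c]) auto
  then show "continuous_on (V c) (pull c (norm_hess M u))"
    by (rule continuous_on_eq) (use norm_hess_chart[OF u c cinv_in[OF c]] cmap_cinv[OF c] in auto)
qed

lemma continuous_norm_grad:
  assumes u: "smooth u"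
  shows "continuous_map X euclideanreal (norm_grad M u)"
proof -
  have "continuous_map X euclideanreal (\<lambda>x. sqrt (grad_prod u u x))"
    by (intro continuous_map_sqrt C1_continuous_map C1_grad_prod u)
  then show ?thesis
    by (rule continuous_map_eq) (simp add: norm_grad_eq[OF u])
qed

lemma hess_bounds:
  assumes u: "smooth u" and x: "x \<in> topspace X"
  shows "norm_hess M u x \<ge> 0" "\<bar>laplacian M u x\<bar> \<le> sqrt (real n) * norm_hess M u x"
    and "\<bar>grad_prod (grad_prod u u) u x\<bar> \<le> 2 * norm_hess M u x * grad_prod u u x"
proof -
  obtain c where c: "c \<in> atlas M" and xc: "x \<in> cdom c" using cover[OF x] by blast
  interpret lm: local_metric n "V c" "G c" by (rule local_metric_chart[OF c])
  let ?y = "cmap c x" and ?u = "pull c u"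
  have y: "?y \<in> V c" using xc by simp
  note C2 = smooth_C2[OF u c]
  show "norm_hess M u x \<ge> 0"
    unfolding norm_hess_chart[OF u c xc] using tensor_norm_nonneg[OF lm.P_pos[OF y]] by simp
  show "\<bar>laplacian M u x\<bar> \<le> sqrt (real n) * norm_hess M u x"
    unfolding norm_hess_chart[OF u c xc] laplacian_chart[OF u c xc] abs_minus_cancel
    by (rule tensor_trace_bound[OF lm.P_pos[OF y]])
  have "grad_prod (grad_prod u u) u x = gp c (grad_prod u u) u x"
    by (rule grad_prod_chart[OF C1_grad_prod[OF u u] smooth_C1[OF u] c xc])
  also have "\<dots> = lm.gprod ?u (pull c (grad_prod u u)) ?y" by (rule lm.gprod_sym[OF y])
  also have "\<dots> = lm.gprod ?u (lm.gprod ?u ?u) ?y"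
    by (rule lm.gprod_cong[OF y])
       (use grad_prod_chart[OF smooth_C1[OF u] smooth_C1[OF u] c] cinv_in[OF c] cmap_cinv[OF c] in auto)
  \<comment> \<open>With all arguments equal to \<open>u\<close>, the three terms of
    \<open>hess_up\<close> coincide up to sign and exactly one remains.\<close>
  also have "\<dots> = 2 * (\<Sum>i<n. \<Sum>j<n. lm.hess ?u ?y i j * lm.up ?u ?y i * lm.up ?u ?y j)"
    using lm.hess_up[OF y C2 C2 C2] by simp
  finally show "\<bar>grad_prod (grad_prod u u) u x\<bar> \<le> 2 * norm_hess M u x * grad_prod u u x"
    using tensor_quadratic_bound[OF lm.P_pos[OF y], of "lm.hess ?u ?y" "\<lambda>k. partial k ?u ?y"]
    unfolding norm_hess_chart[OF u c xc] grad_prod_chart[OF smooth_C1[OF u] smooth_C1[OF u] c xc]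
    by (simp add: lm.up_def lm.gprod_def abs_mult)
qed

end

section \<open>Leibniz rules for gradients and C^1 bump functions\<close>

context local_metric
begin

lemma gprod_add:
  assumes "C1_on n V f" "C1_on n V g" "y \<in> V"
  shows "gprod (\<lambda>y. f y + g y) w y = gprod f w y + gprod g w y"
  by (simp add: gprod_def partial_add[OF assms] distrib_left distrib_right sum.distrib)

lemma gprod_mult:
  assumes "C1_on n V f" "C1_on n V g" "y \<in> V"
  shows "gprod (\<lambda>y. f y * g y) w y = f y * gprod g w y + g y * gprod f w y"
  by (simp add: gprod_def partial_mult[OF assms] distrib_left distrib_right sum.distrib sum_distrib_left mult_ac)

lemma gprod_compose:
  assumes "C1_on n V f" "\<And>y. y \<in> V \<Longrightarrow> (\<psi> has_real_derivative \<psi>' (f y)) (at (f y))" "y \<in> V"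
  shows "gprod (\<lambda>y. \<psi> (f y)) w y = \<psi>' (f y) * gprod f w y"
  by (simp add: gprod_def partial_compose[OF assms] sum_distrib_left mult_ac)

lemma gprod_continuous:
  assumes "C1_on n V f" "C1_on n V g"
  shows "continuous_on V (gprod f g)"
  unfolding gprod_def[abs_def]
  by (intro continuous_intros C1_on_continuous[OF P_C1] C1_on_continuous_partial[OF assms(1)]
      C1_on_continuous_partial[OF assms(2)]) auto

end

text \<open>The building block of the cut-offs: the square of the positive part is C^1, the
  regularity that Green's formula asks of its test functions.\<close>

lemma DERIV_max_0_square: "((\<lambda>s::real. (max 0 s)\<^sup>2) has_real_derivative 2 * max 0 s) (at s)"
proof (cases "s = 0")
  case True
  have "((\<lambda>h::real. (max 0 h)\<^sup>2 / h) \<longlongrightarrow> 0) (at 0)"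
  proof (rule Lim_null_comparison)
    show "\<forall>\<^sub>F h in at 0. norm ((max 0 h)\<^sup>2 / h) \<le> \<bar>h::real\<bar>"
      by (rule always_eventually) (auto simp: max_def power2_eq_square)
    show "((\<lambda>h::real. \<bar>h\<bar>) \<longlongrightarrow> 0) (at 0)" by (rule tendsto_eq_intros | simp)+
  qed
  then show ?thesis using True by (simp add: DERIV_def)
next
  case False
  then consider "s > 0" | "s < 0" by linarith
  then show ?thesis
  proof cases
    case 1
    have "((\<lambda>s::real. s\<^sup>2) has_real_derivative 2 * max 0 s) (at s)"
      using 1 by (auto intro!: derivative_eq_intros)
    then show ?thesis
      by (rule has_field_derivative_transform_within_open[of _ _ _ "{0<..}"]) (use 1 in auto)
  next
    case 2
    have "((\<lambda>s::real. 0) has_real_derivative 2 * max 0 s) (at s)" using 2 by simp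
    then show ?thesis
      by (rule has_field_derivative_transform_within_open[of _ _ _ "{..<0}"]) (use 2 in auto)
  qed
qed

lemma C1_on_max_0_square: "C1_on n V f \<Longrightarrow> C1_on n V (\<lambda>y. (max 0 (f y))\<^sup>2)"
  by (rule C1_on_compose[where g="\<lambda>s. (max 0 s)\<^sup>2" and g'="\<lambda>s. 2 * max 0 s"])
     (auto intro!: DERIV_max_0_square continuous_intros)

text \<open>A product \<open>p\<close> of one-variable cut-offs vanishes off a cube
  \<open>Q\<close>; a second cut-off flattens it to 1 where it exceeds half its value at
  \<open>y\<close>.\<close>

lemma exists_C1_bump:
  assumes W: "openin (Rn n) W" and y: "y \<in> W"
  obtains \<beta> Q U where "C1_on n (En n) \<beta>" "compactin (Rn n) Q" "Q \<subseteq> W" "openin (Rn n) U" "y \<in> U"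
    "\<And>z. z \<in> En n - Q \<Longrightarrow> \<beta> z = 0" "\<And>z. z \<in> U \<Longrightarrow> \<beta> z = 1"
proof -
  have yE: "y \<in> En n" using W y openin_Rn_subset by blast
  obtain e where e: "e > 0" "\<And>z. z \<in> En n \<Longrightarrow> (\<And>i. i < n \<Longrightarrow> \<bar>z i - y i\<bar> < e) \<Longrightarrow> z \<in> W"
    using openin_Rn_box[OF W y] by blast
  \<comment> \<open>Half the radius, so that the closed cube \<open>Q\<close> still lies in
    \<open>W\<close>.\<close>
  define r where "r = e / 2"
  have r: "r > 0" "r < e" using e(1) by (auto simp: r_def)
  define Q where "Q = PiE {..<n} (\<lambda>i. {y i - r..y i + r})"
  have "compactin (Rn n) Q" unfolding Q_def by (subst compactin_PiE) auto
  have "Q \<subseteq> W"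
  proof
    fix z assume z: "z \<in> Q"
    show "z \<in> W"
    proof (rule e(2))
      show "z \<in> En n" using z by (auto simp: Q_def PiE_def)
      fix i assume "i < n"
      then have "z i \<in> {y i - r..y i + r}" using PiE_mem[OF z[unfolded Q_def]] by simp
      then show "\<bar>z i - y i\<bar> < e" using r by auto
    qed
  qed
  define p where "p = (\<lambda>z. \<Prod>i<n. (max 0 (r\<^sup>2 - (z i - y i) * (z i - y i)))\<^sup>2)"
  have p: "C1_on n (En n) p"
    unfolding p_def by (intro C1_on_prod C1_on_max_0_square C1_on_diff C1_on_mult C1_on_coord C1_on_const)
  have py: "p y > 0" unfolding p_def using r(1) by (intro prod_pos) auto
  \<comment> \<open>Where \<open>p\<close> is 0 the square is 1 and \<open>\<beta>\<close> is 0;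
    where \<open>p\<close> exceeds \<open>p y / 2\<close> the positive part vanishes and
    \<open>\<beta>\<close> is 1.\<close>
  define \<beta> where "\<beta> = (\<lambda>z. 1 - (max 0 (1 - 2 / p y * p z))\<^sup>2)"
  have "C1_on n (En n) \<beta>"
    unfolding \<beta>_def by (intro C1_on_diff C1_on_max_0_square C1_on_cmult p C1_on_const)
  moreover have "\<beta> z = 0" if "z \<in> En n - Q" for z
  proof -
    have "\<exists>i<n. z i \<notin> {y i - r..y i + r}"
      using that unfolding Q_def PiE_def Pi_def by blast
    then obtain i where i: "i < n" "z i \<notin> {y i - r..y i + r}" by blast
    then have "\<bar>r\<bar> \<le> \<bar>z i - y i\<bar>" using r(1) by auto
    then have "r\<^sup>2 \<le> (z i - y i) * (z i - y i)" by (simp add: abs_le_square_iff power2_eq_square)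
    then have "(max 0 (r\<^sup>2 - (z i - y i) * (z i - y i)))\<^sup>2 = 0" by simp
    then have "p z = 0" unfolding p_def using i(1) by (intro prod_zero) auto
    then show ?thesis by (simp add: \<beta>_def)
  qed
  moreover define U where "U = En n \<inter> p -` {p y / 2<..}"
  have "openin (top_of_set (En n)) U"
    unfolding U_def using C1_on_continuous[OF p] by (intro continuous_openin_preimage_gen) auto
  then have "openin (Rn n) U" by (metis Rn_eq)
  moreover have "y \<in> U" using py yE by (simp add: U_def)
  moreover have "\<beta> z = 1" if "z \<in> U" for z
  proof -
    have "p z > p y / 2" using that by (simp add: U_def)
    then have "1 - 2 / p y * p z < 0" using py by (simp add: field_simps)
    then show ?thesis by (simp add: \<beta>_def)
  qed
  ultimately show ?thesis using that[of \<beta> Q U] \<open>compactin (Rn n) Q\<close> \<open>Q \<subseteq> W\<close> by blast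
qed

context riemannian
begin

lemma grad_prod_cong_chart:
  assumes "x \<in> topspace X" "openin X U" "x \<in> U" "\<And>z. z \<in> U \<Longrightarrow> f z = g z"
  shows "grad_prod f u x = grad_prod g u x"
proof -
  let ?c = "chart_at M x"
  note c = chart_at[OF assms(1)]
  have o: "openin (Rn n) (cmap ?c ` (U \<inter> cdom ?c))"
    by (intro openin_cmap_image[OF c(1)] openin_Int assms openin_cdom c) auto
  have "partial i (pull ?c f) (cmap ?c x) = partial i (pull ?c g) (cmap ?c x)" if "i < n" for i
    by (rule partial_cong[OF o]) (use assms c cinv_cmap[OF c(1)] that in auto)
  then show ?thesis
    unfolding grad_prod_def local_metric.gprod_def[OF local_metric_chart[OF c(1)]]
    by (intro sum.cong refl) simp
qed

lemma grad_prod_0: "x \<in> topspace X \<Longrightarrow> grad_prod (\<lambda>_. 0) u x = 0"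
  unfolding grad_prod_def using local_metric.gprod_def[OF local_metric_chart[OF chart_at(1)]] by simp

lemma closedin_compactin: "compactin X K \<Longrightarrow> closedin X K"
  using hausdorff compactin_imp_closedin by blast

lemma
  assumes K: "compactin X K" and v: "\<And>x. x \<in> topspace X - K \<Longrightarrow> v x = 0" and x: "x \<in> topspace X - K"
  shows grad_prod_outside: "grad_prod v u x = 0"
    and norm_hess_outside: "smooth v \<Longrightarrow> norm_hess M v x = 0"
    and laplacian_outside: "smooth v \<Longrightarrow> laplacian M v x = 0"
proof -
  have o: "openin X (topspace X - K)" using closedin_compactin[OF K] by blast
  show "grad_prod v u x = 0"
    using grad_prod_cong_chart[of x "topspace X - K" v "\<lambda>_. 0" u] grad_prod_0 o x v by auto
  assume s: "smooth v"
  obtain c where c: "c \<in> atlas M" "x \<in> cdom c" using cover x by blast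
  interpret lm: local_metric n "V c" "G c" by (rule local_metric_chart[OF c(1)])
  let ?W = "cmap c ` ((topspace X - K) \<inter> cdom c)"
  have W: "openin (Rn n) ?W" by (intro openin_cmap_image[OF c(1)] openin_Int o openin_cdom c) auto
  interpret lw: local_metric n ?W "G c" by (rule lm.local_metric_subset[OF W]) auto
  have y: "cmap c x \<in> ?W" using x c(2) by blast
  have "lm.hess (pull c v) (cmap c x) i j = lm.hess (\<lambda>_. 0) (cmap c x) i j" if "i < n" "j < n" for i j
    by (rule lw.hess_cong[OF y that]) (use v cinv_cmap[OF c(1)] in auto)
  moreover have "partial j (\<lambda>_. 0) = (\<lambda>_. 0)" for j by (rule ext) simp
  ultimately have h: "lm.hess (pull c v) (cmap c x) i j = 0" if "i < n" "j < n" for i j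
    using that by (simp add: lm.hess_def)
  show "norm_hess M v x = 0" "laplacian M v x = 0"
    unfolding norm_hess_chart[OF s c] laplacian_chart[OF s c] using h by simp_all
qed

lemma C1_mult: "C1 f \<Longrightarrow> C1 g \<Longrightarrow> C1 (\<lambda>x. f x * g x)"
  and C1_diff: "C1 f \<Longrightarrow> C1 g \<Longrightarrow> C1 (\<lambda>x. f x - g x)"
  and C1_const: "C1 (\<lambda>_. a)"
  by (auto simp: C1_def intro!: C1_on_mult C1_on_diff)

lemma C1_compose:
  assumes "C1 f" "\<And>x. x \<in> topspace X \<Longrightarrow> (\<psi> has_real_derivative \<psi>' (f x)) (at (f x))"
    and "continuous_on (f ` topspace X) \<psi>'"
  shows "C1 (\<lambda>x. \<psi> (f x))"
  unfolding C1_def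
proof
  fix c assume c: "c \<in> atlas M"
  have in_X: "cinv c y \<in> topspace X" if "y \<in> V c" for y using cinv_in[OF c that] cdom_subset[OF c] by blast
  have "continuous_on (pull c f ` V c) \<psi>'"
    by (rule continuous_on_subset[OF assms(3)]) (use in_X in blast)
  then show "C1_on n (V c) (pull c (\<lambda>x. \<psi> (f x)))"
    by (intro C1_on_compose[where g=\<psi> and g'=\<psi>'] C1D[OF assms(1) c] assms(2) in_X)
qed

context
  fixes f g u :: "'a \<Rightarrow> real" and x
  assumes f: "C1 f" and g: "C1 g" and x: "x \<in> topspace X"
begin

lemma grad_prod_add: "grad_prod (\<lambda>x. f x + g x) u x = grad_prod f u x + grad_prod g u x"
  unfolding grad_prod_def using chart_at[OF x] f g
  by (intro local_metric.gprod_add[OF local_metric_chart]) (auto intro: C1D)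

lemma grad_prod_mult: "grad_prod (\<lambda>x. f x * g x) u x = f x * grad_prod g u x + g x * grad_prod f u x"
proof -
  let ?c = "chart_at M x"
  note c = chart_at[OF x]
  have "gp ?c (\<lambda>x. f x * g x) u x = pull ?c f (cmap ?c x) * gp ?c g u x + pull ?c g (cmap ?c x) * gp ?c f u x"
    using c by (intro local_metric.gprod_mult[OF local_metric_chart] C1D f g) auto
  then show ?thesis by (simp add: grad_prod_def cinv_cmap[OF c])
qed

lemma grad_prod_compose:
  assumes "\<And>x. x \<in> topspace X \<Longrightarrow> (\<psi> has_real_derivative \<psi>' (f x)) (at (f x))"
  shows "grad_prod (\<lambda>x. \<psi> (f x)) u x = \<psi>' (f x) * grad_prod f u x"
proof -
  let ?c = "chart_at M x"
  note c = chart_at[OF x]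
  have "gp ?c (\<lambda>x. \<psi> (f x)) u x = \<psi>' (pull ?c f (cmap ?c x)) * gp ?c f u x"
    using c cinv_in[OF c(1)] cdom_subset[OF c(1)]
    by (intro local_metric.gprod_compose[OF local_metric_chart] C1D f assms) auto
  then show ?thesis by (simp add: grad_prod_def cinv_cmap[OF c])
qed

end

lemma continuous_grad_prod:
  assumes f: "C1 f" and g: "C1 g"
  shows "continuous_map X euclideanreal (grad_prod f g)"
proof (rule continuous_map_charts)
  fix c assume c: "c \<in> atlas M"
  have "continuous_on (V c) (local_metric.gprod n (G c) (pull c f) (pull c g))"
    by (intro local_metric.gprod_continuous[OF local_metric_chart] C1D f g c)
  then show "continuous_on (V c) (pull c (grad_prod f g))"
    by (rule continuous_on_eq) (use grad_prod_chart[OF f g c cinv_in[OF c]] cmap_cinv[OF c] in auto)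
qed

text \<open>The bump of the model space is carried to the manifold and extended by 0 off the chart.
  Its compact support is closed by the Hausdorff property, which keeps the extension C^1.\<close>

lemma exists_bump:
  assumes x: "x \<in> topspace X"
  obtains c b K U where "c \<in> atlas M" "C1 b" "compactin X K" "K \<subseteq> cdom c" "openin X U" "x \<in> U"
    "\<And>z. z \<in> topspace X - K \<Longrightarrow> b z = 0" "\<And>z. z \<in> U \<Longrightarrow> b z = 1"
proof -
  obtain c where c: "c \<in> atlas M" and xc: "x \<in> cdom c" using cover[OF x] by blast
  obtain \<beta> Q W where \<beta>: "C1_on n (En n) \<beta>" and Q: "compactin (Rn n) Q" "Q \<subseteq> V c"
    and W: "openin (Rn n) W" "cmap c x \<in> W" and \<beta>0: "\<And>z. z \<in> En n - Q \<Longrightarrow> \<beta> z = 0"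
    and \<beta>1: "\<And>z. z \<in> W \<Longrightarrow> \<beta> z = 1"
    using exists_C1_bump[OF openin_V[OF c], of "cmap c x"] xc by blast
  define b where "b = (\<lambda>z. if z \<in> cdom c then \<beta> (cmap c z) else 0)"
  define K where "K = cinv c ` Q"
  have K: "compactin X K"
    unfolding K_def using Q by (intro image_compactin[OF _ continuous_map_cinv[OF c]]) (simp add: compactin_subtopology)
  have Kc: "K \<subseteq> cdom c" unfolding K_def using Q(2) cinv_in[OF c] by blast
  have VE: "V c \<subseteq> En n" by (rule openin_Rn_subset[OF openin_V[OF c]])
  have b0: "b z = 0" if "z \<notin> K" for z
  proof (cases "z \<in> cdom c")
    case True
    then have "cmap c z \<notin> Q" using that cinv_cmap[OF c True] unfolding K_def by force
    then show ?thesis using \<beta>0 True VE by (auto simp: b_def)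
  qed (simp add: b_def)
  have "C1 b"
    unfolding C1_def
  proof
    fix d assume d: "d \<in> atlas M"
    \<comment> \<open>Two open sets cover the chart \<open>d\<close>: the overlap with
      \<open>c\<close>, where \<open>b\<close> is a composition, and the complement of
      \<open>K\<close>, where \<open>b\<close> is 0.\<close>
    let ?A = "cmap d ` (cdom c \<inter> cdom d)" and ?B = "cmap d ` ((topspace X - K) \<inter> cdom d)"
    have A: "openin (Rn n) ?A" by (rule openin_overlap[OF c d])
    have B: "openin (Rn n) ?B"
      using closedin_compactin[OF K] by (intro openin_cmap_image[OF d] openin_Int openin_cdom[OF d]) auto
    have "C1_on n ?A (\<lambda>y. \<beta> (cmap c (cinv d y)))"
    proof (rule C1_on_chain[OF openin_Rn_En A \<beta>])
      fix y assume "y \<in> ?A"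
      then have "cmap c (cinv d y) \<in> V c" using cinv_cmap[OF d] by auto
      then show "cmap c (cinv d y) \<in> En n" using VE by blast
    qed (rule C1_on_transition[OF c d])
    then have "C1_on n ?A (pull d b)"
      by (rule C1_on_cong[OF A, rotated]) (use cinv_cmap[OF d] in \<open>auto simp: b_def\<close>)
    moreover have "C1_on n ?B (pull d b)"
      by (rule C1_on_cong[OF B _ C1_on_const[of _ _ 0]]) (use cinv_cmap[OF d] b0 in auto)
    ultimately have "C1_on n (?A \<union> ?B) (pull d b)" by (rule C1_on_Un[OF A B])
    moreover have "?A \<union> ?B = V d" using Kc cdom_subset[OF d] by blast
    ultimately show "C1_on n (V d) (pull d b)" by simp
  qed
  moreover define U where "U = cinv c ` (W \<inter> V c)"
  have "openin X U" unfolding U_def by (intro openin_cinv_image[OF c] openin_Int W openin_V[OF c]) auto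
  moreover have "x \<in> U" unfolding U_def using W(2) xc cinv_cmap[OF c xc] by force
  moreover have "b z = 1" if "z \<in> U" for z
    using that \<beta>1 cinv_in[OF c] cmap_cinv[OF c] by (auto simp: U_def b_def)
  ultimately show ?thesis using that[of c b K U] c K Kc b0 by blast
qed

end

subsection \<open>Integration and Green's formula\<close>

locale riemannian_with_volume = riemannian M for M :: "'a riem" +
  fixes vol :: "'a measure"
  assumes volume: "riemannian_volume M vol"
begin

lemma space_vol: "space vol = topspace X"
  using volume by (simp add: riemannian_volume_def)

lemma sets_vol: "sets vol = sigma_sets (topspace X) {U. openin X U}"
  using volume by (simp add: riemannian_volume_def)

lemma sets_vol_openin: "openin X U \<Longrightarrow> U \<in> sets vol"
  unfolding sets_vol by (rule sigma_sets.Basic) simp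

lemma sets_vol_closedin: "closedin X K \<Longrightarrow> K \<in> sets vol"
proof -
  assume K: "closedin X K"
  then have "space vol - (topspace X - K) \<in> sets vol" by (intro sets.compl_sets sets_vol_openin) blast
  then show "K \<in> sets vol" using closedin_subset[OF K] by (simp add: space_vol double_diff)
qed

lemma borel_measurable_continuous_map:
  assumes f: "continuous_map X euclideanreal f"
  shows "f \<in> borel_measurable vol"
proof (rule borel_measurableI)
  fix S :: "real set" assume "open S"
  then have "openin X {x \<in> topspace X. f x \<in> S}"
    using f openin_continuous_map_preimage by fastforce
  moreover have "f -` S \<inter> space vol = {x \<in> topspace X. f x \<in> S}" by (auto simp: space_vol)
  ultimately show "f -` S \<inter> space vol \<in> sets vol" using sets_vol_openin by metis
qed

section \<open>Change of variables in a chart\<close>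

context
  fixes c assumes c: "c \<in> atlas M"
begin

text \<open>Set to 0 off \<open>V c\<close>, where \<open>sdet\<close> has no meaning, so that it is
  measurable on the whole model space.\<close>

abbreviation density_on_chart :: "(nat \<Rightarrow> real) \<Rightarrow> real"
  where "density_on_chart \<equiv> \<lambda>y. if y \<in> V c then local_metric.sdet n (G c) y else 0"

lemma sqrt_det_metric: "sqrt (Determinant.det (metric_mat M c (cinv c y))) = local_metric.sdet n (G c) y"
  by (simp add: local_metric.sdet_def[OF local_metric_chart[OF c]] metric_mat_def coeff_mat_def)

lemma density_measurable: "density_on_chart \<in> borel_measurable (leb n)"
  by (rule borel_measurable_leb_extend[OF openin_V[OF c] C1_on_continuous])
     (rule local_metric.sdet_C1[OF local_metric_chart[OF c]])

lemma density_nonneg: "density_on_chart y \<ge> 0"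
  using local_metric.sdet_pos[OF local_metric_chart[OF c], of y] by (auto intro: less_imp_le)

lemma emeasure_vol_chart:
  assumes "A \<in> sets vol" "A \<subseteq> cdom c"
  shows "emeasure vol A = (\<integral>\<^sup>+ y\<in>cmap c ` A. ennreal (local_metric.sdet n (G c) y) \<partial>leb n)"
  using volume c assms unfolding riemannian_volume_def by (simp add: sqrt_det_metric)

lemma cinv_measurable: "cinv c \<in> restrict_space (leb n) (V c) \<rightarrow>\<^sub>M restrict_space vol (cdom c)"
proof (rule measurable_restrict_space2)
  have sp: "space (restrict_space (leb n) (V c)) = V c"
    using openin_Rn_subset[OF openin_V[OF c]] by (auto simp: space_restrict_space space_leb)
  show "cinv c \<in> space (restrict_space (leb n) (V c)) \<rightarrow> cdom c" using sp cinv_in[OF c] by auto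
  show "cinv c \<in> measurable (restrict_space (leb n) (V c)) vol"
  proof (rule measurable_sigma_sets[OF sets_vol])
    show "{U. openin X U} \<subseteq> Pow (topspace X)" using openin_subset by auto
    show "cinv c \<in> space (restrict_space (leb n) (V c)) \<rightarrow> topspace X"
      using sp cinv_in[OF c] cdom_subset[OF c] by auto
    fix U assume "U \<in> {U. openin X U}"
    then have o: "openin (Rn n) (cmap c ` (U \<inter> cdom c))"
      by (intro openin_cmap_image[OF c] openin_Int openin_cdom[OF c]) auto
    have "cinv c -` U \<inter> space (restrict_space (leb n) (V c)) = cmap c ` (U \<inter> cdom c)"
      unfolding sp using cinv_in[OF c] cmap_cinv[OF c] cinv_cmap[OF c] by (auto simp: image_iff)
    then show "cinv c -` U \<inter> space (restrict_space (leb n) (V c)) \<in> sets (restrict_space (leb n) (V c))"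
      using sets_leb_openin[OF o] sets_leb_openin[OF openin_V[OF c]]
      by (subst sets_restrict_space_iff) (auto simp: space_leb)
  qed
qed

text \<open>\<open>riemannian_volume\<close> prescribes the measure of sets. Read as an equality of
  measures, it makes the volume on a chart domain an image measure, and integrals can be
  transported.\<close>

lemma distr_chart:
  "distr (density (restrict_space (leb n) (V c)) (\<lambda>y. ennreal (density_on_chart y)))
    (restrict_space vol (cdom c)) (cinv c) = restrict_space vol (cdom c)" (is "distr ?N ?R _ = _")
proof (rule measure_eqI)
  have V: "V c \<in> sets (leb n)" by (rule sets_leb_openin[OF openin_V[OF c]])
  have cd: "cdom c \<in> sets vol" by (rule sets_vol_openin[OF openin_cdom[OF c]])
  have sp: "space (restrict_space (leb n) (V c)) = V c"
    using openin_Rn_subset[OF openin_V[OF c]] by (auto simp: space_restrict_space space_leb)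
  show "sets (distr ?N ?R (cinv c)) = sets ?R" by simp
  fix A assume "A \<in> sets (distr ?N ?R (cinv c))"
  then have AR: "A \<in> sets ?R" by simp
  then have A: "A \<in> sets vol" "A \<subseteq> cdom c"
    using cd by (auto simp: sets_restrict_space_iff)
  have B: "cinv c -` A \<inter> space ?N = cmap c ` A"
    using A(2) cinv_in[OF c] cmap_cinv[OF c] cinv_cmap[OF c] by (auto simp: sp image_iff)
  have Bs: "cmap c ` A \<in> sets (restrict_space (leb n) (V c))"
    using measurable_sets[OF cinv_measurable AR] B by simp
  have w: "(\<lambda>y. ennreal (density_on_chart y)) \<in> borel_measurable (restrict_space (leb n) (V c))"
    by (intro measurable_restrict_space1 measurable_compose[OF density_measurable] measurable_ennreal)
  have "emeasure (distr ?N ?R (cinv c)) A = emeasure ?N (cmap c ` A)"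
    using cinv_measurable AR B by (subst emeasure_distr) auto
  also have "\<dots> = (\<integral>\<^sup>+ y. ennreal (density_on_chart y) * indicator (cmap c ` A) y \<partial>restrict_space (leb n) (V c))"
    by (rule emeasure_density[OF w Bs])
  also have "\<dots> = (\<integral>\<^sup>+ y. ennreal (density_on_chart y) * indicator (cmap c ` A) y * indicator (V c) y \<partial>leb n)"
    using V by (subst nn_integral_restrict_space) (auto simp: space_leb)
  also have "\<dots> = (\<integral>\<^sup>+ y\<in>cmap c ` A. ennreal (local_metric.sdet n (G c) y) \<partial>leb n)"
    using A(2) by (intro nn_integral_cong) (auto simp: indicator_def)
  also have "\<dots> = emeasure vol A" by (rule emeasure_vol_chart[OF A, symmetric])
  also have "\<dots> = emeasure ?R A" using A cd by (subst emeasure_restrict_space) auto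
  finally show "emeasure (distr ?N ?R (cinv c)) A = emeasure ?R A" .
qed

lemma integral_chart:
  assumes f: "f \<in> borel_measurable vol" and z: "\<And>x. x \<in> topspace X - cdom c \<Longrightarrow> f x = 0"
  shows "integral\<^sup>L vol f = (\<integral>y. (if y \<in> V c then local_metric.sdet n (G c) y * f (cinv c y) else 0 :: real) \<partial>leb n)"
proof -
  let ?L = "restrict_space (leb n) (V c)" and ?R = "restrict_space vol (cdom c)"
  have V: "V c \<in> sets (leb n)" by (rule sets_leb_openin[OF openin_V[OF c]])
  have cd: "cdom c \<in> sets vol" by (rule sets_vol_openin[OF openin_cdom[OF c]])
  have w: "density_on_chart \<in> borel_measurable ?L"
    by (rule measurable_restrict_space1[OF density_measurable])
  have fR: "f \<in> borel_measurable ?R" by (rule measurable_restrict_space1[OF f])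
  have fc: "(\<lambda>y. f (cinv c y)) \<in> borel_measurable ?L"
    by (rule measurable_compose[OF cinv_measurable fR])
  have "integral\<^sup>L vol f = (\<integral>x. indicator (cdom c) x *\<^sub>R f x \<partial>vol)"
    using z by (intro Bochner_Integration.integral_cong) (auto simp: indicator_def space_vol)
  also have "\<dots> = integral\<^sup>L ?R f"
    using cd by (intro integral_restrict_space[symmetric]) auto
  also have "\<dots> = integral\<^sup>L (distr (density ?L (\<lambda>y. ennreal (density_on_chart y))) ?R (cinv c)) f"
    by (simp only: distr_chart)
  also have "\<dots> = (\<integral>y. f (cinv c y) \<partial>density ?L (\<lambda>y. ennreal (density_on_chart y)))"
    using cinv_measurable fR by (intro integral_distr) auto
  also have "\<dots> = (\<integral>y. density_on_chart y *\<^sub>R f (cinv c y) \<partial>?L)"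
    using density_nonneg by (intro integral_density[OF fc w]) auto
  also have "\<dots> = (\<integral>y. indicator (V c) y *\<^sub>R (density_on_chart y *\<^sub>R f (cinv c y)) \<partial>leb n)"
    using V by (intro integral_restrict_space) auto
  also have "\<dots> = (\<integral>y. (if y \<in> V c then local_metric.sdet n (G c) y * f (cinv c y) else 0) \<partial>leb n)"
    by (intro Bochner_Integration.integral_cong) (auto simp: indicator_def)
  finally show ?thesis .
qed

text \<open>On a small cube \<open>sdet\<close> stays within 1 of its value at the centre, so the
  volume is at most a constant times a finite Lebesgue measure. Finiteness on compact sets follows
  by covering.\<close>

lemma exists_finite_volume_nbhd:
  assumes x: "x \<in> cdom c"
  shows "\<exists>U. openin X U \<and> x \<in> U \<and> emeasure vol U < \<infinity>"
proof -
  interpret product_sigma_finite "\<lambda>_::nat. lborel :: real measure" by standard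
  interpret lm: local_metric n "V c" "G c" by (rule local_metric_chart[OF c])
  let ?y = "cmap c x"
  have y: "?y \<in> V c" using x by simp
  have yE: "?y \<in> En n" using y openin_Rn_subset[OF openin_V[OF c]] by blast
  have "(0::real) < 1" by simp
  from continuous_on_Rn_box[OF openin_V[OF c] y C1_on_continuous[OF lm.sdet_C1] this]
  obtain d where d: "d > 0" "\<And>z. z \<in> En n \<Longrightarrow> (\<And>i. i < n \<Longrightarrow> \<bar>z i - ?y i\<bar> < d) \<Longrightarrow>
      z \<in> V c \<and> \<bar>lm.sdet z - lm.sdet ?y\<bar> < 1"
    by blast
  define B where "B = PiE {..<n} (\<lambda>i. {?y i - d<..<?y i + d})"
  have B: "z \<in> V c \<and> \<bar>lm.sdet z - lm.sdet ?y\<bar> < 1" if "z \<in> B" for z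
  proof (rule d(2))
    show "z \<in> En n" using that by (auto simp: B_def PiE_def)
    fix i assume "i < n"
    then have "z i \<in> {?y i - d<..<?y i + d}" using PiE_mem[OF that[unfolded B_def]] by simp
    then show "\<bar>z i - ?y i\<bar> < d" by auto
  qed
  have oB: "openin (Rn n) B" unfolding B_def by (subst openin_PiE_gen) auto
  have yB: "?y \<in> B" using d(1) yE unfolding B_def by (auto simp: PiE_iff)
  let ?U = "cinv c ` B"
  have oU: "openin X ?U" using B by (intro openin_cinv_image[OF c oB]) auto
  have Bs: "B \<in> sets (leb n)" by (rule sets_leb_openin[OF oB])
  have "cmap c ` ?U = B" using B cmap_cinv[OF c] by (force simp: image_iff)
  then have "emeasure vol ?U = (\<integral>\<^sup>+ y\<in>B. ennreal (lm.sdet y) \<partial>leb n)"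
    using emeasure_vol_chart[OF sets_vol_openin[OF oU]] B cinv_in[OF c] by auto
  also have "\<dots> \<le> (\<integral>\<^sup>+ y. ennreal (lm.sdet ?y + 1) * indicator B y \<partial>leb n)"
    using B by (intro nn_integral_mono) (force simp: indicator_def intro!: ennreal_leI)
  also have "\<dots> = ennreal (lm.sdet ?y + 1) * emeasure (leb n) B" using Bs by (rule nn_integral_cmult_indicator)
  also have "emeasure (leb n) B = (\<Prod>i<n. emeasure lborel {?y i - d<..<?y i + d})"
    unfolding B_def by (rule emeasure_PiM) auto
  also have "\<dots> = ennreal ((2 * d) ^ n)" using d(1) by (simp add: ennreal_power)
  also have "ennreal (lm.sdet ?y + 1) * \<dots> < \<infinity>" by (simp add: ennreal_mult_less_top)
  finally have "emeasure vol ?U < \<infinity>" .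
  moreover have "x \<in> ?U" using yB cinv_cmap[OF c x] by force
  ultimately show ?thesis using oU by blast
qed

end

section \<open>Compact supports and integration by parts\<close>

lemma emeasure_compactin:
  assumes K: "compactin X K"
  shows "emeasure vol K < \<infinity>"
proof -
  let ?\<U> = "{U. openin X U \<and> emeasure vol U < \<infinity>}"
  have "K \<subseteq> \<Union> ?\<U>"
  proof
    fix x assume "x \<in> K"
    then obtain c where "c \<in> atlas M" "x \<in> cdom c" using cover compactin_subset_topspace[OF K] by blast
    then show "x \<in> \<Union> ?\<U>" using exists_finite_volume_nbhd by blast
  qed
  then obtain F where F: "finite F" "F \<subseteq> ?\<U>" "K \<subseteq> \<Union> F"
    using compactinD[OF K, of ?\<U>] by blast
  have "emeasure vol K \<le> emeasure vol (\<Union> F)"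
    using F by (intro emeasure_mono F(3) sets.finite_Union) (auto intro: sets_vol_openin)
  also have "\<dots> \<le> (\<Sum>U\<in>F. emeasure vol U)"
    using emeasure_subadditive_finite[OF F(1), of "\<lambda>U. U" vol] F(2) sets_vol_openin by auto
  also have "\<dots> < \<infinity>" using F by (auto simp: less_top[symmetric])
  finally show ?thesis .
qed

lemma integrable_compact_support:
  fixes f :: "'a \<Rightarrow> real"
  assumes K: "compactin X K" and f: "continuous_map X euclideanreal f"
    and z: "\<And>x. x \<in> topspace X - K \<Longrightarrow> f x = 0"
  shows "integrable vol f"
proof -
  have "compactin euclideanreal (f ` K)" using image_compactin[OF K f] .
  then have "bounded (f ` K)" by (simp add: compact_imp_bounded)
  then obtain B where B: "\<And>x. x \<in> K \<Longrightarrow> \<bar>f x\<bar> \<le> B" by (auto simp: bounded_real)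
  have "K \<in> sets vol" by (rule sets_vol_closedin[OF closedin_compactin[OF K]])
  then have "integrable vol (\<lambda>x. \<bar>B\<bar> * indicator K x)"
    using emeasure_compactin[OF K] by (intro integrable_mult_right integrable_real_indicator)
  then show ?thesis
  proof (rule Bochner_Integration.integrable_bound[OF _ borel_measurable_continuous_map[OF f]], intro AE_I2)
    fix x assume "x \<in> space vol"
    then show "norm (f x) \<le> norm (\<bar>B\<bar> * indicator K x)"
      using B[of x] z[of x] by (cases "x \<in> K") (auto simp: space_vol)
  qed
qed

text \<open>In coordinates, the integrand times the density is the divergence of a compactly
  supported vector field.\<close>

lemma integral_divergence_chart:
  assumes c: "c \<in> atlas M" and u: "smooth u" and v: "C1 v" and K: "compactin X K" "K \<subseteq> cdom c"
    and z: "\<And>x. x \<in> topspace X - K \<Longrightarrow> v x = 0"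
  shows "(\<integral>x. grad_prod v u x - v x * laplacian M u x \<partial>vol) = 0"
proof -
  interpret lm: local_metric n "V c" "G c" by (rule local_metric_chart[OF c])
  let ?h = "\<lambda>x. grad_prod v u x - v x * laplacian M u x"
  let ?u = "pull c u" and ?v = "pull c v"
  note u2 = smooth_C2[OF u c] and v1 = C1D[OF v c]
  define Q where "Q = cmap c ` K"
  have "compactin (subtopology X (cdom c)) K" using K by (simp add: compactin_subtopology)
  then have Q: "compactin (Rn n) Q"
    unfolding Q_def using image_compactin continuous_map_cmap[OF c] by blast
  have VE: "V c \<subseteq> En n" by (rule openin_Rn_subset[OF openin_V[OF c]])
  have QV: "Q \<subseteq> V c" using K(2) by (auto simp: Q_def)
  have "closedin (Rn n) Q" using Q by (intro compactin_imp_closedin) (auto simp: Hausdorff_space_product_topology)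
  then have oQ: "openin (Rn n) (En n - Q)" by (rule openin_diff[OF openin_Rn_En])
  have v0: "?v y = 0" if "y \<in> V c - Q" for y
  proof -
    have "cinv c y \<notin> K" using that cmap_cinv[OF c, of y] unfolding Q_def by (metis DiffD1 DiffD2 image_eqI)
    then show ?thesis using z cinv_in[OF c] cdom_subset[OF c] that by blast
  qed
  \<comment> \<open>The field \<open>v\<close> grad \<open>u\<close> weighted by the density and
    extended by 0. It is C^1 on all of \<open>En n\<close> because \<open>v\<close> vanishes off the
    compact set \<open>Q\<close> inside \<open>V c\<close>.\<close>
  define F where "F = (\<lambda>i y. if y \<in> V c then ?v y * (lm.sdet y * lm.up ?u y i) else 0)"
  have F0: "F i y = 0" if "y \<in> En n - Q" for i y using v0[of y] that by (auto simp: F_def)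
  have F1: "C1_on n (En n) (F i)" if i: "i < n" for i
  proof -
    have "C1_on n (V c) (\<lambda>y. ?v y * (lm.sdet y * lm.up ?u y i))"
      by (intro C1_on_mult v1 lm.sdet_C1 lm.up_C1[OF u2 i])
    then have "C1_on n (V c) (F i)" by (rule C1_on_cong[OF openin_V[OF c], rotated]) (simp add: F_def)
    moreover have "C1_on n (En n - Q) (F i)"
      by (rule C1_on_cong[OF oQ _ C1_on_const[of _ _ 0]]) (simp add: F0)
    ultimately have "C1_on n (V c \<union> (En n - Q)) (F i)" by (rule C1_on_Un[OF openin_V[OF c] oQ])
    moreover have "V c \<union> (En n - Q) = En n" using VE QV by blast
    ultimately show ?thesis by simp
  qed
  have "continuous_map X euclideanreal ?h"
    by (intro continuous_map_diff continuous_map_real_mult continuous_grad_prod[OF v smooth_C1[OF u]]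
        C1_continuous_map[OF v] continuous_laplacian[OF u])
  then have "integral\<^sup>L vol ?h = (\<integral>y. (if y \<in> V c then lm.sdet y * ?h (cinv c y) else 0) \<partial>leb n)"
  proof (intro integral_chart[OF c borel_measurable_continuous_map])
    fix x assume "x \<in> topspace X - cdom c"
    then have x: "x \<in> topspace X - K" using K(2) by blast
    have "grad_prod v u x = 0" by (rule grad_prod_outside[OF K(1) _ x]) (rule z)
    then show "?h x = 0" using z[OF x] by simp
  qed
  also have "\<dots> = (\<integral>y. (\<Sum>i<n. partial i (F i) y) \<partial>leb n)"
  proof (rule Bochner_Integration.integral_cong[OF refl])
    fix y assume "y \<in> space (leb n)"
    then have yE: "y \<in> En n" by (simp add: space_leb)
    show "(if y \<in> V c then lm.sdet y * ?h (cinv c y) else 0) = (\<Sum>i<n. partial i (F i) y)"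
    proof (cases "y \<in> V c")
      case True
      have "(\<Sum>i<n. partial i (F i) y) = (\<Sum>i<n. partial i (\<lambda>y. ?v y * (lm.sdet y * lm.up ?u y i)) y)"
        by (intro sum.cong refl partial_cong[OF openin_V[OF c] True]) (auto simp: F_def)
      also have "\<dots> = lm.sdet y * (lm.gprod ?v ?u y + ?v y * (\<Sum>i<n. \<Sum>j<n. lm.P y i j * lm.hess ?u y i j))"
        by (rule lm.divergence_form[OF True u2 v1])
      also have "lm.gprod ?v ?u y = grad_prod v u (cinv c y)"
        using grad_prod_chart[OF v smooth_C1[OF u] c cinv_in[OF c True]] cmap_cinv[OF c True] by simp
      also have "(\<Sum>i<n. \<Sum>j<n. lm.P y i j * lm.hess ?u y i j) = - laplacian M u (cinv c y)"
        using laplacian_chart[OF u c cinv_in[OF c True]] cmap_cinv[OF c True] by simp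
      finally show ?thesis using True by simp
    next
      case False
      then have "y \<in> En n - Q" using yE QV by blast
      then have "partial i (F i) y = 0" if "i < n" for i
        using partial_cong[OF oQ, of y i "F i" "\<lambda>_. 0"] that F0 by simp
      then show ?thesis using False by simp
    qed
  qed
  also have "\<dots> = (\<Sum>i<n. \<integral>y. partial i (F i) y \<partial>leb n)"
    by (rule Bochner_Integration.integral_sum) (auto intro!: integral_partial_compact(1)[OF Q F1 F0])
  also have "\<dots> = 0" by (intro sum.neutral ballI integral_partial_compact(2)[OF Q F1 F0]) auto
  finally show ?thesis .
qed

text \<open>A partition of unity is avoided by peeling off one chart neighbourhood at a time:
  \<open>v = b v + (1 - b) v\<close> with \<open>b = 1\<close> on that neighbourhood.\<close>

lemma integral_divergence_cover:
  assumes u: "smooth u" and F: "finite F"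
    and bump: "\<And>U. U \<in> F \<Longrightarrow> openin X U \<and> (\<exists>c\<in>atlas M. \<exists>b L. C1 b \<and> compactin X L \<and> L \<subseteq> cdom c \<and>
      (\<forall>x\<in>topspace X - L. b x = 0) \<and> (\<forall>x\<in>U. b x = 1))"
    and v: "C1 v" and K: "compactin X K" "K \<subseteq> \<Union> F" and z: "\<And>x. x \<in> topspace X - K \<Longrightarrow> v x = 0"
  shows "(\<integral>x. grad_prod v u x - v x * laplacian M u x \<partial>vol) = 0"
  using F bump v K z
proof (induction F arbitrary: v K rule: finite_induct)
  case empty
  then have "grad_prod v u x - v x * laplacian M u x = 0" if "x \<in> space vol" for x
    using that grad_prod_outside[of K v x u] by (auto simp: space_vol)
  then show ?case by (simp cong: Bochner_Integration.integral_cong)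
next
  case (insert U F)
  obtain c b L where c: "c \<in> atlas M" and b: "C1 b" and L: "compactin X L" "L \<subseteq> cdom c"
    and b0: "\<And>x. x \<in> topspace X - L \<Longrightarrow> b x = 0" and b1: "\<And>x. x \<in> U \<Longrightarrow> b x = 1" and U: "openin X U"
    using insert.prems(1)[of U] by blast
  define v1 where "v1 = (\<lambda>x. b x * v x)"
  define v2 where "v2 = (\<lambda>x. (1 - b x) * v x)"
  have v1: "C1 v1" unfolding v1_def by (intro C1_mult b insert.prems)
  have v2: "C1 v2" unfolding v2_def by (intro C1_mult C1_diff C1_const b insert.prems)
  have K1: "compactin X (K \<inter> L)"
    using insert.prems(3) closedin_compactin[OF L(1)] by (rule compact_Int_closedin)
  \<comment> \<open>Since \<open>b = 1\<close> on \<open>U\<close>, the function \<open>v2\<close>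
    vanishes there; its support shrinks to a set that the remaining \<open>F\<close> covers.\<close>
  have K2: "compactin X (K - U)"
  proof -
    have "compactin X (K \<inter> (topspace X - U))"
      using U by (intro compact_Int_closedin[OF insert.prems(3)]) auto
    moreover have "K \<inter> (topspace X - U) = K - U" using compactin_subset_topspace[OF insert.prems(3)] by blast
    ultimately show ?thesis by simp
  qed
  have z1: "v1 x = 0" if "x \<in> topspace X - K \<inter> L" for x
    using that b0 insert.prems(5) by (auto simp: v1_def)
  have z2: "v2 x = 0" if "x \<in> topspace X - (K - U)" for x
    using that b1 insert.prems(5) by (auto simp: v2_def)
  have I1: "(\<integral>x. grad_prod v1 u x - v1 x * laplacian M u x \<partial>vol) = 0"
    by (rule integral_divergence_chart[OF c u v1 K1 _ z1]) (use L in auto)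
  have I2: "(\<integral>x. grad_prod v2 u x - v2 x * laplacian M u x \<partial>vol) = 0"
    by (rule insert.IH[OF _ v2 K2 _ z2]) (use insert.prems in auto)
  have int: "integrable vol (\<lambda>x. grad_prod w u x - w x * laplacian M u x)"
    if w: "C1 w" "compactin X K'" "\<And>x. x \<in> topspace X - K' \<Longrightarrow> w x = 0" for w K'
  proof (rule integrable_compact_support[OF w(2)])
    show "continuous_map X euclideanreal (\<lambda>x. grad_prod w u x - w x * laplacian M u x)"
      by (intro continuous_map_diff continuous_map_real_mult
        continuous_grad_prod[OF w(1) smooth_C1[OF u]] C1_continuous_map[OF w(1)] continuous_laplacian[OF u])
    fix x assume x: "x \<in> topspace X - K'"
    have "grad_prod w u x = 0" by (rule grad_prod_outside[OF w(2) _ x]) (rule w(3))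
    then show "grad_prod w u x - w x * laplacian M u x = 0" using w(3)[OF x] by simp
  qed
  have "v = (\<lambda>x. v1 x + v2 x)" by (auto simp: v1_def v2_def algebra_simps)
  then have "grad_prod v u x - v x * laplacian M u x =
      (grad_prod v1 u x - v1 x * laplacian M u x) + (grad_prod v2 u x - v2 x * laplacian M u x)"
    if "x \<in> space vol" for x
    using grad_prod_add[OF v1 v2, of x u] that by (simp add: space_vol algebra_simps)
  then have "(\<integral>x. grad_prod v u x - v x * laplacian M u x \<partial>vol) =
      (\<integral>x. (grad_prod v1 u x - v1 x * laplacian M u x) + (grad_prod v2 u x - v2 x * laplacian M u x) \<partial>vol)"
    by (intro Bochner_Integration.integral_cong refl)
  also have "\<dots> = 0"
    using Bochner_Integration.integral_add[OF int[OF v1 K1 z1] int[OF v2 K2 z2]] I1 I2 by simp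
  finally show ?case .
qed

text \<open>Compactness of \<open>K\<close> leaves finitely many bump neighbourhoods. The integral
  of the difference is then 0, and separate integrability allows it to be split.\<close>

lemma green:
  assumes u: "smooth u" and v: "C1 v" and K: "compactin X K" and z: "\<And>x. x \<in> topspace X - K \<Longrightarrow> v x = 0"
  shows "(\<integral>x. grad_prod v u x \<partial>vol) = (\<integral>x. v x * laplacian M u x \<partial>vol)"
proof -
  let ?\<U> = "{U. openin X U \<and> (\<exists>c\<in>atlas M. \<exists>b L. C1 b \<and> compactin X L \<and> L \<subseteq> cdom c \<and>
      (\<forall>x\<in>topspace X - L. b x = 0) \<and> (\<forall>x\<in>U. b x = 1))}"
  have "K \<subseteq> \<Union> ?\<U>"
  proof
    fix x assume "x \<in> K"
    then have xX: "x \<in> topspace X" using compactin_subset_topspace[OF K] by blast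
    show "x \<in> \<Union> ?\<U>"
    proof (rule exists_bump[OF xX])
      fix c b L U assume a: "c \<in> atlas M" "C1 b" "compactin X L" "L \<subseteq> cdom c" "openin X U" "x \<in> U"
        "\<And>z. z \<in> topspace X - L \<Longrightarrow> b z = 0" "\<And>z. z \<in> U \<Longrightarrow> b z = 1"
      show "x \<in> \<Union> ?\<U>"
        by (rule UnionI[of U], rule CollectI, intro conjI bexI[of _ c] exI[of _ b] exI[of _ L] ballI)
           (use a in \<open>simp_all only: Diff_iff\<close>)
    qed
  qed
  then obtain F where F: "finite F" "F \<subseteq> ?\<U>" "K \<subseteq> \<Union> F"
    using compactinD[OF K, of ?\<U>] by blast
  have "(\<integral>x. grad_prod v u x - v x * laplacian M u x \<partial>vol) = 0"
    by (rule integral_divergence_cover[OF u F(1) _ v K F(3) z]) (use F(2) in blast)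
  moreover have "integrable vol (grad_prod v u)"
  proof (rule integrable_compact_support[OF K continuous_grad_prod[OF v smooth_C1[OF u]]])
    fix x assume "x \<in> topspace X - K"
    then show "grad_prod v u x = 0" by (rule grad_prod_outside[OF K z, rotated])
  qed
  moreover have "integrable vol (\<lambda>x. v x * laplacian M u x)"
    by (intro integrable_compact_support[OF K] continuous_map_real_mult C1_continuous_map[OF v]
        continuous_laplacian[OF u]) (simp add: z)
  ultimately show ?thesis by simp
qed

end

subsection \<open>The interpolation inequalities\<close>

text \<open>After division by \<open>s + t\<close> both shares lie in [0, 1], where a power with
  exponent at most 1 does not decrease them.\<close>

lemma powr_add_le:
  fixes s t q :: real
  assumes "0 \<le> s" "0 \<le> t" "0 < q" "q \<le> 1"
  shows "(s + t) powr q \<le> s powr q + t powr q"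
proof (cases "s + t = 0")
  case True
  then show ?thesis using assms by simp
next
  case False
  then have st: "s + t > 0" using assms by simp
  have *: "x / (s + t) \<le> (x / (s + t)) powr q" if "0 \<le> x" "x \<le> s + t" for x
  proof (cases "x = 0")
    case False
    then have "(x / (s + t)) powr 1 \<le> (x / (s + t)) powr q"
      using that st assms by (intro powr_mono') auto
    then show ?thesis using that st by simp
  qed simp
  have "1 = s / (s + t) + t / (s + t)" using st by (simp add: add_divide_distrib[symmetric])
  also have "\<dots> \<le> (s / (s + t)) powr q + (t / (s + t)) powr q"
    using * assms by (intro add_mono) auto
  also have "\<dots> = (s powr q + t powr q) / (s + t) powr q"
    using assms st by (simp add: powr_divide add_divide_distrib)
  finally show ?thesis using st by (simp add: field_simps)
qed

lemma powr_add_le_2: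
  fixes s t q :: real
  assumes "0 \<le> s" "0 \<le> t" "0 \<le> q"
  shows "(s + t) powr q \<le> 2 powr q * (s powr q + t powr q)"
proof -
  have "(s + t) powr q \<le> (2 * max s t) powr q" using assms by (intro powr_mono2) auto
  also have "\<dots> = 2 powr q * max s t powr q" by (rule powr_mult)
  also have "max s t powr q \<le> s powr q + t powr q" by (cases "s \<le> t") (auto simp: max_def)
  finally show ?thesis by (simp add: mult_left_mono)
qed

lemma powr_minus_1_mult: "0 \<le> x \<Longrightarrow> 0 < p \<Longrightarrow> x powr (p - 1) * x = x powr p" for x p :: real
  by (cases "x = 0") (auto simp: powr_diff)

lemma powr_square: "(x\<^sup>2) powr q = \<bar>x\<bar> powr (2 * q)" for x q :: real
proof (cases "x = 0")
  case False
  then have "(x\<^sup>2) powr q = (\<bar>x\<bar> powr 2) powr q" by simp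
  then show ?thesis by (simp only: powr_powr)
qed simp

text \<open>Replace the smaller of \<open>x\<close> and \<open>y\<close> by the larger one; the
  constant 1 in front of both terms is good enough for what follows.\<close>

lemma young_powr:
  fixes x y p :: real
  assumes "0 \<le> x" "0 \<le> y" "1 \<le> p"
  shows "x powr (p - 1) * y \<le> x powr p + y powr p"
proof (cases "y \<le> x")
  case True
  then have "x powr (p - 1) * y \<le> x powr (p - 1) * x" by (intro mult_left_mono) auto
  then show ?thesis using assms powr_minus_1_mult[of x p] by (smt (verit) powr_ge_zero)
next
  case False
  then have "x powr (p - 1) * y \<le> y powr (p - 1) * y"
    using assms by (intro mult_right_mono powr_mono2) auto
  then show ?thesis using assms powr_minus_1_mult[of y p] by (smt (verit) powr_ge_zero)
qed

lemma powr_mult_le: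
  fixes x y q :: real
  assumes "0 \<le> x" "0 \<le> y" "0 \<le> q"
  shows "(x * y) powr q \<le> x powr (2 * q) + y powr (2 * q)"
proof -
  have "x * y \<le> (max x y)\<^sup>2" unfolding power2_eq_square using assms by (intro mult_mono) auto
  then have "(x * y) powr q \<le> ((max x y)\<^sup>2) powr q" using assms by (intro powr_mono2) auto
  also have "\<dots> = max x y powr (2 * q)" using assms by (simp add: powr_square)
  also have "\<dots> \<le> x powr (2 * q) + y powr (2 * q)" by (cases "x \<le> y") (auto simp: max_def)
  finally show ?thesis .
qed

text \<open>Recovers |grad u|^p from the weighted square that Green's formula controls, with
  \<open>c\<close> = |grad u| and \<open>m\<close> = u^2 + \<open>\<delta>\<close>; for
  \<open>p < 2\<close> it stands for Hoelder's inequality with exponents 2/p and 2/(2-p). If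
  \<open>m\<close> is at most \<open>(\<epsilon> * c)\<^sup>2\<close>, the nonpositive exponent
  makes the first term large enough, otherwise the second term suffices.\<close>

lemma gradient_power_bound:
  fixes c \<epsilon> m p :: real
  assumes c: "0 \<le> c" and \<epsilon>: "0 < \<epsilon>" and m: "0 < m" and p: "0 < p" "p \<le> 2"
  shows "c powr p \<le> \<epsilon> powr (2 - p) * (c\<^sup>2 * m powr ((p - 2) / 2)) + \<epsilon> powr (- p) * m powr (p / 2)"
proof (cases "c = 0")
  case True
  then show ?thesis by simp
next
  case False
  then have c: "c > 0" using c by simp
  show ?thesis
  proof (cases "m \<le> (\<epsilon> * c)\<^sup>2")
    case True
    then have "((\<epsilon> * c)\<^sup>2) powr ((p - 2) / 2) \<le> m powr ((p - 2) / 2)"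
      using m p by (intro powr_mono2') auto
    moreover have "((\<epsilon> * c)\<^sup>2) powr ((p - 2) / 2) = \<epsilon> powr (p - 2) * c powr (p - 2)"
      using c \<epsilon> by (simp add: powr_square powr_mult abs_mult diff_divide_distrib)
    ultimately have "\<epsilon> powr (2 - p) * (c\<^sup>2 * (\<epsilon> powr (p - 2) * c powr (p - 2)))
        \<le> \<epsilon> powr (2 - p) * (c\<^sup>2 * m powr ((p - 2) / 2))"
      by (intro mult_left_mono) auto
    moreover have "\<epsilon> powr (2 - p) * (c\<^sup>2 * (\<epsilon> powr (p - 2) * c powr (p - 2))) = c powr p"
    proof -
      have "\<epsilon> powr (2 - p) * \<epsilon> powr (p - 2) = 1" using \<epsilon> by (simp add: powr_add[symmetric])
      moreover have "c\<^sup>2 * c powr (p - 2) = c powr p" using c by (simp add: powr_diff)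
      ultimately show ?thesis by (metis (no_types, lifting) mult.assoc mult.commute mult_1)
    qed
    ultimately show ?thesis by (smt (verit) powr_ge_zero mult_nonneg_nonneg)
  next
    case False
    then have "((\<epsilon> * c)\<^sup>2) powr (p / 2) \<le> m powr (p / 2)"
      using p by (intro powr_mono2) auto
    moreover have "((\<epsilon> * c)\<^sup>2) powr (p / 2) = \<epsilon> powr p * c powr p"
      unfolding powr_square using c \<epsilon> by (simp add: powr_mult abs_mult)
    ultimately have "\<epsilon> powr (- p) * (\<epsilon> powr p * c powr p) \<le> \<epsilon> powr (- p) * m powr (p / 2)"
      by (intro mult_left_mono) auto
    moreover have "\<epsilon> powr (- p) * (\<epsilon> powr p * c powr p) = c powr p"
      using \<epsilon> by (simp add: powr_minus)
    ultimately show ?thesis by (smt (verit) powr_ge_zero mult_nonneg_nonneg zero_le_power2)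
  qed
qed

lemma le_of_le_add_small:
  fixes a b d :: real
  assumes "\<And>\<eta>. \<eta> > 0 \<Longrightarrow> a \<le> b + d * \<eta>" and "d \<ge> 0"
  shows "a \<le> b"
proof (rule field_le_epsilon)
  fix e :: real assume e: "e > 0"
  \<comment> \<open>The divisor is \<open>d + 1\<close> because \<open>d\<close> may be 0.\<close>
  have "a \<le> b + d * (e / (d + 1))" using assms(1)[of "e / (d + 1)"] assms(2) e by simp
  also have "d * (e / (d + 1)) \<le> e" using assms(2) e by (simp add: field_simps)
  finally show "a \<le> b + e" by simp
qed

text \<open>Subadditivity of the power 1/p separates the two integrals and turns the factors
  \<open>\<epsilon> powr (- p)\<close> and \<open>\<epsilon> powr p\<close> into the inverse of
  \<open>\<epsilon>\<close> and \<open>\<epsilon>\<close>.\<close>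

lemma Lp_norm_interpolate:
  assumes p: "1 \<le> p" and C: "0 < C" and \<epsilon>: "0 < \<epsilon>"
    and le: "(\<integral>x. \<bar>f x\<bar> powr p \<partial>vol)
      \<le> C * (\<epsilon> powr (- p) * (\<integral>x. \<bar>g x\<bar> powr p \<partial>vol) + \<epsilon> powr p * (\<integral>x. \<bar>h x\<bar> powr p \<partial>vol))"
  shows "Lp_norm vol p f \<le> C powr (1 / p) / \<epsilon> * Lp_norm vol p g + C powr (1 / p) * \<epsilon> * Lp_norm vol p h"
proof -
  let ?A = "\<integral>x. \<bar>g x\<bar> powr p \<partial>vol" and ?B = "\<integral>x. \<bar>h x\<bar> powr p \<partial>vol"
  have nn: "?A \<ge> 0" "?B \<ge> 0" "(\<integral>x. \<bar>f x\<bar> powr p \<partial>vol) \<ge> 0" by simp_all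
  have "Lp_norm vol p f \<le> (C * (\<epsilon> powr (- p) * ?A + \<epsilon> powr p * ?B)) powr (1 / p)"
    unfolding Lp_norm_def using le p nn by (intro powr_mono2) auto
  also have "\<dots> = C powr (1 / p) * (\<epsilon> powr (- p) * ?A + \<epsilon> powr p * ?B) powr (1 / p)"
    by (rule powr_mult)
  also have "(\<epsilon> powr (- p) * ?A + \<epsilon> powr p * ?B) powr (1 / p)
      \<le> (\<epsilon> powr (- p) * ?A) powr (1 / p) + (\<epsilon> powr p * ?B) powr (1 / p)"
    using nn p by (intro powr_add_le) auto
  also have "(\<epsilon> powr (- p) * ?A) powr (1 / p) = inverse \<epsilon> * ?A powr (1 / p)"
  proof -
    have "(\<epsilon> powr (- p)) powr (1 / p) = \<epsilon> powr (- 1)" using p by (simp add: powr_powr)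
    also have "\<dots> = inverse \<epsilon>" using \<epsilon> by (simp add: powr_minus)
    finally show ?thesis by (simp add: powr_mult)
  qed
  also have "(\<epsilon> powr p * ?B) powr (1 / p) = \<epsilon> * ?B powr (1 / p)"
    using nn p \<epsilon> by (subst powr_mult) (auto simp: powr_powr)
  finally show ?thesis
    unfolding Lp_norm_def using C by (simp add: field_simps)
qed

section \<open>The integral estimates from regularised test functions\<close>

context riemannian_with_volume
begin

context
  fixes u K assumes u: "smooth u" and K: "compactin X K" and u0: "\<And>x. x \<in> topspace X - K \<Longrightarrow> u x = 0"
begin

lemma integrable_Lp:
  assumes p: "0 < p" and f: "continuous_map X euclideanreal f" "\<And>x. x \<in> topspace X - K \<Longrightarrow> f x = 0"
  shows "integrable vol (\<lambda>x. \<bar>f x\<bar> powr p)"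
proof (rule integrable_compact_support[OF K])
  have "continuous_on UNIV (\<lambda>t::real. \<bar>t\<bar> powr p)"
    using p by (intro continuous_on_powr' continuous_intros) auto
  then have "continuous_map X euclideanreal ((\<lambda>t::real. \<bar>t\<bar> powr p) \<circ> f)"
    by (intro continuous_map_compose[OF f(1)]) simp
  then show "continuous_map X euclideanreal (\<lambda>x. \<bar>f x\<bar> powr p)" by (simp add: o_def)
qed (simp add: f(2))

lemma grad_prod_u_outside: "x \<in> topspace X - K \<Longrightarrow> grad_prod u w x = 0"
  by (rule grad_prod_outside[OF K u0])

lemma norm_grad_outside: "x \<in> topspace X - K \<Longrightarrow> norm_grad M u x = 0"
  using norm_grad_eq[OF u] grad_prod_u_outside by simp

lemma integrable_u_powr: "0 < p \<Longrightarrow> integrable vol (\<lambda>x. \<bar>u x\<bar> powr p)"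
  by (rule integrable_Lp[OF _ C1_continuous_map[OF smooth_C1[OF u]] u0])

lemma integrable_grad_powr: "0 < p \<Longrightarrow> integrable vol (\<lambda>x. \<bar>norm_grad M u x\<bar> powr p)"
  by (rule integrable_Lp[OF _ continuous_norm_grad[OF u] norm_grad_outside])

lemma integrable_hess_powr: "0 < p \<Longrightarrow> integrable vol (\<lambda>x. \<bar>norm_hess M u x\<bar> powr p)"
  by (rule integrable_Lp[OF _ continuous_norm_hess[OF u] norm_hess_outside[OF K u0 _ u]])

lemma integrable_laplacian_powr: "0 < p \<Longrightarrow> integrable vol (\<lambda>x. \<bar>laplacian M u x\<bar> powr p)"
  by (rule integrable_Lp[OF _ continuous_laplacian[OF u] laplacian_outside[OF K u0 _ u]])

lemma integrable_indicator_K: "integrable vol (indicator K :: 'a \<Rightarrow> real)"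
  by (intro integrable_real_indicator sets_vol_closedin closedin_compactin K emeasure_compactin)

lemma norm_grad_nonneg: "x \<in> topspace X \<Longrightarrow> norm_grad M u x \<ge> 0"
  using norm_grad_eq[OF u] grad_prod_nonneg by simp

lemma integral_grad_le_laplacian_regularized:
  assumes p: "1 < p" "p \<le> 2" and \<epsilon>: "0 < \<epsilon>" and \<delta>: "0 < \<delta>"
  shows "(\<integral>x. \<bar>norm_grad M u x\<bar> powr p \<partial>vol) \<le>
    (1 / (p - 1) + 1) * (\<epsilon> powr (- p) * (\<integral>x. \<bar>u x\<bar> powr p \<partial>vol) + \<epsilon> powr p * (\<integral>x. \<bar>laplacian M u x\<bar> powr p \<partial>vol))
    + \<epsilon> powr (- p) * measure vol K * \<delta> powr (p / 2)"
proof -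
  define e where "e = (p - 2) / 2"
  have e0: "e \<le> 0" and e2: "p - 2 = 2 * e" using p by (simp_all add: e_def)
  define m where "m = (\<lambda>s::real. s\<^sup>2 + \<delta>)"
  have m: "m s > 0" for s unfolding m_def using \<delta> by (simp add: add_nonneg_pos)
  define \<phi> where "\<phi> = (\<lambda>s. s * m s powr e)"
  define \<phi>' where "\<phi>' = (\<lambda>s. m s powr e + s * (e * m s powr (e - 1) * (2 * s)))"
  have D: "(\<phi> has_real_derivative \<phi>' s) (at s)" for s
    unfolding \<phi>_def \<phi>'_def m_def using m[of s, unfolded m_def]
    by (auto intro!: derivative_eq_intros simp: powr_diff field_simps)
  have \<phi>'_ge: "(p - 1) * m s powr e \<le> \<phi>' s" for s
  proof -
    \<comment> \<open>As \<open>p - 2\<close> is not positive, replacing \<open>s\<^sup>2\<close> by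
      the larger \<open>m s\<close> lowers the derivative of \<open>\<phi>\<close> and leaves the
      factor \<open>1 + (p - 2)\<close>, which is positive for \<open>p > 1\<close>.\<close>
    have "s\<^sup>2 * m s powr (e - 1) \<le> m s * m s powr (e - 1)"
      using \<delta> by (intro mult_right_mono) (auto simp: m_def)
    also have "\<dots> = m s powr e" using m[of s] by (simp add: powr_diff)
    finally have "(p - 2) * m s powr e \<le> (p - 2) * (s\<^sup>2 * m s powr (e - 1))"
      using p by (intro mult_left_mono_neg) auto
    moreover have "\<phi>' s = m s powr e + (p - 2) * (s\<^sup>2 * m s powr (e - 1))"
      using e2 by (simp add: \<phi>'_def power2_eq_square)
    ultimately show ?thesis by (simp add: algebra_simps)
  qed
  \<comment> \<open>The exponent \<open>e\<close> is not positive, so passing from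
    \<open>m s\<close> down to \<open>s\<^sup>2\<close> only increases the power. The resulting
    bound is free of \<open>\<delta>\<close>.\<close>
  have \<phi>_abs: "\<bar>\<phi> s\<bar> \<le> \<bar>s\<bar> powr (p - 1)" for s
  proof (cases "s = 0")
    case False
    have "m s powr e \<le> (s\<^sup>2) powr e" using False \<delta> e0 by (intro powr_mono2') (auto simp: m_def)
    also have "\<dots> = \<bar>s\<bar> powr (p - 2)" by (simp add: powr_square e_def diff_divide_distrib)
    finally have "\<bar>s\<bar> * m s powr e \<le> \<bar>s\<bar> * \<bar>s\<bar> powr (p - 2)" by (intro mult_left_mono) auto
    also have "\<dots> = \<bar>s\<bar> powr (p - 1)" using False powr_mult_base[of "\<bar>s\<bar>" "p - 2"] by simp
    finally show ?thesis by (simp add: \<phi>_def abs_mult)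
  qed (simp add: \<phi>_def)
  define v where "v = (\<lambda>x. \<phi> (u x))"
  have v: "C1 v"
    unfolding v_def
  proof (rule C1_compose[OF smooth_C1[OF u] D])
    show "continuous_on (u ` topspace X) \<phi>'"
      unfolding \<phi>'_def m_def using m[unfolded m_def]
      by (intro continuous_intros) (auto simp: less_imp_neq[symmetric])
  qed
  have v0: "v x = 0" if "x \<in> topspace X - K" for x using u0[OF that] by (simp add: v_def \<phi>_def)
  have gv: "grad_prod v u x = \<phi>' (u x) * (norm_grad M u x)\<^sup>2" if x: "x \<in> topspace X" for x
    unfolding v_def norm_grad_square[OF u x]
    by (rule grad_prod_compose[OF smooth_C1[OF u] smooth_C1[OF u] x D])
  have int_gv: "integrable vol (grad_prod v u)"
    by (rule integrable_compact_support[OF K continuous_grad_prod[OF v smooth_C1[OF u]] grad_prod_outside[OF K v0]])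
  have int_vl: "integrable vol (\<lambda>x. v x * laplacian M u x)"
    by (intro integrable_compact_support[OF K] continuous_map_real_mult C1_continuous_map[OF v]
        continuous_laplacian[OF u]) (simp add: v0)
  have p0: "0 < p" using p by simp
  note ints = integrable_u_powr[OF p0] integrable_grad_powr[OF p0] integrable_laplacian_powr[OF p0]
    integrable_indicator_K int_gv int_vl
  \<comment> \<open>Since \<open>m\<close> is at least \<open>\<delta>\<close> everywhere,
    \<open>gradient_power_bound\<close> leaves a \<open>\<delta>\<close> term that does not vanish
    with \<open>u\<close>. It is charged to \<open>K\<close> alone, which has finite volume.\<close>
  have A: "\<bar>norm_grad M u x\<bar> powr p \<le> \<epsilon> powr (2 - p) / (p - 1) * grad_prod v u x
      + \<epsilon> powr (- p) * \<bar>u x\<bar> powr p + \<epsilon> powr (- p) * \<delta> powr (p / 2) * indicator K x"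
    if x: "x \<in> space vol" for x
  proof -
    let ?c = "norm_grad M u x"
    have xX: "x \<in> topspace X" using x by (simp add: space_vol)
    show ?thesis
    proof (cases "x \<in> K")
      case True
      have "?c powr p \<le> \<epsilon> powr (2 - p) * (?c\<^sup>2 * m (u x) powr e) + \<epsilon> powr (- p) * m (u x) powr (p / 2)"
        unfolding e_def using p by (intro gradient_power_bound norm_grad_nonneg xX \<epsilon> m) auto
      moreover have "?c\<^sup>2 * m (u x) powr e \<le> grad_prod v u x / (p - 1)"
        using mult_left_mono[OF \<phi>'_ge[of "u x"], of "?c\<^sup>2"] p unfolding gv[OF xX] by (simp add: field_simps)
      then have "\<epsilon> powr (2 - p) * (?c\<^sup>2 * m (u x) powr e) \<le> \<epsilon> powr (2 - p) * (grad_prod v u x / (p - 1))"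
        by (intro mult_left_mono) auto
      moreover have "m (u x) powr (p / 2) \<le> \<bar>u x\<bar> powr p + \<delta> powr (p / 2)"
        using powr_add_le[of "(u x)\<^sup>2" \<delta> "p / 2"] \<delta> p by (simp add: m_def powr_square)
      then have "\<epsilon> powr (- p) * m (u x) powr (p / 2) \<le> \<epsilon> powr (- p) * (\<bar>u x\<bar> powr p + \<delta> powr (p / 2))"
        by (intro mult_left_mono) auto
      ultimately show ?thesis
        using True norm_grad_nonneg[OF xX] by (simp add: distrib_left)
    next
      case False
      then have xK: "x \<in> topspace X - K" using xX by simp
      then show ?thesis
        using False norm_grad_outside[OF xK] gv[OF xX] u0[OF xK] by simp
    qed
  qed
  \<comment> \<open>Young's inequality for |u| divided by \<open>\<epsilon>\<close> and
    \<open>\<epsilon>\<close> times the Laplacian; the factor \<open>\<epsilon> powr (2 - p)\<close>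
    inherited from \<open>A\<close> is exactly the one produced by this scaling.\<close>
  have B: "\<epsilon> powr (2 - p) * (v x * laplacian M u x)
      \<le> \<epsilon> powr (- p) * \<bar>u x\<bar> powr p + \<epsilon> powr p * \<bar>laplacian M u x\<bar> powr p" for x
  proof -
    let ?l = "\<bar>laplacian M u x\<bar>"
    have "v x * laplacian M u x \<le> \<bar>v x\<bar> * ?l" by (simp add: abs_mult[symmetric])
    also have "\<dots> \<le> \<bar>u x\<bar> powr (p - 1) * ?l" unfolding v_def by (intro mult_right_mono \<phi>_abs) auto
    finally have "\<epsilon> powr (2 - p) * (v x * laplacian M u x) \<le> \<epsilon> powr (2 - p) * (\<bar>u x\<bar> powr (p - 1) * ?l)"
      by (intro mult_left_mono) auto
    also have "\<dots> = (\<bar>u x\<bar> / \<epsilon>) powr (p - 1) * (\<epsilon> * ?l)"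
    proof -
      have "\<epsilon> powr (2 - p) = \<epsilon> powr (1 - (p - 1))" by (simp add: algebra_simps)
      also have "\<dots> = \<epsilon> powr 1 / \<epsilon> powr (p - 1)" by (rule powr_diff)
      finally show ?thesis using \<epsilon> by (simp add: powr_divide)
    qed
    also have "\<dots> \<le> (\<bar>u x\<bar> / \<epsilon>) powr p + (\<epsilon> * ?l) powr p"
      using \<epsilon> p by (intro young_powr) auto
    also have "\<dots> = \<epsilon> powr (- p) * \<bar>u x\<bar> powr p + \<epsilon> powr p * ?l powr p"
      using \<epsilon> by (simp add: powr_divide powr_mult powr_minus field_simps)
    finally show ?thesis .
  qed
  let ?U = "\<integral>x. \<bar>u x\<bar> powr p \<partial>vol" and ?L = "\<integral>x. \<bar>laplacian M u x\<bar> powr p \<partial>vol"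
  have "(\<integral>x. \<bar>norm_grad M u x\<bar> powr p \<partial>vol) \<le> (\<integral>x. \<epsilon> powr (2 - p) / (p - 1) * grad_prod v u x
      + \<epsilon> powr (- p) * \<bar>u x\<bar> powr p + \<epsilon> powr (- p) * \<delta> powr (p / 2) * indicator K x \<partial>vol)"
    using ints by (intro integral_mono A Bochner_Integration.integrable_add integrable_mult_right) auto
  also have "\<dots> = \<epsilon> powr (2 - p) / (p - 1) * (\<integral>x. grad_prod v u x \<partial>vol) + \<epsilon> powr (- p) * ?U
      + \<epsilon> powr (- p) * \<delta> powr (p / 2) * measure vol K"
    using ints sets.Int_space_eq2[OF sets_vol_closedin[OF closedin_compactin[OF K]]] by simp
  also have "(\<integral>x. grad_prod v u x \<partial>vol) = (\<integral>x. v x * laplacian M u x \<partial>vol)"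
    by (rule green[OF u v K v0])
  also have "\<epsilon> powr (2 - p) / (p - 1) * (\<integral>x. v x * laplacian M u x \<partial>vol)
      = 1 / (p - 1) * (\<integral>x. \<epsilon> powr (2 - p) * (v x * laplacian M u x) \<partial>vol)"
    by simp
  also have "(\<integral>x. \<epsilon> powr (2 - p) * (v x * laplacian M u x) \<partial>vol)
      \<le> (\<integral>x. \<epsilon> powr (- p) * \<bar>u x\<bar> powr p + \<epsilon> powr p * \<bar>laplacian M u x\<bar> powr p \<partial>vol)"
    using ints by (intro integral_mono B Bochner_Integration.integrable_add integrable_mult_right) auto
  also have "\<dots> = \<epsilon> powr (- p) * ?U + \<epsilon> powr p * ?L" using ints by simp
  finally have "(\<integral>x. \<bar>norm_grad M u x\<bar> powr p \<partial>vol) \<le> 1 / (p - 1) * (\<epsilon> powr (- p) * ?U + \<epsilon> powr p * ?L)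
      + \<epsilon> powr (- p) * ?U + \<epsilon> powr (- p) * \<delta> powr (p / 2) * measure vol K"
    using p by (simp add: divide_right_mono)
  moreover have "\<epsilon> powr p * ?L \<ge> 0" by simp
  \<comment> \<open>The summand \<open>1 / (p - 1)\<close> stems from the lower bound for
    \<open>\<phi>'\<close>, the summand 1 from the extra \<open>u\<close> term in \<open>A\<close>,
    completed by a nonnegative Laplacian term.\<close>
  moreover have "(1 / (p - 1) + 1) * (\<epsilon> powr (- p) * ?U + \<epsilon> powr p * ?L) =
      1 / (p - 1) * (\<epsilon> powr (- p) * ?U + \<epsilon> powr p * ?L) + (\<epsilon> powr (- p) * ?U + \<epsilon> powr p * ?L)"
    by (simp only: distrib_right mult_1)
  moreover have "\<epsilon> powr (- p) * \<delta> powr (p / 2) * measure vol K = \<epsilon> powr (- p) * measure vol K * \<delta> powr (p / 2)"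
    by simp
  ultimately show ?thesis by linarith
qed

lemma integral_grad_le_laplacian:
  assumes p: "1 < p" "p \<le> 2" and \<epsilon>: "0 < \<epsilon>"
  shows "(\<integral>x. \<bar>norm_grad M u x\<bar> powr p \<partial>vol) \<le>
    (1 / (p - 1) + 1) * (\<epsilon> powr (- p) * (\<integral>x. \<bar>u x\<bar> powr p \<partial>vol) + \<epsilon> powr p * (\<integral>x. \<bar>laplacian M u x\<bar> powr p \<partial>vol))"
proof (rule le_of_le_add_small)
  fix \<eta> :: real assume \<eta>: "\<eta> > 0"
  \<comment> \<open>With this choice of \<open>\<delta>\<close> the error term is linear in
    \<open>\<eta>\<close>.\<close>
  have "(\<eta> powr (2 / p)) powr (p / 2) = \<eta>" using \<eta> p by (simp add: powr_powr)
  then show "(\<integral>x. \<bar>norm_grad M u x\<bar> powr p \<partial>vol) \<le>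
    (1 / (p - 1) + 1) * (\<epsilon> powr (- p) * (\<integral>x. \<bar>u x\<bar> powr p \<partial>vol) + \<epsilon> powr p * (\<integral>x. \<bar>laplacian M u x\<bar> powr p \<partial>vol))
    + (\<epsilon> powr (- p) * measure vol K) * \<eta>"
    using integral_grad_le_laplacian_regularized[OF p \<epsilon>, of "\<eta> powr (2 / p)"] \<eta> by simp
qed simp

text \<open>Green's formula bounds the weighted integral of |grad u|^2 by terms containing
  \<open>b\<close> |u| |Hess u|, and half of that integral is absorbed on the left. In
  \<open>b\<close>, the root of \<open>n\<close> comes from the Laplacian, and \<open>p - 2\<close>
  is the exponent \<open>e\<close> of the weight times the 2 in front of the Hessian.\<close>

lemma integral_grad_le_hess_regularized:
  fixes p :: real
  defines "b \<equiv> sqrt (real n) + (p - 2)"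
  assumes p: "2 \<le> p" and \<epsilon>: "0 < \<epsilon>" and \<delta>: "0 < \<delta>"
  shows "(\<integral>x. \<bar>norm_grad M u x\<bar> powr p \<partial>vol) \<le>
    (2 * (4 * b) powr (p / 2)) * (\<epsilon> powr (- p) * (\<integral>x. \<bar>u x\<bar> powr p \<partial>vol) + \<epsilon> powr p * (\<integral>x. \<bar>norm_hess M u x\<bar> powr p \<partial>vol))
    + 2 * 2 powr (p / 2) * measure vol K * \<delta> powr (p / 2)"
proof -
  have b: "b \<ge> 0" using p by (simp add: b_def)
  define e where "e = (p - 2) / 2"
  have e0: "e \<ge> 0" using p by (simp add: e_def)
  have e1: "e + 1 = p / 2" by (simp add: e_def field_simps)
  define s where "s = grad_prod u u"
  have s: "C1 s" unfolding s_def by (rule C1_grad_prod[OF u u])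
  have s_nonneg: "s x \<ge> 0" if "x \<in> topspace X" for x using grad_prod_nonneg[OF that] by (simp add: s_def)
  have s0: "s x = 0" if "x \<in> topspace X - K" for x using grad_prod_u_outside[OF that] by (simp add: s_def)
  define \<psi> where "\<psi> = (\<lambda>t. (t + \<delta>) powr e)"
  define \<psi>' where "\<psi>' = (\<lambda>t. e * (t + \<delta>) powr (e - 1))"
  have D: "(\<psi> has_real_derivative \<psi>' (s x)) (at (s x))" if "x \<in> topspace X" for x
    unfolding \<psi>_def \<psi>'_def using s_nonneg[OF that] \<delta>
    by (auto intro!: derivative_eq_intros simp: powr_diff)
  have \<psi>s: "C1 (\<lambda>x. \<psi> (s x))"
  proof (rule C1_compose[OF s D])
    show "continuous_on (s ` topspace X) \<psi>'"
      unfolding \<psi>'_def using s_nonneg \<delta> by (intro continuous_intros) (auto simp: add_nonneg_eq_0_iff)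
  qed
  define v where "v = (\<lambda>x. u x * \<psi> (s x))"
  have v: "C1 v" unfolding v_def by (intro C1_mult smooth_C1[OF u] \<psi>s)
  have v0: "v x = 0" if "x \<in> topspace X - K" for x using u0[OF that] by (simp add: v_def)
  have gv: "grad_prod v u x = u x * (\<psi>' (s x) * grad_prod s u x) + \<psi> (s x) * s x" if x: "x \<in> topspace X" for x
  proof -
    have "grad_prod (\<lambda>x. \<psi> (s x)) u x = \<psi>' (s x) * grad_prod s u x"
      by (rule grad_prod_compose[OF s smooth_C1[OF u] x D])
    moreover have "grad_prod u u x = s x" by (simp add: s_def)
    ultimately show ?thesis
      unfolding v_def grad_prod_mult[OF smooth_C1[OF u] \<psi>s x] by simp
  qed
  have int_gv: "integrable vol (grad_prod v u)"
    by (rule integrable_compact_support[OF K continuous_grad_prod[OF v smooth_C1[OF u]] grad_prod_outside[OF K v0]])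
  have int_vl: "integrable vol (\<lambda>x. v x * laplacian M u x)"
    by (intro integrable_compact_support[OF K] continuous_map_real_mult C1_continuous_map[OF v]
        continuous_laplacian[OF u]) (simp add: v0)
  have int_s: "integrable vol (\<lambda>x. \<psi> (s x) * s x)"
    by (intro integrable_compact_support[OF K] continuous_map_real_mult C1_continuous_map[OF s]
        C1_continuous_map[OF \<psi>s]) (simp add: s0)
  have p0: "0 < p" using p by simp
  note ints = integrable_u_powr[OF p0] integrable_grad_powr[OF p0] integrable_hess_powr[OF p0]
    integrable_indicator_K int_gv int_vl int_s
  let ?q = "p / 2"
  \<comment> \<open>By Green's formula the left side integrates to the same integral of
    \<open>\<psi> (s x) * s x\<close> that carries the factor 1/2 on the right, which is why the
    latter can be absorbed.\<close>
  have A: "v x * laplacian M u x - (grad_prod v u x - \<psi> (s x) * s x) \<le>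
     1 / 2 * (\<psi> (s x) * s x) + (4 * b) powr ?q * (\<epsilon> powr (- p) * \<bar>u x\<bar> powr p + \<epsilon> powr p * \<bar>norm_hess M u x\<bar> powr p)
     + 2 powr ?q * \<delta> powr ?q * indicator K x" if x: "x \<in> space vol" for x
  proof -
    have xX: "x \<in> topspace X" using x by (simp add: space_vol)
    let ?a = "\<bar>u x\<bar>" and ?h = "norm_hess M u x" and ?s = "s x"
    have h: "?h \<ge> 0" by (rule hess_bounds(1)[OF u xX])
    note sx = s_nonneg[OF xX]
    have \<psi>0: "\<psi> ?s \<ge> 0" by (simp add: \<psi>_def)
    \<comment> \<open>The ratio of \<open>s\<close> to \<open>s + \<delta>\<close> is at most 1, so
      \<open>\<psi>'\<close> times \<open>s\<close> is comparable with \<open>\<psi>\<close>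
      itself.\<close>
    have "?s * (?s + \<delta>) powr (e - 1) \<le> (?s + \<delta>) * (?s + \<delta>) powr (e - 1)"
      using \<delta> by (intro mult_right_mono) auto
    also have "\<dots> = \<psi> ?s" using sx \<delta> by (simp add: \<psi>_def powr_diff)
    finally have "e * (?s * (?s + \<delta>) powr (e - 1)) \<le> e * \<psi> ?s" by (intro mult_left_mono e0)
    then have \<psi>'s: "\<psi>' ?s * ?s \<le> e * \<psi> ?s" by (simp add: \<psi>'_def mult_ac)
    have \<psi>'0: "\<psi>' ?s \<ge> 0" using e0 by (simp add: \<psi>'_def)
    have "v x * laplacian M u x - (grad_prod v u x - \<psi> ?s * ?s)
        = u x * \<psi> ?s * laplacian M u x - u x * (\<psi>' ?s * grad_prod s u x)"
      using gv[OF xX] unfolding v_def by simp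
    also have "\<dots> \<le> \<bar>u x * \<psi> ?s * laplacian M u x\<bar> + \<bar>u x * (\<psi>' ?s * grad_prod s u x)\<bar>" by linarith
    also have "\<dots> = ?a * \<psi> ?s * \<bar>laplacian M u x\<bar> + ?a * (\<psi>' ?s * \<bar>grad_prod s u x\<bar>)"
      using \<psi>0 \<psi>'0 by (simp add: abs_mult)
    also have "\<dots> \<le> ?a * \<psi> ?s * (sqrt (real n) * ?h) + ?a * (\<psi>' ?s * (2 * ?h * ?s))"
      unfolding s_def using hess_bounds(2,3)[OF u xX] \<psi>0 \<psi>'0
      by (intro add_mono mult_left_mono) (auto simp: s_def)
    also have "?a * (\<psi>' ?s * (2 * ?h * ?s)) = ?a * (2 * ?h) * (\<psi>' ?s * ?s)" by simp
    also have "\<dots> \<le> ?a * (2 * ?h) * (e * \<psi> ?s)" using h by (intro mult_left_mono[OF \<psi>'s]) auto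
    also have "?a * \<psi> ?s * (sqrt (real n) * ?h) + ?a * (2 * ?h) * (e * \<psi> ?s) = (sqrt (real n) + 2 * e) * (?a * ?h) * \<psi> ?s"
      by (simp add: algebra_simps)
    also have "sqrt (real n) + 2 * e = b" by (simp add: b_def e_def)
    finally have main: "v x * laplacian M u x - (grad_prod v u x - \<psi> ?s * ?s) \<le> b * (?a * ?h) * \<psi> ?s" by simp
    have ah: "(?a * ?h) powr ?q \<le> \<epsilon> powr (- p) * ?a powr p + \<epsilon> powr p * \<bar>?h\<bar> powr p"
    proof -
      have "?a * ?h = (?a / \<epsilon>) * (\<epsilon> * ?h)" using \<epsilon> by simp
      then have "(?a * ?h) powr ?q \<le> (?a / \<epsilon>) powr (2 * ?q) + (\<epsilon> * ?h) powr (2 * ?q)"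
        using powr_mult_le[of "?a / \<epsilon>" "\<epsilon> * ?h" ?q] \<epsilon> h p by simp
      also have "\<dots> = \<epsilon> powr (- p) * ?a powr p + \<epsilon> powr p * \<bar>?h\<bar> powr p"
        using \<epsilon> h by (simp add: powr_divide powr_mult powr_minus field_simps)
      finally show ?thesis .
    qed
    have "b * (?a * ?h) * \<psi> ?s \<le> 1 / 2 * (\<psi> ?s * ?s) + (4 * b) powr ?q * (?a * ?h) powr ?q
        + 2 powr ?q * \<delta> powr ?q * indicator K x"
    \<comment> \<open>Either the product is at most half of \<open>s\<close> and goes into the
      absorbed term, or \<open>s\<close> is below twice the product and can be eliminated from the
      weight.\<close>
    proof (cases "b * (?a * ?h) \<le> ?s / 2")
      case True
      then have "b * (?a * ?h) * \<psi> ?s \<le> ?s / 2 * \<psi> ?s" using \<psi>0 by (rule mult_right_mono)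
      then have "b * (?a * ?h) * \<psi> ?s \<le> 1 / 2 * (\<psi> ?s * ?s)" by (simp only: mult_ac times_divide_eq_right mult_1)
      moreover have "0 \<le> (4 * b) powr ?q * (?a * ?h) powr ?q" by simp
      moreover have "0 \<le> 2 powr ?q * \<delta> powr ?q * indicator K x" by simp
      ultimately show ?thesis by linarith
    next
      case False
      let ?t = "2 * b * (?a * ?h)"
      have t: "?t \<ge> 0" "b * (?a * ?h) \<ge> 0" using b h by simp_all
      \<comment> \<open>If \<open>u x\<close> were 0, the product would be 0 and not exceed half of
        the nonnegative \<open>s\<close>. So the point lies in \<open>K\<close>, where the
        \<open>\<delta>\<close> term is available.\<close>
      have "u x \<noteq> 0" using False sx by auto
      then have xK: "x \<in> K" using u0 xX by blast
      have "\<psi> ?s \<le> (?t + \<delta>) powr e"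
        unfolding \<psi>_def using False sx \<delta> e0 by (intro powr_mono2) auto
      then have "b * (?a * ?h) * \<psi> ?s \<le> (?t + \<delta>) * (?t + \<delta>) powr e"
        using t \<delta> \<psi>0 by (intro mult_mono) auto
      also have "\<dots> = (?t + \<delta>) powr ?q"
        unfolding e1[symmetric] using t \<delta> by (subst powr_mult_base) (auto simp: add.commute)
      also have "\<dots> \<le> 2 powr ?q * (?t powr ?q + \<delta> powr ?q)"
        using t \<delta> p by (intro powr_add_le_2) auto
      also have "\<dots> = (2 * ?t) powr ?q + 2 powr ?q * \<delta> powr ?q"
        by (simp only: powr_mult[of 2 ?t] distrib_left)
      \<comment> \<open>The 4 is the 2 of the case distinction times the 2 of
        \<open>powr_add_le_2\<close>.\<close>
      also have "(2 * ?t) powr ?q = (4 * b) powr ?q * (?a * ?h) powr ?q"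
        by (simp add: powr_mult[symmetric] mult.assoc)
      finally have "b * (?a * ?h) * \<psi> ?s \<le> (4 * b) powr ?q * (?a * ?h) powr ?q + 2 powr ?q * \<delta> powr ?q" .
      moreover have "0 \<le> 1 / 2 * (\<psi> ?s * ?s)" using sx \<psi>0 by simp
      moreover have "2 powr ?q * \<delta> powr ?q * indicator K x = 2 powr ?q * \<delta> powr ?q" using xK by simp
      ultimately show ?thesis by linarith
    qed
    also have "(4 * b) powr ?q * (?a * ?h) powr ?q
        \<le> (4 * b) powr ?q * (\<epsilon> powr (- p) * ?a powr p + \<epsilon> powr p * \<bar>?h\<bar> powr p)"
      by (intro mult_left_mono ah) auto
    finally show ?thesis using main by simp
  qed
  let ?U = "\<integral>x. \<bar>u x\<bar> powr p \<partial>vol" and ?H = "\<integral>x. \<bar>norm_hess M u x\<bar> powr p \<partial>vol"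
  let ?S = "\<integral>x. \<psi> (s x) * s x \<partial>vol"
  have "?S = (\<integral>x. v x * laplacian M u x - (grad_prod v u x - \<psi> (s x) * s x) \<partial>vol)"
    using ints green[OF u v K v0] by simp
  also have "\<dots> \<le> (\<integral>x. 1 / 2 * (\<psi> (s x) * s x)
     + (4 * b) powr ?q * (\<epsilon> powr (- p) * \<bar>u x\<bar> powr p + \<epsilon> powr p * \<bar>norm_hess M u x\<bar> powr p)
     + 2 powr ?q * \<delta> powr ?q * indicator K x \<partial>vol)"
    using ints by (intro integral_mono A Bochner_Integration.integrable_add
        Bochner_Integration.integrable_diff integrable_mult_right) auto
  also have "\<dots> = 1 / 2 * ?S + (4 * b) powr ?q * (\<epsilon> powr (- p) * ?U + \<epsilon> powr p * ?H)
      + 2 powr ?q * \<delta> powr ?q * measure vol K"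
    using ints sets.Int_space_eq2[OF sets_vol_closedin[OF closedin_compactin[OF K]]] by simp
  finally have S: "?S \<le> 2 * (4 * b) powr ?q * (\<epsilon> powr (- p) * ?U + \<epsilon> powr p * ?H)
      + 2 * 2 powr ?q * measure vol K * \<delta> powr ?q"
    by (simp add: algebra_simps)
  \<comment> \<open>The exponent \<open>e\<close> is nonnegative here, so adding
    \<open>\<delta>\<close> only increases the weight.\<close>
  have "(\<integral>x. \<bar>norm_grad M u x\<bar> powr p \<partial>vol) \<le> ?S"
  proof (intro integral_mono ints)
    fix x assume "x \<in> space vol"
    then have xX: "x \<in> topspace X" by (simp add: space_vol)
    have "\<bar>norm_grad M u x\<bar> powr p = s x powr ?q"
      using powr_square[of "norm_grad M u x" ?q] norm_grad_square[OF u xX] by (simp add: s_def)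
    also have "\<dots> = s x powr e * s x"
      unfolding e1[symmetric] using s_nonneg[OF xX] powr_mult_base[of "s x" e] by (simp add: mult.commute add.commute)
    also have "\<dots> \<le> \<psi> (s x) * s x"
      unfolding \<psi>_def using s_nonneg[OF xX] \<delta> e0 by (intro mult_right_mono powr_mono2) auto
    finally show "\<bar>norm_grad M u x\<bar> powr p \<le> \<psi> (s x) * s x" .
  qed
  with S show ?thesis by linarith
qed

lemma integral_grad_le_hess:
  assumes p: "2 \<le> p" and \<epsilon>: "0 < \<epsilon>"
  shows "(\<integral>x. \<bar>norm_grad M u x\<bar> powr p \<partial>vol) \<le> (2 * (4 * (sqrt (real n) + (p - 2))) powr (p / 2)) *
    (\<epsilon> powr (- p) * (\<integral>x. \<bar>u x\<bar> powr p \<partial>vol) + \<epsilon> powr p * (\<integral>x. \<bar>norm_hess M u x\<bar> powr p \<partial>vol))"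
proof (rule le_of_le_add_small)
  fix \<eta> :: real assume \<eta>: "\<eta> > 0"
  have "(\<eta> powr (2 / p)) powr (p / 2) = \<eta>" using \<eta> p by (simp add: powr_powr)
  then show "(\<integral>x. \<bar>norm_grad M u x\<bar> powr p \<partial>vol) \<le> (2 * (4 * (sqrt (real n) + (p - 2))) powr (p / 2)) *
    (\<epsilon> powr (- p) * (\<integral>x. \<bar>u x\<bar> powr p \<partial>vol) + \<epsilon> powr p * (\<integral>x. \<bar>norm_hess M u x\<bar> powr p \<partial>vol))
    + (2 * 2 powr (p / 2) * measure vol K) * \<eta>"
    using integral_grad_le_hess_regularized[OF p \<epsilon>, of "\<eta> powr (2 / p)"] \<eta> by simp
qed simp

end

lemma Cc_inftyD:
  assumes "u \<in> Cc_infty M"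
  obtains K where "smooth u" "compactin X K" "\<And>x. x \<in> topspace X - K \<Longrightarrow> u x = 0"
proof (rule that)
  let ?K = "Abstract_Topology.closure_of X {x \<in> topspace X. u x \<noteq> 0}"
  show "smooth u" "compactin X ?K" using assms by (auto simp: Cc_infty_def smooth_def)
  show "u x = 0" if "x \<in> topspace X - ?K" for x
    using that closure_of_subset[of "{x \<in> topspace X. u x \<noteq> 0}" X] by blast
qed

end

theorem proposition3p12:
  shows
    "(\<forall>(n::nat) (p::real). 2 \<le> p \<longrightarrow>
        (\<exists>C>0. \<forall>(M :: 'a riem) vol. riemannian_manifold M \<and> mdim M = n \<and> riemannian_volume M vol \<longrightarrow>
           (\<forall>\<epsilon>>0. \<forall>u\<in>Cc_infty M.
              Lp_norm vol p (norm_grad M u)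
                \<le> C / \<epsilon> * Lp_norm vol p u + C * \<epsilon> * Lp_norm vol p (norm_hess M u)))) \<and>
     (\<forall>p::real. 1 < p \<and> p \<le> 2 \<longrightarrow>
        (\<exists>C>0. \<forall>(M :: 'a riem) vol. riemannian_manifold M \<and> riemannian_volume M vol \<and>
             (geodesically_complete M \<or>
              (\<exists>N. riemannian_manifold N \<and> relatively_compact_open_in M N)) \<longrightarrow>
           (\<forall>\<epsilon>>0. \<forall>u\<in>Cc_infty M.
              Lp_norm vol p (norm_grad M u)
                \<le> C / \<epsilon> * Lp_norm vol p u + C * \<epsilon> * Lp_norm vol p (laplacian M u))))"
proof (intro conjI allI impI)
  fix n :: nat and p :: real assume p: "2 \<le> p"
  \<comment> \<open>The dimension enters through the bound of the Laplacian by the Hessian, so this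
    constant depends on \<open>n\<close> as well as on \<open>p\<close>. The summand 1 keeps it
    positive when \<open>n = 0\<close> and \<open>p = 2\<close>.\<close>
  define C where "C = 2 * (4 * (sqrt (real n) + (p - 2))) powr (p / 2) + 1"
  have C: "C > 0" by (simp add: C_def add_nonneg_pos)
  show "\<exists>C>0. \<forall>(M :: 'a riem) vol. riemannian_manifold M \<and> mdim M = n \<and> riemannian_volume M vol \<longrightarrow>
           (\<forall>\<epsilon>>0. \<forall>u\<in>Cc_infty M. Lp_norm vol p (norm_grad M u)
                \<le> C / \<epsilon> * Lp_norm vol p u + C * \<epsilon> * Lp_norm vol p (norm_hess M u))"
  proof (intro exI[of _ "C powr (1 / p)"] conjI allI impI ballI)
    show "C powr (1 / p) > 0" using C by simp
    fix M :: "'a riem" and vol \<epsilon> u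
    assume M: "riemannian_manifold M \<and> mdim M = n \<and> riemannian_volume M vol" and \<epsilon>: "0 < (\<epsilon>::real)"
      and u: "u \<in> Cc_infty M"
    then interpret riemannian_with_volume M vol by unfold_locales auto
    obtain K where K: "smooth u" "compactin (mtop M) K" "\<And>x. x \<in> topspace (mtop M) - K \<Longrightarrow> u x = 0"
      using Cc_inftyD[OF u] by blast
    let ?R = "\<epsilon> powr (- p) * (\<integral>x. \<bar>u x\<bar> powr p \<partial>vol) + \<epsilon> powr p * (\<integral>x. \<bar>norm_hess M u x\<bar> powr p \<partial>vol)"
    have "(\<integral>x. \<bar>norm_grad M u x\<bar> powr p \<partial>vol) \<le> (C - 1) * ?R"
      using integral_grad_le_hess[OF K p \<epsilon>] M by (simp add: C_def)
    also have "\<dots> \<le> C * ?R" by (intro mult_right_mono add_nonneg_nonneg mult_nonneg_nonneg) auto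
    finally show "Lp_norm vol p (norm_grad M u)
        \<le> C powr (1 / p) / \<epsilon> * Lp_norm vol p u + C powr (1 / p) * \<epsilon> * Lp_norm vol p (norm_hess M u)"
      using p C \<epsilon> by (intro Lp_norm_interpolate) auto
  qed
next
  fix p :: real assume p: "1 < p \<and> p \<le> 2"
  \<comment> \<open>No dimension occurs: the Laplacian is kept and never compared with the
    Hessian.\<close>
  define C where "C = 1 / (p - 1) + 1"
  have C: "C > 0" using p by (simp add: C_def add_pos_pos)
  show "\<exists>C>0. \<forall>(M :: 'a riem) vol. riemannian_manifold M \<and> riemannian_volume M vol \<and>
             (geodesically_complete M \<or> (\<exists>N. riemannian_manifold N \<and> relatively_compact_open_in M N)) \<longrightarrow>
           (\<forall>\<epsilon>>0. \<forall>u\<in>Cc_infty M. Lp_norm vol p (norm_grad M u)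
                \<le> C / \<epsilon> * Lp_norm vol p u + C * \<epsilon> * Lp_norm vol p (laplacian M u))"
  proof (intro exI[of _ "C powr (1 / p)"] conjI allI impI ballI)
    show "C powr (1 / p) > 0" using C by simp
    fix M :: "'a riem" and vol \<epsilon> u
    assume M: "riemannian_manifold M \<and> riemannian_volume M vol \<and>
        (geodesically_complete M \<or> (\<exists>N. riemannian_manifold N \<and> relatively_compact_open_in M N))"
      and \<epsilon>: "0 < (\<epsilon>::real)" and u: "u \<in> Cc_infty M"
    then interpret riemannian_with_volume M vol by unfold_locales auto
    obtain K where K: "smooth u" "compactin (mtop M) K" "\<And>x. x \<in> topspace (mtop M) - K \<Longrightarrow> u x = 0"
      using Cc_inftyD[OF u] by blast
    show "Lp_norm vol p (norm_grad M u)
        \<le> C powr (1 / p) / \<epsilon> * Lp_norm vol p u + C powr (1 / p) * \<epsilon> * Lp_norm vol p (laplacian M u)"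
      using p C \<epsilon> integral_grad_le_laplacian[OF K _ _ \<epsilon>, of p]
      by (intro Lp_norm_interpolate) (auto simp: C_def)
  qed
qed

end
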